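(* Let $a$ and $c$ be nonzero complex numbers such that $c(c-a)\in\mathbb{R}$ and $|c|\ge 2|c-a|$. Then there is a finite positive Borel measure $d\mu_{a,c}$ with compact support in $\mathbb{R}^2$ with respect to which the polynomials $Q_k^m(z,\bar z)$, $0\le k\le m$, $m\ge 0$, are orthogonal. Furthermore, for the integral against $d\mu_{a,c}$, the Gaussian cubature rule of degree $2m-1$ exists for all $m\in\mathbb{N}$.
   Context: Here $z=x+iy$, $\bar z=x-iy$ with $(x,y)\in\mathbb{R}^2$, and $\mathbb{N}=\{1,2,\dots\}$. For complex numbers $a,c$ and $m\ge 1$, $A^{a,c}_{m,m+1}(z,\bar z)$ is the $m\times(m+1)$ matrix with rows indexed by $i=0,\dots,m-1$ and columns indexed by $j=0,\dots,m$ whose entries are: $z$ at positions $(i,i)$; $\bar z$ at positions $(i,i+1)$; at positions $(i,i+2)$ with $i+2\le m$ the entry is $\bar c$, except that it is $\bar a$ when $i=0$; at positions $(i,i-1)$ with $i\ge1$ the entry is $c$, except that it is $a$ when $i=m-1$; all other entries are $0$. (For $m=1$ the matrix is $[\,z\ \ \bar z\,]$, and for $m=2$ its rows are $(z,\bar z,\bar a)$ and $(a,z,\bar z)$.) For $0\le k\le m$, $Q_k^m(z,\bar z)$ is the determinant of the $m\times m$ matrix obtained from $A^{a,c}_{m,m+1}(z,\bar z)$ by deleting the column with index $m-k$ (columns indexed $0,\dots,m$); $Q_0^0=1$. Its leading term is $z^{m-k}\bar z^k$. The polynomials $Q_k^m$ are orthogonal with respect to $d\mu$ if $\int Q_k^m(z,\bar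 z)\,\overline{R(z,\bar z)}\,d\mu=0$ for all $0\le k\le m$ and all polynomials $R$ in $z,\bar z$ (complex coefficients) of total degree at most $m-1$; polynomials of the same degree need not be mutually orthogonal. The measure is normalized so that $\int 1\,d\mu=1$. Let $\Pi_n^2$ be the space of real polynomials of total degree at most $n$ in two real variables. A Gaussian cubature rule of degree $2m-1$ for $d\mu$ is a formula $$\int_{\mathbb{R}^2} f\,d\mu=\sum_{k=1}^N\lambda_k f(x_k)\quad\text{for all } f\in\Pi_{2m-1}^2,$$ with distinct nodes $x_k\in\mathbb{R}^2$, weights $\lambda_k\neq0$, and $N=\dim\Pi_{m-1}^2=\binom{m+1}{2}$ (the minimal possible number of nodes). *)

theory Defs
  imports "HOL-Probability.Probability_Measure" "Jordan_Normal_Form.Determinant"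
begin

text \<open>
  The plane is \<^typ>\<open>real \<times> real\<close>; the point \<open>(x, y)\<close> corresponds to \<open>z = x + i y\<close>.
\<close>

definition cplx :: "real \<times> real \<Rightarrow> complex" where
  "cplx p = Complex (fst p) (snd p)"

definition A_mat :: "complex \<Rightarrow> complex \<Rightarrow> nat \<Rightarrow> complex \<Rightarrow> complex mat" where
  "A_mat a c m z = mat m (m + 1) (\<lambda>(i, j).
     if j = i then z
     else if j = i + 1 then cnj z
     else if j = i + 2 then (if i = 0 then cnj a else cnj c)
     else if i = j + 1 then (if i = m - 1 then a else c)
     else 0)"

definition delete_col :: "nat \<Rightarrow> 'a mat \<Rightarrow> 'a mat" where
  "delete_col l B = mat (dim_row B) (dim_col B - 1)
     (\<lambda>(i, j). B $$ (i, if j < l then j else Suc j))"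

text \<open>
  For \<open>m = 0\<close> the matrix is the empty one, with determinant \<open>1\<close>, so that \<open>Q\<^sub>0\<^sup>0 = 1\<close>.
\<close>

definition Q_poly :: "complex \<Rightarrow> complex \<Rightarrow> nat \<Rightarrow> nat \<Rightarrow> complex \<Rightarrow> complex" where
  "Q_poly a c m k z = Determinant.det (delete_col (m - k) (A_mat a c m z))"

text \<open>
  Polynomial functions in \<open>z\<close> and its conjugate of total degree strictly less than \<open>m\<close>;
  the strict bound makes the case \<open>m = 0\<close> the zero polynomial only (degree at most \<open>-1\<close>).
\<close>

definition zpolys_less :: "nat \<Rightarrow> (complex \<Rightarrow> complex) set" where
  "zpolys_less m = {R. \<exists>r :: nat \<Rightarrow> nat \<Rightarrow> complex.
     R = (\<lambda>z. \<Sum>i<m. \<Sum>j<m - i. r i j * z ^ i * cnj z ^ j)}"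

definition Q_orthogonal :: "complex \<Rightarrow> complex \<Rightarrow> (real \<times> real) measure \<Rightarrow> bool" where
  "Q_orthogonal a c M \<longleftrightarrow>
     (\<forall>m k. k \<le> m \<longrightarrow> (\<forall>R \<in> zpolys_less m.
        (LINT p|M. Q_poly a c m k (cplx p) * cnj (R (cplx p))) = 0))"

definition real_polys2 :: "nat \<Rightarrow> (real \<times> real \<Rightarrow> real) set" where
  "real_polys2 n = {f. \<exists>b :: nat \<Rightarrow> nat \<Rightarrow> real.
     f = (\<lambda>(x, y). \<Sum>i\<le>n. \<Sum>j\<le>n - i. b i j * x ^ i * y ^ j)}"

definition measure_support :: "'a::topological_space measure \<Rightarrow> 'a set" where
  "measure_support M = {x. \<forall>U. open U \<and> x \<in> U \<longrightarrow> emeasure M U > 0}"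

text \<open>
  \<open>(m + 1) choose 2\<close> is the dimension of \<^term>\<open>real_polys2 (m - 1)\<close>, for \<open>m \<ge> 1\<close>.
\<close>

definition gaussian_cubature_exists :: "(real \<times> real) measure \<Rightarrow> nat \<Rightarrow> bool" where
  "gaussian_cubature_exists M m \<longleftrightarrow>
     (\<exists>(N :: nat) (node :: nat \<Rightarrow> real \<times> real) (wt :: nat \<Rightarrow> real).
        N = (m + 1) choose 2 \<and>
        inj_on node {1..N} \<and>
        (\<forall>k \<in> {1..N}. wt k \<noteq> 0) \<and>
        (\<forall>f \<in> real_polys2 (2 * m - 1).
           (LINT p|M. f p) = (\<Sum>k = 1..N. wt k * f (node k))))"

end

theory Submission
  imports
    Defs
    "HOL-Complex_Analysis.Cauchy_Integral_Formula"
    "HOL-Computational_Algebra.Fundamental_Theorem_Algebra"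
    "HOL-Library.Function_Algebras"
begin

text \<open>
  Write \<open>c - a = e c\<close>, so \<open>|e| \<le> 1/2\<close>, choose \<open>\<kappa>\<close> with \<open>\<kappa>\<^sup>3 = c |c|\<^sup>2\<close>, and parametrise
  \<open>z = \<kappa> (u + v + w)\<close> by unimodular \<open>u, v, w\<close> with \<open>u v w = 1\<close>. As for the Chebyshev
  polynomials of the deltoid (\<open>e = 0\<close>), recurrences for the banded determinants show that \<open>Q\<close> times the
  Vandermonde product is, up to a constant, the antisymmetrisation over the permutations of \<open>u, v, w\<close> of
  \<open>u\<^bsup>m-k+1\<^esup> w\<^bsup>-(k+1)\<^esup> (1 - cnj e u\<^bsup>-3\<^esup>) (1 - e w\<^sup>3)\<close>.
  Take for \<open>\<mu>\<close> the image of Haar measure on the torus with density the squared modulus of the Vandermonde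
  product divided by that of \<open>(1 - e u\<^sup>3) (1 - e v\<^sup>3) (1 - e w\<^sup>3)\<close>. Integrated against a polynomial of degree
  below \<open>m\<close>, each of the six terms becomes, with \<open>v\<close> fixed, a circle mean of a holomorphic function of
  \<open>u\<close> vanishing at \<open>0\<close>; hence \<open>Q\<close> is orthogonal to lower degrees.

  For the cubature, let \<open>T\<close> be multiplication by \<open>z\<close> followed by the orthogonal projection onto the
  polynomials of degree below \<open>m\<close>. The cofactor relation among the \<open>Q\<close>'s of degree \<open>m\<close> makes \<open>T\<close> normal,
  so it has an orthogonal eigenbasis; its eigenvalues are the nodes.
\<close>

subsection \<open>Normal operators on Hermitian spaces\<close>

text \<open>The constant \<kappa> comes from a recurrence. Expanding a banded minor along its first
  column gives a linear recurrence with characteristic polynomial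
  \<open>X^3 - z X^2 + c (cnj z) X - c^2 (cnj c)\<close>. Asking for roots \<kappa> u, \<kappa> v,
  \<kappa> w with u v w = 1 fixes the cube of \<kappa>, and with unimodular u, v, w the middle
  coefficient then fits because \<open>c * cnj \<kappa> = \<kappa>\<^sup>2\<close>. The entries
  \<open>a\<close> and \<open>cnj a\<close> disturb the recurrence only at its two ends: the one in
  the last row produces the factor \<open>1 - e w^3\<close>, the one in the first row the factor
  \<open>1 - cnj e / u^3\<close>. The denominator of the density is chosen to meet exactly these
  factors. They cancel the part of the weight with poles inside the disc, and the remaining poles
  lie outside since |e| < 1. For the cubature, the Q's of one degree need not be mutually
  orthogonal, and no description of their common zeros is used. The spectral route replaces it:
  eigenvalues of a normal operator are points of the plane, and they are distinct because an
  eigenfunction cannot vanish at its own node.\<close>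

locale hermitian_space = vector_space scale
  for scale :: "complex \<Rightarrow> 'b::ab_group_add \<Rightarrow> 'b" (infixr \<open>\<star>\<close> 75) +
  fixes V :: "'b set" and ip :: "'b \<Rightarrow> 'b \<Rightarrow> complex"
  assumes subspace_V: "subspace V"
    and finite_dim: "\<exists>B. finite B \<and> V \<subseteq> span B"
    and ip_add: "\<lbrakk>f \<in> V; g \<in> V; h \<in> V\<rbrakk> \<Longrightarrow> ip (f + g) h = ip f h + ip g h"
    and ip_scale: "\<lbrakk>f \<in> V; h \<in> V\<rbrakk> \<Longrightarrow> ip (k \<star> f) h = k * ip f h"
    and ip_commute: "\<lbrakk>f \<in> V; g \<in> V\<rbrakk> \<Longrightarrow> ip g f = cnj (ip f g)"
    and ip_definite: "\<lbrakk>f \<in> V; ip f f = 0\<rbrakk> \<Longrightarrow> f = 0"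
begin

lemmas V_closed = subspace_add[OF subspace_V] subspace_diff[OF subspace_V]
  subspace_scale[OF subspace_V] subspace_0[OF subspace_V]

lemma ip_zero_left: "h \<in> V \<Longrightarrow> ip 0 h = 0"
  using ip_scale[of 0 h 0] V_closed by simp

lemma ip_diff:
  assumes "f \<in> V" "g \<in> V" "h \<in> V"
  shows "ip (f - g) h = ip f h - ip g h"
  using ip_add[of "f - g" g h] V_closed assms by simp

lemma ip_add_right:
  assumes "f \<in> V" "g \<in> V" "h \<in> V"
  shows "ip h (f + g) = ip h f + ip h g"
  using assms V_closed by (simp add: ip_commute[of _ h] ip_add)

lemma ip_scale_right:
  assumes "f \<in> V" "h \<in> V"
  shows "ip h (k \<star> f) = cnj k * ip h f"
  using assms V_closed by (simp add: ip_commute[of _ h] ip_scale)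

lemma ip_diff_right:
  assumes "f \<in> V" "g \<in> V" "h \<in> V"
  shows "ip h (f - g) = ip h f - ip h g"
  using ip_add_right[of "f - g" g h] V_closed assms by simp

lemma ip_sum:
  assumes "\<And>i. i \<in> A \<Longrightarrow> f i \<in> V" "h \<in> V"
  shows "ip (\<Sum>i\<in>A. f i) h = (\<Sum>i\<in>A. ip (f i) h)"
  using assms(1)
proof (induction A rule: infinite_finite_induct)
  case (insert x A)
  then have "(\<Sum>i\<in>A. f i) \<in> V" by (intro subspace_sum[OF subspace_V]) auto
  then show ?case using insert assms(2) by (simp add: ip_add)
qed (use assms(2) ip_zero_left in auto)

text \<open>Excluding \<open>0\<close> makes every \<open>ip e e\<close> with \<open>e\<close> in
  the set invertible, by \<open>ip_definite\<close>. This takes the place of positivity of the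
  form.\<close>

definition orthogonal_set :: "'b set \<Rightarrow> bool" where
  "orthogonal_set E \<longleftrightarrow> E \<subseteq> V \<and> 0 \<notin> E \<and> (\<forall>e\<in>E. \<forall>e'\<in>E. e \<noteq> e' \<longrightarrow> ip e e' = 0)"

lemma ip_orthogonal_sum:
  assumes E: "orthogonal_set E" and fin: "finite A" "A \<subseteq> E" and e: "e \<in> A"
  shows "ip (\<Sum>x\<in>A. u x \<star> x) e = u e * ip e e"
proof -
  have AV: "A \<subseteq> V" using E fin by (auto simp: orthogonal_set_def)
  have "ip (\<Sum>x\<in>A. u x \<star> x) e = (\<Sum>x\<in>A. u x * ip x e)"
    using AV e by (subst ip_sum) (auto simp: ip_scale subset_iff intro!: V_closed sum.cong)
  also have "\<dots> = (\<Sum>x\<in>A. if x = e then u e * ip e e else 0)"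
    using E fin e by (intro sum.cong) (auto simp: orthogonal_set_def subset_iff)
  also have "\<dots> = u e * ip e e" using fin e by simp
  finally show ?thesis .
qed

lemma independent_orthogonal_set:
  assumes "orthogonal_set E"
  shows "independent E"
  unfolding independent_explicit_module
proof (intro allI impI)
  fix A u v
  assume fin: "finite A" "A \<subseteq> E" and s: "(\<Sum>v\<in>A. u v \<star> v) = 0" and v: "v \<in> A"
  have vV: "v \<in> V" "v \<noteq> 0" using v fin assms by (auto simp: orthogonal_set_def)
  have "u v * ip v v = 0"
    using ip_orthogonal_sum[OF assms fin v, of u] s ip_zero_left vV by simp
  then show "u v = 0" using ip_definite vV by auto
qed

lemma finite_orthogonal_set:
  assumes "orthogonal_set E" "finite B" "V \<subseteq> span B"
  shows "finite E \<and> card E \<le> card B"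
  by (rule independent_span_bound)
    (use assms independent_orthogonal_set in \<open>auto simp: orthogonal_set_def\<close>)

end

section \<open>Spectral theorem for normal operators in finite dimension\<close>

locale normal_operator = hermitian_space scale V ip
  for scale :: "complex \<Rightarrow> 'b::ab_group_add \<Rightarrow> 'b" (infixr \<open>\<star>\<close> 75) and V ip +
  fixes T S :: "'b \<Rightarrow> 'b"
  assumes T_in: "f \<in> V \<Longrightarrow> T f \<in> V" and S_in: "f \<in> V \<Longrightarrow> S f \<in> V"
    and T_add: "\<lbrakk>f \<in> V; g \<in> V\<rbrakk> \<Longrightarrow> T (f + g) = T f + T g"
    and T_scale: "f \<in> V \<Longrightarrow> T (k \<star> f) = k \<star> T f"
    and adjoint: "\<lbrakk>f \<in> V; g \<in> V\<rbrakk> \<Longrightarrow> ip (T f) g = ip f (S g)"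
    and commute: "f \<in> V \<Longrightarrow> T (S f) = S (T f)"
begin

lemma T_pow_in: "f \<in> V \<Longrightarrow> (T ^^ i) f \<in> V"
  by (induction i) (auto intro: T_in)

lemma T_diff_scale:
  assumes "f \<in> V" "g \<in> V"
  shows "T (f - k \<star> g) = T f - k \<star> T g"
proof -
  have "T (f - k \<star> g) = T (f + (-k) \<star> g)" by simp
  also have "\<dots> = T f + (-k) \<star> T g" using assms V_closed(3)[of g "-k"] T_add[of f "(-k) \<star> g"] T_scale[of g "-k"] by simp
  finally show ?thesis by simp
qed

lemma T_pow_diff_scale:
  assumes "f \<in> V" "g \<in> V"
  shows "(T ^^ i) (f - k \<star> g) = (T ^^ i) f - k \<star> (T ^^ i) g"
  using assms by (induction i) (auto simp: T_diff_scale T_pow_in)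

text \<open>The \<open>n + 1\<close> iterates from \<open>f\<close> to \<open>(T ^^ n) f\<close> lie
  in the span of \<open>n\<close> vectors, so they satisfy a linear relation, whose coefficients
  form the polynomial. This does the work of a characteristic polynomial without a matrix for
  \<open>T\<close>.\<close>

lemma annihilating_poly:
  assumes f: "f \<in> V"
  shows "\<exists>p :: complex poly. p \<noteq> 0 \<and> (\<Sum>i\<le>degree p. coeff p i \<star> (T ^^ i) f) = 0"
proof -
  obtain B where B: "finite B" "V \<subseteq> span B" using finite_dim by blast
  define n where "n = card B"
  have "\<exists>p :: complex poly. p \<noteq> 0 \<and> degree p \<le> n \<and> (\<Sum>i\<le>n. coeff p i \<star> (T ^^ i) f) = 0"
  \<comment> \<open>Dependence is a property of sets, which do not see a repeated iterate. A
    repetition gives the relation X^i - X^j directly.\<close>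
  proof (cases "inj_on (\<lambda>i. (T ^^ i) f) {..n}")
    case False
    then obtain i j where ij: "i \<le> n" "j \<le> n" "i \<noteq> j" "(T ^^ i) f = (T ^^ j) f"
      by (auto simp: inj_on_def)
    let ?p = "monom 1 i - monom 1 j :: complex poly"
    have c: "coeff ?p k = (if k = i then 1 else 0) - (if k = j then 1 else 0)" for k
      by (auto simp: coeff_monom)
    have "coeff ?p i \<noteq> 0" using ij by (simp add: c)
    then have "?p \<noteq> 0" by force
    moreover have "degree ?p \<le> n"
      using ij by (intro degree_diff_le) (auto intro: order_trans[OF degree_monom_le])
    moreover have "(\<Sum>k\<le>n. coeff ?p k \<star> (T ^^ k) f)
        = (\<Sum>k\<le>n. (if k = i then (T ^^ i) f else 0) - (if k = j then (T ^^ j) f else 0))"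
      unfolding c using ij by (intro sum.cong) (auto simp: scale_left_diff_distrib)
    then have "(\<Sum>k\<le>n. coeff ?p k \<star> (T ^^ k) f) = 0"
      using ij by (simp add: sum_subtractf)
    ultimately show ?thesis by blast
  next
    case True
    let ?F = "(\<lambda>i. (T ^^ i) f) ` {..n}"
    have "card ?F = Suc n" using True by (simp add: card_image)
    moreover have "?F \<subseteq> span B" using B T_pow_in f by auto
    ultimately have "dependent ?F"
      using independent_span_bound[OF B(1), of ?F] by (auto simp: n_def)
    then obtain u v where uv: "v \<in> ?F" "u v \<noteq> 0" "(\<Sum>v\<in>?F. u v \<star> v) = 0"
      using dependent_finite[of ?F] by auto
    define p where "p = (\<Sum>i\<le>n. monom (u ((T ^^ i) f)) i)"
    have c: "coeff p k = (if k \<le> n then u ((T ^^ k) f) else 0)" for k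
      unfolding p_def coeff_sum by (simp add: coeff_monom if_distrib cong: if_cong)
    obtain k where "k \<le> n" "v = (T ^^ k) f" using uv by auto
    then have "coeff p k \<noteq> 0" using uv c by simp
    then have "p \<noteq> 0" by force
    moreover have "degree p \<le> n" by (rule degree_le) (simp add: c)
    moreover have "(\<Sum>i\<le>n. coeff p i \<star> (T ^^ i) f) = 0"
      using uv(3) by (simp add: sum.reindex[OF True] c)
    ultimately show ?thesis by blast
  qed
  then obtain p :: "complex poly" where p: "p \<noteq> 0" "degree p \<le> n"
    "(\<Sum>i\<le>n. coeff p i \<star> (T ^^ i) f) = 0" by blast
  have "(\<Sum>i\<le>degree p. coeff p i \<star> (T ^^ i) f) = (\<Sum>i\<le>n. coeff p i \<star> (T ^^ i) f)"
    using p by (intro sum.mono_neutral_left) (auto simp: coeff_eq_0)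
  with p show ?thesis by metis
qed

text \<open>Split off a root \<open>t\<close> of \<open>p\<close>. Either \<open>f\<close> is
  already an eigenvector for \<open>t\<close>, or \<open>T f - t \<star> f\<close> is a nonzero
  vector annihilated by the cofactor \<open>q\<close> of smaller degree. The invariant subspace
  \<open>W\<close> is carried along because the eigenvector will be sought in an orthogonal
  complement.\<close>

lemma eigenvector_from_poly:
  assumes W: "W \<subseteq> V" "subspace W" "\<And>f. f \<in> W \<Longrightarrow> T f \<in> W"
  shows "p \<noteq> 0 \<Longrightarrow> degree p = d \<Longrightarrow> f \<in> W \<Longrightarrow> f \<noteq> 0 \<Longrightarrow>
    (\<Sum>i\<le>d. coeff p i \<star> (T ^^ i) f) = 0 \<Longrightarrow> \<exists>e\<in>W. e \<noteq> 0 \<and> (\<exists>t. T e = t \<star> e)"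
proof (induction d arbitrary: p f)
  case 0
  then have "coeff p 0 \<noteq> 0" using leading_coeff_0_iff by metis
  then show ?case using 0 by simp
next
  case (Suc d)
  have "\<not> constant (poly p)" using Suc.prems by (simp add: constant_degree)
  then obtain t where "poly p t = 0" using fundamental_theorem_of_algebra by blast
  then obtain q where q: "p = [:-t, 1:] * q" by (auto simp: poly_eq_0_iff_dvd)
  then have q0: "q \<noteq> 0" using Suc.prems by auto
  have "degree p = degree [:-t, 1:] + degree q" unfolding q using q0 by (intro degree_mult_eq) auto
  then have dq: "degree q = d" using Suc.prems(2) by simp
  define g where "g = T f - t \<star> f"
  have fV: "f \<in> V" using Suc.prems W by auto
  show ?case
  proof (cases "g = 0")
    case True
    then show ?thesis using Suc.prems g_def by auto
  next
    case False
    have c0: "coeff p 0 = - t * coeff q 0" by (simp add: q)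
    have cS: "coeff p (Suc i) = coeff q i - t * coeff q (Suc i)" for i by (simp add: q)
    \<comment> \<open>Coefficientwise form of p(T) f = q(T) (T f) - t q(T) f = q(T) g.\<close>
    have "(\<Sum>i\<le>Suc d. coeff p i \<star> (T ^^ i) f)
        = (\<Sum>i\<le>d. coeff q i \<star> (T ^^ Suc i) f)
          - ((t * coeff q 0) \<star> f + (\<Sum>i\<le>d. (t * coeff q (Suc i)) \<star> (T ^^ Suc i) f))"
      unfolding sum.atMost_Suc_shift c0 cS
      by (simp add: scale_left_diff_distrib sum_subtractf algebra_simps)
    also have "(t * coeff q 0) \<star> f + (\<Sum>i\<le>d. (t * coeff q (Suc i)) \<star> (T ^^ Suc i) f)
        = (\<Sum>i\<le>Suc d. (t * coeff q i) \<star> (T ^^ i) f)"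
      unfolding sum.atMost_Suc_shift by simp
    also have "\<dots> = (\<Sum>i\<le>d. (t * coeff q i) \<star> (T ^^ i) f)"
      using dq by (simp add: coeff_eq_0)
    also have "(\<Sum>i\<le>d. coeff q i \<star> (T ^^ Suc i) f) - \<dots> = (\<Sum>i\<le>d. coeff q i \<star> (T ^^ i) g)"
      unfolding g_def
      by (simp add: T_pow_diff_scale fV T_in scale_right_diff_distrib sum_subtractf
          funpow_Suc_right o_def mult.commute del: funpow.simps)
    finally have "(\<Sum>i\<le>d. coeff q i \<star> (T ^^ i) g) = 0" using Suc.prems by simp
    moreover have "g \<in> W" unfolding g_def
      using Suc.prems W subspace_diff subspace_scale by blast
    ultimately show ?thesis using Suc.IH q0 dq False by blast
  qed
qed

text \<open>Commutation gives \<open>S e\<close> the same square \<open>t * cnj t * ip e e\<close>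
  as \<open>T e\<close>. Expanding the form at \<open>S e - cnj t \<star> e\<close> then yields four
  terms that cancel, and an isotropic vector is zero.\<close>

lemma eigenvector_adjoint:
  assumes e: "e \<in> V" "T e = t \<star> e"
  shows "S e = cnj t \<star> e"
proof -
  have SS: "ip (S e) (S e) = t * cnj t * ip e e"
  proof -
    have "ip (S e) (S e) = ip (T (S e)) e" using adjoint e S_in by simp
    also have "\<dots> = ip (S (t \<star> e)) e" using commute e by simp
    also have "\<dots> = cnj (ip e (S (t \<star> e)))" using e S_in V_closed by (intro ip_commute) auto
    also have "\<dots> = cnj (ip (t \<star> e) (t \<star> e))" using adjoint[of e "t \<star> e"] e V_closed by simp
    also have "\<dots> = cnj (t * cnj t * ip e e)" using e V_closed by (simp add: ip_scale ip_scale_right)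
    also have "\<dots> = t * cnj t * cnj (ip e e)" by simp
    also have "cnj (ip e e) = ip e e" using ip_commute[of e e] e by simp
    finally show ?thesis .
  qed
  have eS: "ip e (S e) = t * ip e e" using adjoint[of e e] e by (simp add: ip_scale)
  have Se: "ip (S e) e = cnj t * ip e e"
    using ip_commute[of e "S e"] eS e S_in ip_commute[of e e] by simp
  let ?d = "S e - cnj t \<star> e"
  have "?d \<in> V" using e S_in V_closed by auto
  moreover have "ip ?d ?d = 0"
  proof -
    have "ip ?d ?d = ip (S e) ?d - cnj t * ip e ?d"
      using \<open>?d \<in> V\<close> e S_in V_closed by (simp add: ip_diff ip_scale)
    also have "ip (S e) ?d = ip (S e) (S e) - t * ip (S e) e"
      using e S_in V_closed by (simp add: ip_diff_right ip_scale_right)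
    also have "ip e ?d = ip e (S e) - t * ip e e"
      using e S_in V_closed by (simp add: ip_diff_right ip_scale_right)
    finally show ?thesis using SS eS Se by (simp add: algebra_simps)
  qed
  ultimately have "?d = 0" by (rule ip_definite)
  then show ?thesis by simp
qed

text \<open>A largest orthogonal set of common eigenvectors must span. Its complement is invariant
  under \<open>T\<close>, since the members are eigenvectors of the adjoint, and a nonzero
  complement would contain one more eigenvector.\<close>

theorem orthogonal_eigenbasis:
  "\<exists>E. finite E \<and> orthogonal_set E \<and> V \<subseteq> span E \<and>
     (\<forall>e\<in>E. \<exists>t. T e = t \<star> e \<and> S e = cnj t \<star> e)"
proof -
  define good where "good E \<longleftrightarrow> orthogonal_set E \<and>
    (\<forall>e\<in>E. \<exists>t. T e = t \<star> e \<and> S e = cnj t \<star> e)" for E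
  obtain B where B: "finite B" "V \<subseteq> span B" using finite_dim by blast
  \<comment> \<open>Orthogonal sets have at most \<open>card B\<close> elements, so a largest one
    exists.\<close>
  have "\<exists>n. (\<exists>E. good E \<and> card E = n) \<and> (\<forall>k. (\<exists>E. good E \<and> card E = k) \<longrightarrow> k \<le> n)"
  proof (rule exI[of _ "Greatest (\<lambda>n. \<exists>E. good E \<and> card E = n)"], intro conjI allI impI)
    have ex: "\<exists>E. good E \<and> card E = 0"
      by (rule exI[of _ "{}"]) (auto simp: good_def orthogonal_set_def)
    have bd: "\<And>y. \<exists>E. good E \<and> card E = y \<Longrightarrow> y \<le> card B"
      using finite_orthogonal_set B by (auto simp: good_def)
    show "\<exists>E. good E \<and> card E = (GREATEST n. \<exists>E. good E \<and> card E = n)"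
      by (rule GreatestI_nat[of "\<lambda>n. \<exists>E. good E \<and> card E = n", OF ex bd])
    show "k \<le> (GREATEST n. \<exists>E. good E \<and> card E = n)" if "\<exists>E. good E \<and> card E = k" for k
      by (rule Greatest_le_nat[of "\<lambda>n. \<exists>E. good E \<and> card E = n", OF that bd])
  qed
  then obtain E where E: "good E" and max: "\<And>E'. good E' \<Longrightarrow> card E' \<le> card E" by blast
  have orth: "orthogonal_set E" using E good_def by blast
  then have EV: "E \<subseteq> V" and finE: "finite E"
    using finite_orthogonal_set B by (auto simp: orthogonal_set_def)
  define W where "W = {f \<in> V. \<forall>e\<in>E. ip f e = 0}"
  have WV: "W \<subseteq> V" by (auto simp: W_def)
  have subW: "subspace W"
    using EV by (auto simp: subspace_def W_def V_closed ip_add ip_scale ip_zero_left)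
  have TW: "T f \<in> W" if "f \<in> W" for f
  proof -
    have "ip (T f) e = 0" if e: "e \<in> E" for e
    proof -
      obtain t where "S e = cnj t \<star> e" using E e by (auto simp: good_def)
      then show ?thesis using adjoint[of f e] \<open>f \<in> W\<close> e EV
        by (auto simp: W_def ip_scale_right)
    qed
    then show ?thesis using that T_in by (auto simp: W_def)
  qed
  have W0: "f = 0" if "f \<in> W" for f
  proof (rule ccontr)
    assume f0: "f \<noteq> 0"
    obtain p where p: "p \<noteq> 0" "(\<Sum>i\<le>degree p. coeff p i \<star> (T ^^ i) f) = 0"
      using annihilating_poly WV \<open>f \<in> W\<close> by blast
    then obtain e t where e: "e \<in> W" "e \<noteq> 0" "T e = t \<star> e"
      using eigenvector_from_poly[OF WV subW TW p(1) refl \<open>f \<in> W\<close> f0] by blast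
    then have eV: "e \<in> V" using WV by auto
    have oe: "ip e x = 0" "ip x e = 0" if "x \<in> E" for x
      using that e eV EV ip_commute[of e x] by (auto simp: W_def)
    have "e \<notin> E" using oe(1)[of e] ip_definite[OF eV] e by auto
    moreover have "good (insert e E)"
      using E e eV oe eigenvector_adjoint[OF eV e(3)]
      unfolding good_def orthogonal_set_def by auto
    then have "card (insert e E) \<le> card E" by (rule max)
    ultimately show False using finE by simp
  qed
  have "f \<in> span E" if f: "f \<in> V" for f
  proof -
    define s where "s = (\<Sum>x\<in>E. (ip f x / ip x x) \<star> x)"
    have sV: "s \<in> V" unfolding s_def using EV by (intro subspace_sum[OF subspace_V] V_closed) auto
    have "f - s \<in> W"
    proof -
      have "ip (f - s) e = 0" if e: "e \<in> E" for e
      proof -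
        have "e \<in> V" "ip e e \<noteq> 0" using e EV orth ip_definite by (auto simp: orthogonal_set_def)
        then show ?thesis using ip_orthogonal_sum[OF orth finE _ e, of "\<lambda>x. ip f x / ip x x"] f sV
          by (simp add: ip_diff s_def)
      qed
      then show ?thesis using f sV by (auto simp: W_def V_closed)
    qed
    then have "f = s" using W0[of "f - s"] by simp
    moreover have "s \<in> span E" unfolding s_def by (intro span_sum span_scale span_base)
    ultimately show ?thesis by simp
  qed
  then show ?thesis using E finE orth by (auto simp: good_def)
qed

end

subsection \<open>Determinants of the banded matrices\<close>

lemma mat_delete_mat:
  "i \<le> n \<Longrightarrow> j \<le> n \<Longrightarrow> mat_delete (mat (Suc n) (Suc n) f) i j =
     mat n n (\<lambda>(k, l). f (if k < i then k else Suc k, if l < j then l else Suc l))"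
  by (rule eq_matI) (auto simp: mat_delete_def)

definition skip :: "nat \<Rightarrow> nat \<Rightarrow> nat" where
  "skip p j = (if j < p then j else Suc j)"

lemma skip_simps [simp]: "skip 0 j = Suc j" "skip (Suc p) 0 = 0" "skip (Suc p) (Suc j) = Suc (skip p j)"
  by (auto simp: skip_def)

context
  fixes a c z w d :: "'a :: comm_ring_1"
begin

text \<open>The variable and its conjugate are independent letters \<open>z\<close>,
  \<open>w\<close> over a commutative ring, and \<open>d\<close> stands for \<open>cnj c\<close>. In
  \<open>band_det\<close> the first row is replaced by a row given separately.\<close>

definition band :: "nat \<Rightarrow> nat \<Rightarrow> nat \<Rightarrow> 'a" where
  "band m i j = (if j = i then z else if j = i + 1 then w else if j = i + 2 then d
     else if i = j + 1 then (if i = m - 1 then a else c) else 0)"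

text \<open>What the second row of the band becomes once the first row and the first column are
  removed. The first row of \<open>A_mat\<close> is the same shape with \<open>cnj a\<close> as its
  third entry.\<close>

definition top_row :: "nat \<Rightarrow> 'a" where
  "top_row j = (if j = 0 then z else if j = 1 then w else if j = 2 then d else 0)"

text \<open>\<open>p\<close> columns stand to the left of the deleted one and \<open>q\<close> to
  its right. The first row \<open>r\<close> is arbitrary because expansion along the first column
  leaves a minor whose first row is the old one shifted by one place; only for general
  \<open>r\<close> does the recursion close up.\<close>

definition band_det :: "(nat \<Rightarrow> 'a) \<Rightarrow> nat \<Rightarrow> nat \<Rightarrow> 'a" where
  "band_det r p q = Determinant.det (mat (p + q) (p + q)
     (\<lambda>(i, j). if i = 0 then r (skip p j) else band (p + q) i (skip p j)))"

lemma det_eq_band_det: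
  assumes "n = p + q"
    and "\<And>i j. f (i, j) = (if i = 0 then r (skip p j) else band n i (skip p j))"
  shows "Determinant.det (mat n n f) = band_det r p q"
proof -
  have "f = (\<lambda>(i, j). if i = 0 then r (skip p j) else band n i (skip p j))"
    using assms(2) by auto
  then show ?thesis unfolding assms(1) band_det_def by (rule arg_cong)
qed

lemma band_Suc_Suc:
  "band (Suc n) (Suc k) (Suc j) = (if k = 0 then top_row j else band n k j)" if "k < n"
  using that by (auto simp: band_def top_row_def)

lemma band_det_0_0: "band_det r 0 0 = 1"
  by (simp add: band_det_def)

lemma band_det_1_0: "band_det r (Suc 0) 0 = r 0"
  by (simp add: band_det_def det_single)

lemma band_det_0_1: "band_det r 0 (Suc 0) = r 1"
  by (simp add: band_det_def det_single)

text \<open>The first column has only two possible nonzero entries, \<open>r 0\<close> and the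
  subdiagonal one. The latter is \<open>a\<close> exactly when the second row is also the last, that
  is at size two.\<close>

lemma band_det_Suc:
  assumes "p + q \<ge> 1"
  shows "band_det r (Suc p) q = r 0 * band_det top_row p q
     - (if p + q = 1 then a else c) * band_det (\<lambda>j. r (Suc j)) p q"
proof -
  define n where "n = p + q"
  define F where "F = (\<lambda>(i, j). if i = 0 then r (skip (Suc p) j) else band (Suc n) i (skip (Suc p) j))"
  let ?A = "mat (Suc n) (Suc n) F"
  have "n \<noteq> 0" using assms n_def by linarith
  then obtain n' where n': "n = Suc n'" using not0_implies_Suc by blast
  have d0: "mat_delete ?A 0 0 = mat n n
      (\<lambda>(i, j). if i = 0 then top_row (skip p j) else band n i (skip p j))"
    by (subst mat_delete_mat) (auto intro!: cong_mat simp: F_def band_Suc_Suc)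
  have d1: "mat_delete ?A (Suc 0) 0 = mat n n
      (\<lambda>(i, j). if i = 0 then r (Suc (skip p j)) else band n i (skip p j))"
    using n' by (subst mat_delete_mat) (auto intro!: cong_mat simp: F_def band_Suc_Suc)
  have "band_det r (Suc p) q = Determinant.det ?A"
    by (rule det_eq_band_det[symmetric]) (auto simp: F_def n_def)
  also have "\<dots> = (\<Sum>i<Suc n. ?A $$ (i, 0) * cofactor ?A i 0)"
    by (rule laplace_expansion_column) auto
  also have "\<dots> = (\<Sum>i<2. ?A $$ (i, 0) * cofactor ?A i 0)"
  proof (rule sum.mono_neutral_right)
    show "\<forall>i\<in>{..<Suc n} - {..<2}. ?A $$ (i, 0) * cofactor ?A i 0 = 0"
      by (auto simp: F_def band_def)
  qed (use n' in auto)
  also have "\<dots> = ?A $$ (0, 0) * cofactor ?A 0 0 + ?A $$ (Suc 0, 0) * cofactor ?A (Suc 0) 0"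
    by (simp add: numeral_2_eq_2)
  also have "?A $$ (0, 0) = r 0" by (simp add: F_def)
  also have "?A $$ (Suc 0, 0) = (if p + q = 1 then a else c)"
    using n' by (simp add: F_def band_def n_def)
  also have "cofactor ?A 0 0 = band_det top_row p q"
    unfolding cofactor_def d0 by (simp add: det_eq_band_det[OF n_def, of _ top_row])
  also have "cofactor ?A (Suc 0) 0 = - band_det (\<lambda>j. r (Suc j)) p q"
    unfolding cofactor_def d1 by (simp add: det_eq_band_det[OF n_def, of _ "\<lambda>j. r (Suc j)"])
  finally show ?thesis by simp
qed

text \<open>With the column of index 0 deleted, the first remaining column may hold three nonzero
  entries, but the first row only \<open>r 1\<close> and \<open>r 2\<close>; hence a row expansion
  here.\<close>

lemma band_det_0_Suc_Suc:
  assumes r: "\<And>j. j \<ge> 3 \<Longrightarrow> r j = 0"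
  shows "band_det r 0 (Suc (Suc q)) = r 1 * band_det top_row 0 (Suc q) - r 2 * band_det top_row (Suc 0) q"
proof -
  define F where "F = (\<lambda>(i, j). if i = 0 then r (Suc j) else band (Suc (Suc q)) i (Suc j))"
  let ?A = "mat (Suc (Suc q)) (Suc (Suc q)) F"
  have d0: "mat_delete ?A 0 0 = mat (Suc q) (Suc q)
      (\<lambda>(i, j). if i = 0 then top_row (Suc j) else band (Suc q) i (Suc j))"
    by (subst mat_delete_mat) (auto intro!: cong_mat simp: F_def band_Suc_Suc)
  have d1: "mat_delete ?A 0 (Suc 0) = mat (Suc q) (Suc q)
      (\<lambda>(i, j). if i = 0 then top_row (skip 1 j) else band (Suc q) i (skip 1 j))"
    by (subst mat_delete_mat) (auto intro!: cong_mat simp: F_def band_Suc_Suc skip_def)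
  have "band_det r 0 (Suc (Suc q)) = Determinant.det ?A"
    by (rule det_eq_band_det[symmetric]) (auto simp: F_def)
  also have "\<dots> = (\<Sum>j<Suc (Suc q). ?A $$ (0, j) * cofactor ?A 0 j)"
    by (rule laplace_expansion_row) auto
  also have "\<dots> = (\<Sum>j<2. ?A $$ (0, j) * cofactor ?A 0 j)"
    by (rule sum.mono_neutral_right) (auto simp: F_def r)
  also have "\<dots> = ?A $$ (0, 0) * cofactor ?A 0 0 + ?A $$ (0, Suc 0) * cofactor ?A 0 (Suc 0)"
    by (simp add: numeral_2_eq_2)
  also have "?A $$ (0, 0) = r 1" by (simp add: F_def)
  also have "?A $$ (0, Suc 0) = r 2" by (simp add: F_def numeral_2_eq_2)
  also have "cofactor ?A 0 0 = band_det top_row 0 (Suc q)"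
    by (simp add: cofactor_def d0 det_eq_band_det)
  also have "cofactor ?A 0 (Suc 0) = - band_det top_row (Suc 0) q"
    by (simp add: cofactor_def d1 det_eq_band_det)
  finally show ?thesis by simp
qed

text \<open>Induction on the size, for all first rows at once. \<open>R\<close> plays the role of
  \<Delta> times the minor with first row \<open>top_row\<close>, continued to negative
  \<open>p\<close> by the recurrence; \<open>R_m2\<close> and \<open>R_m3\<close> make the row
  expansion at \<open>p = 0\<close> agree with the column expansion. The corner entry
  \<open>a\<close> enters only through \<open>R00\<close>: since it replaces \<open>c\<close> just
  at size two, it acts as if the empty minor had the value a / c. Multiplying by \<Delta> avoids a
  division by the Vandermonde product, which may vanish.\<close>

lemma band_det_closed_form:
  fixes R :: "int \<Rightarrow> int \<Rightarrow> 'a" and \<Delta> :: 'a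
  assumes rec: "\<And>p q. R p q = z * R (p - 1) q - c * w * R (p - 2) q + c\<^sup>2 * d * R (p - 3) q"
    and R_m1: "\<And>q. R (-1) q = 0"
    and R_m2: "\<And>q. c * R (-2) q = - R 0 (q - 1)"
    and R_m3: "\<And>q. c\<^sup>2 * R (-3) q = - R 1 (q - 2)"
    and R00: "c * R 0 0 = a * \<Delta>" and R10: "R 1 0 = z * \<Delta>" and R01: "R 0 1 = w * \<Delta>"
  shows "p + q \<ge> 2 \<Longrightarrow> (\<And>j. j \<ge> 3 \<Longrightarrow> r j = 0) \<Longrightarrow>
    \<Delta> * band_det r p q = r 0 * R (int p - 1) (int q) - c * r 1 * R (int p - 2) (int q)
      + c\<^sup>2 * r 2 * R (int p - 3) (int q)"
proof (induction "p + q" arbitrary: p q r rule: less_induct)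
  case less
  \<comment> \<open>Size zero is excluded: there the determinant is 1, while \<open>R00\<close>
    prescribes a / c.\<close>
  have top: "\<Delta> * band_det top_row p' q' = R (int p') (int q')"
    if "p' + q' < p + q" "p' + q' \<ge> 1" for p' q'
  proof (cases "p' + q' = 1")
    case True
    then consider "p' = 1" "q' = 0" | "p' = 0" "q' = 1" by linarith
    then show ?thesis
      by cases (auto simp: band_det_1_0 band_det_0_1 top_row_def R10 R01)
  next
    case False
    then have "\<Delta> * band_det top_row p' q' = z * R (int p' - 1) (int q')
        - c * w * R (int p' - 2) (int q') + c\<^sup>2 * d * R (int p' - 3) (int q')"
      using less.hyps[of p' q' top_row] that by (simp add: top_row_def)
    then show ?thesis using rec[of "int p'" "int q'"] by simp
  qed
  show ?case
  proof (cases p)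
    case 0
    then obtain q' where q': "q = Suc (Suc q')" using less.prems(1)
      by (metis add_0 add_2_eq_Suc le_Suc_ex)
    have "\<Delta> * band_det r p q = r 1 * (\<Delta> * band_det top_row 0 (Suc q')) - r 2 * (\<Delta> * band_det top_row (Suc 0) q')"
      unfolding 0 q' by (subst band_det_0_Suc_Suc[OF less.prems(2)]) (auto simp: right_diff_distrib mult.left_commute[of \<Delta>])
    also have "\<dots> = r 1 * R 0 (int q - 1) - r 2 * R 1 (int q - 2)"
      using top[of 0 "Suc q'"] top[of "Suc 0" q'] 0 q' by simp
    also have "R 0 (int q - 1) = - (c * R (-2) (int q))" by (simp add: R_m2)
    also have "R 1 (int q - 2) = - (c\<^sup>2 * R (-3) (int q))" by (simp add: R_m3)
    finally show ?thesis using 0 by (simp add: R_m1 algebra_simps)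
  next
    case (Suc p')
    have pq: "p' + q \<ge> 1" using less.prems(1) Suc by simp
    let ?b = "if p' + q = 1 then a else c"
    let ?r = "\<lambda>j. r (Suc j)"
    have eq: "\<Delta> * band_det r p q = r 0 * (\<Delta> * band_det top_row p' q) - ?b * (\<Delta> * band_det ?r p' q)"
      unfolding Suc by (subst band_det_Suc[OF pq]) (simp only: right_diff_distrib mult.left_commute[of \<Delta>])
    have t: "\<Delta> * band_det top_row p' q = R (int p - 1) (int q)" using top[of p' q] pq Suc by simp
    have br: "?b * (\<Delta> * band_det ?r p' q) = c * r 1 * R (int p - 2) (int q) - c\<^sup>2 * r 2 * R (int p - 3) (int q)"
    proof (cases "p' + q = 1")
      case True
      then consider "p' = 1" "q = 0" | "p' = 0" "q = 1" by linarith
      then show ?thesis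
      proof cases
        case 1
        then have "?b * (\<Delta> * band_det ?r p' q) = r 1 * (c * R 0 0)"
          by (simp add: band_det_1_0 R00 algebra_simps)
        then show ?thesis using 1 Suc by (simp add: R_m1 algebra_simps)
      next
        case 2
        then have "?b * (\<Delta> * band_det ?r p' q) = r 2 * (c * R 0 0)"
          by (simp add: band_det_0_1 R00 algebra_simps numeral_2_eq_2)
        also have "R 0 0 = - (c * R (-2) 1)" by (simp add: R_m2)
        finally show ?thesis using 2 Suc by (simp add: R_m1 algebra_simps power2_eq_square)
      qed
    next
      case False
      then have "\<Delta> * band_det ?r p' q = r 1 * R (int p' - 1) (int q) - c * r 2 * R (int p' - 2) (int q)"
        using less.hyps[of p' q ?r] less.prems(2) Suc pq by (simp add: numeral_2_eq_2)
      then have "c * (\<Delta> * band_det ?r p' q)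
          = c * (r 1 * R (int p' - 1) (int q) - c * r 2 * R (int p' - 2) (int q))" by simp
      then show ?thesis using False Suc by (simp add: algebra_simps power2_eq_square)
    qed
    show ?thesis unfolding eq t br by (simp add: algebra_simps)
  qed
qed

end

lemma Q_poly_eq_band_det:
  assumes "k \<le> m"
  shows "Q_poly a c m k z = band_det a c z (cnj z) (cnj c) (top_row z (cnj z) (cnj a)) (m - k) k"
  unfolding Q_poly_def delete_col_def A_mat_def band_det_def
  using assms
  by (intro arg_cong[of _ _ Determinant.det] eq_matI)
    (auto simp: band_def top_row_def skip_def)

text \<open>The signed maximal minors span kernel vectors of the matrix: put a second copy of row
  \<open>i\<close> on top and expand the vanishing determinant along it.\<close>

lemma A_mat_cofactor_relation:
  assumes "i < m"
  shows "(\<Sum>j\<le>m. A_mat a c m z $$ (i, j) * ((-1) ^ j * Q_poly a c m (m - j) z)) = 0"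
proof -
  let ?A = "A_mat a c m z"
  let ?B = "mat (Suc m) (Suc m) (\<lambda>(k, l). if k = 0 then ?A $$ (i, l) else ?A $$ (k - 1, l))"
  have "row ?B 0 = row ?B (Suc i)" using assms by (intro eq_vecI) auto
  then have "0 = Determinant.det ?B"
    using assms by (intro det_identical_rows[symmetric, of _ "Suc m" 0 "Suc i"]) auto
  also have "\<dots> = (\<Sum>j<Suc m. ?B $$ (0, j) * cofactor ?B 0 j)"
    by (rule laplace_expansion_row) auto
  also have "\<dots> = (\<Sum>j\<le>m. ?A $$ (i, j) * ((-1) ^ j * Q_poly a c m (m - j) z))"
  proof (rule sum.cong)
    fix j assume "j \<in> {..m}"
    then have j: "j \<le> m" by simp
    have "mat_delete ?B 0 j = delete_col j ?A"
      using j by (subst mat_delete_mat) (auto simp: delete_col_def A_mat_def intro!: eq_matI)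
    then show "?B $$ (0, j) * cofactor ?B 0 j = ?A $$ (i, j) * ((-1) ^ j * Q_poly a c m (m - j) z)"
      using j by (simp add: cofactor_def Q_poly_def)
  qed auto
  finally show ?thesis by simp
qed

subsection \<open>Polynomials in a complex variable and its conjugate\<close>

lemma sum_fun_apply: "(\<Sum>i\<in>A. f i) x = (\<Sum>i\<in>A. f i x)"
  by (induction A rule: infinite_finite_induct) auto

definition fscale :: "complex \<Rightarrow> (complex \<Rightarrow> complex) \<Rightarrow> complex \<Rightarrow> complex" where
  "fscale k f = (\<lambda>z. k * f z)"

interpretation cfun: vector_space fscale
  by unfold_locales (auto simp: fscale_def fun_eq_iff algebra_simps)

definition monomials_less :: "nat \<Rightarrow> (complex \<Rightarrow> complex) set" where
  "monomials_less m = (\<lambda>(i, j) z. z ^ i * cnj z ^ j) ` {(i, j). i + j < m}"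

lemma monomial_in_zpolys:
  assumes "i + j < m"
  shows "(\<lambda>z. z ^ i * cnj z ^ j) \<in> zpolys_less m"
proof -
  define r where "r = (\<lambda>k l. if k = i then if l = j then 1 else 0 else 0 :: complex)"
  have inner: "(\<Sum>l<m - k. r k l * z ^ k * cnj z ^ l) = (if k = i then z ^ i * cnj z ^ j else 0)" for k z
  proof (cases "k = i")
    case True
    have "(\<Sum>l<m - k. r k l * z ^ k * cnj z ^ l) = (\<Sum>l<m - k. if l = j then z ^ i * cnj z ^ j else 0)"
      using True by (intro sum.cong) (auto simp: r_def)
    then show ?thesis using True assms by simp
  qed (auto simp: r_def)
  have "(\<Sum>k<m. \<Sum>l<m - k. r k l * z ^ k * cnj z ^ l) = z ^ i * cnj z ^ j" for z
    unfolding inner using assms by simp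
  then have "(\<lambda>z. z ^ i * cnj z ^ j) = (\<lambda>z. \<Sum>k<m. \<Sum>l<m - k. r k l * z ^ k * cnj z ^ l)"
    by auto
  then show ?thesis unfolding zpolys_less_def by blast
qed

lemma subspace_zpolys: "cfun.subspace (zpolys_less m)"
  unfolding cfun.subspace_def
proof (intro conjI ballI allI)
  show "0 \<in> zpolys_less m" unfolding zpolys_less_def
    by (auto intro!: exI[of _ "\<lambda>_ _. 0"])
next
  fix f g assume "f \<in> zpolys_less m" "g \<in> zpolys_less m"
  then obtain r s where "f = (\<lambda>z. \<Sum>i<m. \<Sum>j<m - i. r i j * z ^ i * cnj z ^ j)"
    "g = (\<lambda>z. \<Sum>i<m. \<Sum>j<m - i. s i j * z ^ i * cnj z ^ j)"
    unfolding zpolys_less_def by blast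
  then have "f + g = (\<lambda>z. \<Sum>i<m. \<Sum>j<m - i. (r i j + s i j) * z ^ i * cnj z ^ j)"
    by (auto simp: fun_eq_iff sum.distrib algebra_simps)
  then show "f + g \<in> zpolys_less m" unfolding zpolys_less_def
    by (intro CollectI exI[of _ "\<lambda>i j. r i j + s i j"])
next
  fix f k assume "f \<in> zpolys_less m"
  then obtain r where "f = (\<lambda>z. \<Sum>i<m. \<Sum>j<m - i. r i j * z ^ i * cnj z ^ j)"
    unfolding zpolys_less_def by blast
  then have "fscale k f = (\<lambda>z. \<Sum>i<m. \<Sum>j<m - i. (k * r i j) * z ^ i * cnj z ^ j)"
    by (auto simp: fun_eq_iff fscale_def sum_distrib_left mult.assoc)
  then show "fscale k f \<in> zpolys_less m" unfolding zpolys_less_def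
    by (intro CollectI exI[of _ "\<lambda>i j. k * r i j"])
qed

lemma zpolys_eq_span: "zpolys_less m = cfun.span (monomials_less m)"
proof
  show "cfun.span (monomials_less m) \<subseteq> zpolys_less m"
    by (rule cfun.span_minimal[OF _ subspace_zpolys])
      (auto simp: monomials_less_def monomial_in_zpolys)
  show "zpolys_less m \<subseteq> cfun.span (monomials_less m)"
  proof
    fix f assume "f \<in> zpolys_less m"
    then obtain r where f: "f = (\<lambda>z. \<Sum>i<m. \<Sum>j<m - i. r i j * z ^ i * cnj z ^ j)"
      unfolding zpolys_less_def by blast
    have "f = (\<Sum>i<m. \<Sum>j<m - i. fscale (r i j) (\<lambda>z. z ^ i * cnj z ^ j))"
      by (auto simp: f fun_eq_iff sum_fun_apply fscale_def mult.assoc)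
    also have "\<dots> \<in> cfun.span (monomials_less m)"
      by (intro cfun.span_sum cfun.span_scale cfun.span_base) (auto simp: monomials_less_def)
    finally show "f \<in> cfun.span (monomials_less m)" .
  qed
qed

lemma finite_monomials_less: "finite (monomials_less m)"
proof -
  have "{(i, j). i + j < m} \<subseteq> {..<m} \<times> {..<m}" by auto
  then show ?thesis unfolding monomials_less_def by (meson finite_SigmaI finite_imageI finite_lessThan finite_subset)
qed

lemma zpolys_add: "f \<in> zpolys_less m \<Longrightarrow> g \<in> zpolys_less m \<Longrightarrow> (\<lambda>z. f z + g z) \<in> zpolys_less m"
  using cfun.subspace_add[OF subspace_zpolys] by (simp add: plus_fun_def)

lemma zpolys_scale: "f \<in> zpolys_less m \<Longrightarrow> (\<lambda>z. k * f z) \<in> zpolys_less m"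
  using cfun.subspace_scale[OF subspace_zpolys] by (simp add: fscale_def)

lemma zpolys_diff: "f \<in> zpolys_less m \<Longrightarrow> g \<in> zpolys_less m \<Longrightarrow> (\<lambda>z. f z - g z) \<in> zpolys_less m"
  using zpolys_add[of f m "\<lambda>z. (-1) * g z"] zpolys_scale[of g m "-1"] by simp

lemma zpolys_sum:
  "(\<And>i. i \<in> A \<Longrightarrow> f i \<in> zpolys_less m) \<Longrightarrow> (\<lambda>z. \<Sum>i\<in>A. f i z) \<in> zpolys_less m"
  using cfun.subspace_sum[OF subspace_zpolys, of A f m]
  by (simp add: sum_fun_apply[abs_def] fun_eq_iff)

lemma zpolys_mono: "m \<le> n \<Longrightarrow> zpolys_less m \<subseteq> zpolys_less n"
  unfolding zpolys_eq_span by (intro cfun.span_mono) (auto simp: monomials_less_def)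

text \<open>Induction over a span: statements compatible with linear combinations are checked on
  monomials, without handling coefficient arrays.\<close>

lemma zpolys_induct [consumes 1, case_names zero add scale monomial]:
  assumes f: "f \<in> zpolys_less m"
    and "P (\<lambda>_. 0)" and "\<And>f g. P f \<Longrightarrow> P g \<Longrightarrow> P (\<lambda>z. f z + g z)"
    and "\<And>f k. P f \<Longrightarrow> P (\<lambda>z. k * f z)"
    and "\<And>i j. i + j < m \<Longrightarrow> P (\<lambda>z. z ^ i * cnj z ^ j)"
  shows "P f"
proof -
  have "f \<in> cfun.span (monomials_less m)" using f zpolys_eq_span by simp
  then have "f \<in> Collect P"
    by (rule cfun.span_induct)
      (use assms(2-) in \<open>auto simp: cfun.subspace_def monomials_less_def plus_fun_def fscale_def zero_fun_def\<close>)
  then show ?thesis by simp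
qed

lemma zpolys_mult_monomial:
  assumes "f \<in> zpolys_less m" "m + i + j \<le> n"
  shows "(\<lambda>z. z ^ i * cnj z ^ j * f z) \<in> zpolys_less n"
  using assms(1)
proof (induction rule: zpolys_induct)
  case zero
  then show ?case using cfun.subspace_0[OF subspace_zpolys] by (simp add: zero_fun_def)
next
  case (add f g)
  then show ?case using zpolys_add by (fastforce simp: algebra_simps)
next
  case (scale f k)
  then show ?case using zpolys_scale[of _ n k] by (fastforce simp: algebra_simps)
next
  case (monomial k l)
  have "(\<lambda>z. z ^ i * cnj z ^ j * (z ^ k * cnj z ^ l)) = (\<lambda>z::complex. z ^ (i + k) * cnj z ^ (j + l))"
    by (simp add: power_add algebra_simps)
  then show ?case using monomial assms(2) monomial_in_zpolys[of "i + k" "j + l" n] by simp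
qed

lemma zpolys_mult:
  assumes "f \<in> zpolys_less (Suc m)" "g \<in> zpolys_less n" "m + n \<le> l"
  shows "(\<lambda>z. f z * g z) \<in> zpolys_less l"
  using assms(1)
proof (induction rule: zpolys_induct)
  case zero
  then show ?case using cfun.subspace_0[OF subspace_zpolys] by (simp add: zero_fun_def)
next
  case (add f g)
  then show ?case using zpolys_add by (fastforce simp: algebra_simps)
next
  case (scale f k)
  then show ?case using zpolys_scale[of _ l k] by (fastforce simp: algebra_simps)
next
  case (monomial i j)
  then show ?case using zpolys_mult_monomial[OF assms(2)] assms(3) by simp
qed

lemma zpolys_const: "0 < m \<Longrightarrow> (\<lambda>_. k) \<in> zpolys_less m"
  using zpolys_scale[OF monomial_in_zpolys[of 0 0 m], of k] by simp

lemma zpolys_zero: "(\<lambda>_. 0) \<in> zpolys_less m"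
  using cfun.subspace_0[OF subspace_zpolys] by (simp add: zero_fun_def)

section \<open>Degrees and leading terms of the minors\<close>

lemma top_row_in_zpolys: "(\<lambda>z. top_row z (cnj z) d j) \<in> zpolys_less 2"
proof -
  consider "j = 0" | "j = 1" | "j = 2" | "j \<ge> 3" by linarith
  then show ?thesis
    using monomial_in_zpolys[of 1 0 2] monomial_in_zpolys[of 0 1 2] zpolys_const[of 2 d] zpolys_zero
    by cases (auto simp: top_row_def)
qed

text \<open>First rows more general than \<open>top_row\<close> are needed, because the column
  expansion shifts the row.\<close>

lemma band_det_in_zpolys:
  assumes "\<And>j. j < 3 \<Longrightarrow> r j \<in> zpolys_less 2" "\<And>j. j \<ge> 3 \<Longrightarrow> r j = (\<lambda>_. 0)"
  shows "(\<lambda>z. band_det a c z (cnj z) d (\<lambda>j. r j z) p q) \<in> zpolys_less (Suc (p + q))"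
  using assms
proof (induction "p + q" arbitrary: p q r rule: less_induct)
  case less
  let ?top = "\<lambda>j z. top_row z (cnj z) d j"
  have r2: "r j \<in> zpolys_less 2" for j using less.prems zpolys_zero by (cases "j < 3") auto
  have top: "(\<lambda>z. band_det a c z (cnj z) d (top_row z (cnj z) d) p' q') \<in> zpolys_less (Suc (p' + q'))"
    if "p' + q' < p + q" for p' q'
  proof -
    have "?top j \<in> zpolys_less 2" for j by (rule top_row_in_zpolys)
    moreover have "?top j = (\<lambda>_. 0)" if "j \<ge> 3" for j using that by (auto simp: top_row_def)
    ultimately show ?thesis using less.hyps[OF that, of ?top] by simp
  qed
  consider "p = 0" "q = 0" | "p = 0" "q = 1" | "p = 1" "q = 0"
    | q' where "p = 0" "q = Suc (Suc q')" | p' where "p = Suc p'" "p' + q \<ge> 1"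
    by (cases p; cases q; cases "q - 1"; cases "p - 1") auto
  then show ?case
  proof cases
    case 1 then show ?thesis by (simp add: band_det_0_0 zpolys_const)
  next
    case 2 then show ?thesis using r2[of 1] by (simp add: band_det_0_1 numeral_2_eq_2)
  next
    case 3 then show ?thesis using r2[of 0] by (simp add: band_det_1_0 numeral_2_eq_2)
  next
    case (4 q')
    have r12: "r 1 \<in> zpolys_less (Suc 1)" "r 2 \<in> zpolys_less (Suc 1)"
      using r2 by (auto simp: numeral_2_eq_2)
    have t: "0 + Suc q' < p + q" "Suc 0 + q' < p + q" using 4 by auto
    have "(\<lambda>z. r 1 z * band_det a c z (cnj z) d (top_row z (cnj z) d) 0 (Suc q')
        - r 2 z * band_det a c z (cnj z) d (top_row z (cnj z) d) (Suc 0) q') \<in> zpolys_less (Suc (p + q))"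
      using 4 by (intro zpolys_diff zpolys_mult[OF r12(1) top[OF t(1)]]
          zpolys_mult[OF r12(2) top[OF t(2)]]) auto
    moreover have "band_det a c z (cnj z) d (\<lambda>j. r j z) p q
        = r 1 z * band_det a c z (cnj z) d (top_row z (cnj z) d) 0 (Suc q')
        - r 2 z * band_det a c z (cnj z) d (top_row z (cnj z) d) (Suc 0) q'" for z
      unfolding 4 by (rule band_det_0_Suc_Suc) (simp add: less.prems)
    ultimately show ?thesis by simp
  next
    case (5 p')
    let ?b = "if p' + q = 1 then a else c"
    have "r 0 \<in> zpolys_less (Suc 1)" using r2 by (auto simp: numeral_2_eq_2)
    moreover have "(\<lambda>z. band_det a c z (cnj z) d (\<lambda>j. r (Suc j) z) p' q) \<in> zpolys_less (Suc (p' + q))"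
      using less.hyps[of p' q "\<lambda>j. r (Suc j)"] 5 r2 less.prems by simp
    then have "(\<lambda>z. band_det a c z (cnj z) d (\<lambda>j. r (Suc j) z) p' q) \<in> zpolys_less (Suc (p + q))"
      using zpolys_mono[of "Suc (p' + q)" "Suc (p + q)"] 5 by auto
    ultimately have "(\<lambda>z. r 0 z * band_det a c z (cnj z) d (top_row z (cnj z) d) p' q
        - ?b * band_det a c z (cnj z) d (\<lambda>j. r (Suc j) z) p' q) \<in> zpolys_less (Suc (p + q))"
      using top[of p' q] 5 by (intro zpolys_diff zpolys_scale) (auto intro!: zpolys_mult)
    moreover have "band_det a c z (cnj z) d (\<lambda>j. r j z) p q
        = r 0 z * band_det a c z (cnj z) d (top_row z (cnj z) d) p' q
        - ?b * band_det a c z (cnj z) d (\<lambda>j. r (Suc j) z) p' q" for z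
      unfolding 5(1) by (rule band_det_Suc[OF 5(2)])
    ultimately show ?thesis by simp
  qed
qed

text \<open>In each expansion the summand with factor \<open>z\<close> or \<open>cnj z\<close>
  carries the leading term. The other summand has a constant coefficient in front of a smaller
  minor, so the degree bound just proved disposes of it.\<close>

lemma band_det_leading_term:
  assumes "\<And>z. r z 0 = z" "\<And>z. r z 1 = cnj z" "\<And>z. r z 2 = k" "\<And>z j. j \<ge> 3 \<Longrightarrow> r z j = 0"
  shows "(\<lambda>z. band_det a c z (cnj z) d (r z) p q - z ^ p * cnj z ^ q) \<in> zpolys_less (p + q)"
  using assms
proof (induction "p + q" arbitrary: p q r k rule: less_induct)
  case less
  let ?M = "\<lambda>z. band_det a c z (cnj z) d"
  have top: "(\<lambda>z. ?M z (top_row z (cnj z) d) p' q' - z ^ p' * cnj z ^ q') \<in> zpolys_less (p' + q')"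
    if "p' + q' < p + q" for p' q'
    by (rule less.hyps[OF that]) (auto simp: top_row_def)
  consider "p = 0" "q = 0" | "p = 0" "q = 1" | "p = 1" "q = 0"
    | q' where "p = 0" "q = Suc (Suc q')" | p' where "p = Suc p'" "p' + q \<ge> 1"
    by (cases p; cases q; cases "q - 1"; cases "p - 1") auto
  then show ?case
  proof cases
    case 1 then show ?thesis by (simp add: band_det_0_0 zpolys_zero)
  next
    case 2 then show ?thesis using less.prems(2) by (simp add: band_det_0_1 zpolys_zero)
  next
    case 3 then show ?thesis using less.prems(1) by (simp add: band_det_1_0 zpolys_zero)
  next
    case (4 q')
    have eq: "?M z (r z) p q - z ^ p * cnj z ^ q
        = z ^ 0 * cnj z ^ 1 * (?M z (top_row z (cnj z) d) 0 (Suc q') - z ^ 0 * cnj z ^ Suc q')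
          - k * ?M z (top_row z (cnj z) d) (Suc 0) q'" for z
      unfolding 4 by (subst band_det_0_Suc_Suc) (auto simp: less.prems less.prems(2)[unfolded One_nat_def] algebra_simps)
    have "(\<lambda>z. ?M z (\<lambda>j. top_row z (cnj z) d j) (Suc 0) q') \<in> zpolys_less (Suc (Suc 0 + q'))"
      by (rule band_det_in_zpolys, rule top_row_in_zpolys) (simp add: top_row_def)
    then have "(\<lambda>z. k * ?M z (top_row z (cnj z) d) (Suc 0) q') \<in> zpolys_less (p + q)"
      using 4 by (intro zpolys_scale) simp
    moreover have "(\<lambda>z. z ^ 0 * cnj z ^ 1 * (?M z (top_row z (cnj z) d) 0 (Suc q') - z ^ 0 * cnj z ^ Suc q'))
        \<in> zpolys_less (p + q)"
      using 4 by (intro zpolys_mult_monomial[OF top]) auto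
    ultimately show ?thesis unfolding eq by (intro zpolys_diff)
  next
    case (5 p')
    let ?b = "if p' + q = 1 then a else c"
    have eq: "?M z (r z) p q - z ^ p * cnj z ^ q
        = z ^ 1 * cnj z ^ 0 * (?M z (top_row z (cnj z) d) p' q - z ^ p' * cnj z ^ q)
          - ?b * ?M z (\<lambda>j. r z (Suc j)) p' q" for z
      unfolding 5(1) by (subst band_det_Suc[OF 5(2)]) (simp add: less.prems algebra_simps)
    have r1: "(\<lambda>z. r z (Suc j)) \<in> zpolys_less 2" if "j < 3" for j
    proof -
      from that consider "j = 0" | "j = 1" | "j = 2" by linarith
      then show ?thesis
        using less.prems(2,3,4) monomial_in_zpolys[of 0 1 2] zpolys_const[of 2 k] zpolys_zero
        by cases (auto simp: numeral_2_eq_2)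
    qed
    have "(\<lambda>z. ?M z (\<lambda>j. r z (Suc j)) p' q) \<in> zpolys_less (Suc (p' + q))"
      by (rule band_det_in_zpolys) (use r1 less.prems(4) in auto)
    then have "(\<lambda>z. ?b * ?M z (\<lambda>j. r z (Suc j)) p' q) \<in> zpolys_less (p + q)"
      using 5 by (intro zpolys_scale) simp
    moreover have "(\<lambda>z. z ^ 1 * cnj z ^ 0 * (?M z (top_row z (cnj z) d) p' q - z ^ p' * cnj z ^ q))
        \<in> zpolys_less (p + q)"
      using 5 by (intro zpolys_mult_monomial[OF top]) auto
    ultimately show ?thesis unfolding eq by (intro zpolys_diff)
  qed
qed

lemma Q_poly_leading_term:
  assumes "k \<le> m"
  shows "(\<lambda>z. Q_poly a c m k z - z ^ (m - k) * cnj z ^ k) \<in> zpolys_less m"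
  unfolding Q_poly_eq_band_det[OF assms]
  using band_det_leading_term[of "\<lambda>z. top_row z (cnj z) (cnj a)" "cnj a" a c "cnj c" "m - k" k] assms
  by (simp add: top_row_def)

lemma Q_poly_in_zpolys:
  assumes "k \<le> m"
  shows "Q_poly a c m k \<in> zpolys_less (Suc m)"
proof -
  have "(\<lambda>z. (Q_poly a c m k z - z ^ (m - k) * cnj z ^ k) + z ^ (m - k) * cnj z ^ k) \<in> zpolys_less (Suc m)"
    using Q_poly_leading_term[OF assms, of a c] zpolys_mono[of m "Suc m"] assms
    by (intro zpolys_add monomial_in_zpolys) auto
  then show ?thesis by simp
qed

subsection \<open>Means over the circle and the torus\<close>

abbreviation circle :: "complex set" where "circle \<equiv> sphere 0 1"

definition circ :: "real \<Rightarrow> complex" where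
  "circ s = exp (2 * of_real pi * \<i> * of_real s)"

definition circle_mean :: "(complex \<Rightarrow> complex) \<Rightarrow> complex" where
  "circle_mean f = integral {0..1} (\<lambda>s. f (circ s))"

text \<open>An iterated mean with \<open>x\<close> innermost, so that function theory in
  \<open>x\<close> applies for each frozen \<open>y\<close>.\<close>

definition torus_mean :: "(complex \<Rightarrow> complex \<Rightarrow> complex) \<Rightarrow> complex" where
  "torus_mean F = circle_mean (\<lambda>y. circle_mean (\<lambda>x. F x y))"

lemma circ_in_circle [simp]: "circ s \<in> sphere 0 1" "norm (circ s) = 1" "circ s \<noteq> 0"
  by (auto simp: circ_def)

lemma continuous_on_circ [continuous_intros]:
  "continuous_on A f \<Longrightarrow> continuous_on A (\<lambda>x. circ (f x))"
  unfolding circ_def by (intro continuous_intros)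

lemma circ_add: "circ (s + t) = circ s * circ t"
  by (simp add: circ_def exp_add[symmetric] algebra_simps)

lemma circ_1 [simp]: "circ 1 = 1"
  by (simp add: circ_def exp_eq_1)

lemma circ_minus: "circ (- s) = inverse (circ s)"
  by (simp add: circ_def exp_minus)

lemma circle_eq_circ:
  assumes "norm w = 1"
  shows "\<exists>\<theta>\<in>{0..1}. w = circ \<theta>"
proof (rule bexI[of _ "Arg2pi w / (2 * pi)"])
  show "w = circ (Arg2pi w / (2 * pi))"
    using Arg2pi_eq[of w] assms by (simp add: circ_def mult_ac)
  show "Arg2pi w / (2 * pi) \<in> {0..1}"
    using Arg2pi[of w] by (auto simp: field_simps)
qed

text \<open>Cauchy's formula at the centre: along the circle the form du / u is 2 \<pi> i ds, so the
  contour integral is a plain mean.\<close>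

lemma circle_mean_holomorphic:
  assumes "F holomorphic_on cball 0 1"
  shows "circle_mean F = F 0"
proof -
  have "((\<lambda>u. F u / (u - 0)) has_contour_integral (2 * of_real pi * \<i> * F 0)) (circlepath 0 1)"
    using Cauchy_integral_circlepath_simple[OF assms, of 0] by simp
  then have "((\<lambda>s. F (circ s) / circ s * (2 * pi * \<i> * circ s)) has_integral (2 * of_real pi * \<i> * F 0)) {0..1}"
    unfolding has_contour_integral_def
  proof (rule has_integral_eq[rotated])
    fix s :: real assume "s \<in> {0..1}"
    then have "vector_derivative (circlepath 0 1) (at s within {0..1}) = 2 * pi * \<i> * circ s"
      by (subst vector_derivative_circlepath01) (auto simp: circ_def)
    moreover have "circlepath 0 1 s = circ s" by (simp add: circlepath circ_def)
    ultimately show "F (circlepath 0 1 s) / (circlepath 0 1 s - 0)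
        * vector_derivative (circlepath 0 1) (at s within {0..1})
      = F (circ s) / circ s * (2 * pi * \<i> * circ s)" by simp
  qed
  then have "((\<lambda>s. (2 * of_real pi * \<i>) * F (circ s)) has_integral (2 * of_real pi * \<i> * F 0)) {0..1}"
    by (rule has_integral_eq[rotated]) (auto simp: field_simps)
  from has_integral_mult_right[OF this, of "inverse (2 * of_real pi * \<i>)"]
  have "((\<lambda>s. F (circ s)) has_integral F 0) {0..1}" by (simp add: field_simps)
  then show ?thesis unfolding circle_mean_def by (rule integral_unique)
qed

text \<open>In terms of the angle this is a reflection followed by a translation, and periodicity
  brings the interval back to \<open>{0..1}\<close>. It is the invariance needed to exchange two of
  three unimodular numbers with product 1 while the third is fixed.\<close>

lemma circle_mean_reflect:
  assumes f: "continuous_on (sphere 0 1) f" and w: "norm w = 1"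
  shows "circle_mean (\<lambda>x. f (w / x)) = circle_mean f"
proof -
  obtain \<theta> where \<theta>: "\<theta> \<in> {0..1}" "w = circ \<theta>" using circle_eq_circ[OF w] by blast
  define g where "g = (\<lambda>s. f (circ s))"
  have cont: "continuous_on A g" for A
    unfolding g_def by (rule continuous_on_compose2[OF f]) (auto intro!: continuous_intros)
  then have int: "g integrable_on {a..b}" for a b by (intro integrable_continuous_real)
  have per: "g (1 + s) = g s" for s by (simp add: g_def circ_add)
  have "circle_mean (\<lambda>x. f (w / x)) = integral {0..1} (\<lambda>s. g (\<theta> + - s))"
    unfolding circle_mean_def g_def circ_add circ_minus \<theta> by (simp add: divide_inverse)
  also have "\<dots> = integral {-1..0} (\<lambda>s. g (\<theta> + s))"
    using Henstock_Kurzweil_Integration.integral_reflect_real[of 0 "-1" "\<lambda>s. g (\<theta> + s)"] by simp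
  also have "\<dots> = integral {\<theta> - 1..\<theta>} g"
    using integral_shift_Icc_real[of "-1" 0 g \<theta>] by (simp add: o_def add.commute)
  also have "\<dots> = integral {\<theta> - 1..0} g + integral {0..\<theta>} g"
    using \<theta> int by (intro Henstock_Kurzweil_Integration.integral_combine[symmetric]) auto
  also have "integral {\<theta> - 1..0} g = integral {\<theta> - 1..0} (g \<circ> (+) 1)"
    by (simp add: o_def per)
  also have "\<dots> = integral {\<theta>..1} g"
    using integral_shift_Icc_real[of "\<theta> - 1" 0 g 1] by simp
  also have "\<dots> + integral {0..\<theta>} g = integral {0..1} g"
    using \<theta> int by (subst add.commute, intro Henstock_Kurzweil_Integration.integral_combine) auto
  finally show ?thesis by (simp add: circle_mean_def g_def)
qed

lemma torus_continuous:
  assumes "continuous_on (circle \<times> circle) (\<lambda>(x, y). F x y)"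
  shows "continuous_on A (\<lambda>(s, t). F (circ s) (circ t))"
  unfolding split_def
  by (rule continuous_on_compose2[OF assms[unfolded split_def],
        where f = "\<lambda>x. (circ (fst x), circ (snd x))", simplified])
    (auto intro!: continuous_intros)

lemma torus_mean_swap:
  assumes "continuous_on (circle \<times> circle) (\<lambda>(x, y). F x y)"
  shows "torus_mean (\<lambda>x y. F y x) = torus_mean F"
proof -
  note c = torus_continuous[OF assms]
  show ?thesis unfolding torus_mean_def circle_mean_def
    using integral_swap_continuous[of "0::real" "0::real" 1 1 "\<lambda>s t. F (circ s) (circ t)"] c
    by simp
qed

lemma torus_mean_eq_integral:
  assumes "continuous_on (circle \<times> circle) (\<lambda>(x, y). F x y)"
  shows "integral (cbox (0, 0) (1, 1)) (\<lambda>(s, t). F (circ s) (circ t)) = torus_mean F"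
proof -
  note c = torus_continuous[OF assms]
  have "integral (cbox (0, 0) (1, 1)) (\<lambda>(s, t). F (circ s) (circ t)) = torus_mean (\<lambda>x y. F y x)"
    unfolding torus_mean_def circle_mean_def
    using integral_prod_continuous[of "0::real" "0::real" 1 1 "\<lambda>(s, t). F (circ s) (circ t)"] c
    by simp
  then show ?thesis using torus_mean_swap[OF assms] by simp
qed

subsection \<open>The determinants as alternating sums\<close>

definition alt :: "(complex \<Rightarrow> complex \<Rightarrow> complex \<Rightarrow> complex) \<Rightarrow> complex \<Rightarrow> complex \<Rightarrow> complex \<Rightarrow> complex" where
  "alt \<Phi> u v w = \<Phi> u v w - \<Phi> v u w - \<Phi> w v u - \<Phi> u w v + \<Phi> v w u + \<Phi> w u v"

text \<open>On u v w = 1 the quotient u / w equals u^2 v, so this is (u - v) (u - w) (v - w), the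
  Weyl denominator of SU(3).\<close>

abbreviation vdm :: "complex \<Rightarrow> complex \<Rightarrow> complex \<Rightarrow> complex" where
  "vdm \<equiv> alt (\<lambda>u v w. u / w)"

definition Q_term :: "complex \<Rightarrow> nat \<Rightarrow> nat \<Rightarrow> complex \<Rightarrow> complex \<Rightarrow> complex \<Rightarrow> complex" where
  "Q_term e p q u v w = u ^ Suc p * (1 / w) ^ Suc q * (1 - cnj e / u ^ 3) * (1 - e * w ^ 3)"

lemma alt_cong:
  assumes "\<And>x y s. (x, y, s) \<in> {(u, v, w), (v, u, w), (w, v, u), (u, w, v), (v, w, u), (w, u, v)} \<Longrightarrow> \<Phi> x y s = \<Psi> x y s"
  shows "alt \<Phi> u v w = alt \<Psi> u v w"
  unfolding alt_def using assms by simp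

lemma alt_scale: "alt (\<lambda>x y s. k * \<Phi> x y s) u v w = k * alt \<Phi> u v w"
  by (simp add: alt_def algebra_simps)

lemma alt_diff: "alt (\<lambda>x y s. \<Phi> x y s - \<Psi> x y s) u v w = alt \<Phi> u v w - alt \<Psi> u v w"
  by (simp add: alt_def algebra_simps)

lemma alt_add: "alt (\<lambda>x y s. \<Phi> x y s + \<Psi> x y s) u v w = alt \<Phi> u v w + alt \<Psi> u v w"
  by (simp add: alt_def algebra_simps)

text \<open>Only the product of \<open>u\<close>, \<open>v\<close>, \<open>w\<close> is prescribed,
  not their moduli. The identities are algebraic, and \<open>zb\<close> becomes the conjugate of
  \<open>zz\<close> once the three numbers are unimodular.\<close>

locale deltoid_point =
  fixes a c \<kappa> e u v w :: complex
  assumes c0: "c \<noteq> 0" and kappa: "\<kappa> ^ 3 = c\<^sup>2 * cnj c" "\<kappa> * cnj \<kappa> = c * cnj c"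
    and a_eq: "a = c * (1 - e)"
    and uvw: "u * v * w = 1"
begin

lemma nz: "\<kappa> \<noteq> 0" "cnj \<kappa> \<noteq> 0" "cnj c \<noteq> 0" "u \<noteq> 0" "v \<noteq> 0" "w \<noteq> 0"
  using c0 kappa uvw by auto

lemma kappa2: "c * cnj \<kappa> = \<kappa>\<^sup>2"
proof -
  have "\<kappa> * (c * cnj \<kappa>) = c * (\<kappa> * cnj \<kappa>)" by (simp add: algebra_simps)
  also have "\<dots> = \<kappa> ^ 3" unfolding kappa by (simp add: power2_eq_square algebra_simps)
  finally have "\<kappa> * (c * cnj \<kappa>) = \<kappa> * \<kappa>\<^sup>2" by (simp add: power3_eq_cube power2_eq_square)
  then show ?thesis using nz by simp
qed

lemma inverses: "inverse u = v * w" "inverse v = u * w" "inverse w = u * v"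
  using uvw nz by (auto simp: field_simps)

abbreviation "zz \<equiv> \<kappa> * (u + v + w)"
abbreviation "zb \<equiv> cnj \<kappa> * (v * w + u * w + u * v)"

text \<open>For e = 0 these are the alternating sums for the matrix with a = c. The factor
  \<open>1 - e * w ^ 3\<close> builds in the corner entry of the last row. Integer exponents are
  required because the closed form reaches down to index -3.\<close>

definition R :: "int \<Rightarrow> int \<Rightarrow> complex" where
  "R p q = \<kappa> powi p * cnj \<kappa> powi q *
     alt (\<lambda>u v w. u powi (p + 1) * (w powi (- (q + 1)) * (1 - e * w ^ 3))) u v w"

text \<open>\<kappa> x is a root of the characteristic polynomial of the determinant recurrence;
  \<open>kappa2\<close> is what matches the middle coefficient.\<close>

lemma cubic:
  assumes "x \<in> {u, v, w}"
  shows "\<kappa> ^ 3 * x ^ 3 = zz * \<kappa>\<^sup>2 * x\<^sup>2 - c * zb * \<kappa> * x + c\<^sup>2 * cnj c"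
proof -
  have "(x - u) * (x - v) * (x - w) = 0" using assms by auto
  then have "x ^ 3 = (u + v + w) * x\<^sup>2 - (v * w + u * w + u * v) * x + u * v * w"
    by (simp add: algebra_simps power2_eq_square power3_eq_cube)
  then have "\<kappa> ^ 3 * x ^ 3 = \<kappa> ^ 3 * ((u + v + w) * x\<^sup>2 - (v * w + u * w + u * v) * x + 1)"
    by (simp add: uvw)
  also have "\<dots> = zz * \<kappa>\<^sup>2 * x\<^sup>2 - \<kappa>\<^sup>2 * (v * w + u * w + u * v) * \<kappa> * x + \<kappa> ^ 3"
    by (simp add: algebra_simps power2_eq_square power3_eq_cube)
  finally show ?thesis unfolding kappa(1) kappa2[symmetric] by (simp add: mult.assoc)
qed

lemma powi_shift:
  fixes x :: complex
  assumes "x \<noteq> 0"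
  shows "x powi (p + 1) = x powi (p - 2) * x ^ 3" "x powi p = x powi (p - 2) * x ^ 2"
    "x powi (p - 1) = x powi (p - 2) * x"
proof -
  have "x powi (p - 2 + 3) = x powi (p - 2) * x powi 3" "x powi (p - 2 + 2) = x powi (p - 2) * x powi 2"
    "x powi (p - 2 + 1) = x powi (p - 2) * x powi 1"
    using assms power_int_add[of x "p - 2"] by blast+
  then show "x powi (p + 1) = x powi (p - 2) * x ^ 3" "x powi p = x powi (p - 2) * x ^ 2"
    "x powi (p - 1) = x powi (p - 2) * x" by (simp_all add: algebra_simps)
qed

text \<open>Up to a fixed factor each summand depends on \<open>p\<close> only through the power
  (\<kappa> x)^p, and \<kappa> x satisfies the cubic; alternation is linear.\<close>

lemma R_rec: "R p q = zz * R (p - 1) q - c * zb * R (p - 2) q + c\<^sup>2 * cnj c * R (p - 3) q"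
proof -
  let ?W = "\<lambda>x. x powi (- (q + 1)) * (1 - e * x ^ 3)"
  let ?K = "\<kappa> powi (p - 3) * cnj \<kappa> powi q"
  have k: "\<kappa> powi p = \<kappa> powi (p - 3) * \<kappa> ^ 3" "\<kappa> powi (p - 1) = \<kappa> powi (p - 3) * \<kappa>\<^sup>2"
    "\<kappa> powi (p - 2) = \<kappa> powi (p - 3) * \<kappa>"
    using powi_shift[of \<kappa> "p - 1"] nz by simp_all
  have expand: "(A * \<kappa>\<^sup>2 * x\<^sup>2 - B * \<kappa> * x + C) * (P * W)
      = A * (\<kappa>\<^sup>2 * (P * x\<^sup>2 * W)) - B * (\<kappa> * (P * x * W)) + C * (P * W)" for A B C P W x :: complex
    by (simp add: algebra_simps)
  have "R p q = ?K * \<kappa> ^ 3 * alt (\<lambda>x y s. x powi (p + 1) * ?W s) u v w"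
    by (simp add: R_def k mult_ac)
  also have "\<dots> = ?K * alt (\<lambda>x y s. \<kappa> ^ 3 * (x powi (p + 1) * ?W s)) u v w"
    by (simp only: alt_scale mult.assoc)
  also have "alt (\<lambda>x y s. \<kappa> ^ 3 * (x powi (p + 1) * ?W s)) u v w
      = alt (\<lambda>x y s. zz * (\<kappa>\<^sup>2 * (x powi p * ?W s)) - c * zb * (\<kappa> * (x powi (p - 1) * ?W s))
          + c\<^sup>2 * cnj c * (x powi (p - 2) * ?W s)) u v w"
  proof (rule alt_cong)
    fix x y s assume "(x, y, s) \<in> {(u, v, w), (v, u, w), (w, v, u), (u, w, v), (v, w, u), (w, u, v)}"
    then have x: "x \<in> {u, v, w}" by auto
    then have "x \<noteq> 0" using nz by auto
    have "\<kappa> ^ 3 * (x powi (p + 1) * ?W s) = (\<kappa> ^ 3 * x ^ 3) * (x powi (p - 2) * ?W s)"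
      using powi_shift(1)[OF \<open>x \<noteq> 0\<close>, of p] by (simp only: mult_ac)
    also have "\<dots> = zz * (\<kappa>\<^sup>2 * (x powi (p - 2) * x\<^sup>2 * ?W s)) - c * zb * (\<kappa> * (x powi (p - 2) * x * ?W s))
          + c\<^sup>2 * cnj c * (x powi (p - 2) * ?W s)"
      unfolding cubic[OF x] by (rule expand)
    finally show "\<kappa> ^ 3 * (x powi (p + 1) * ?W s) = zz * (\<kappa>\<^sup>2 * (x powi p * ?W s))
        - c * zb * (\<kappa> * (x powi (p - 1) * ?W s)) + c\<^sup>2 * cnj c * (x powi (p - 2) * ?W s)"
      unfolding powi_shift(2,3)[OF \<open>x \<noteq> 0\<close>, of p] .
  qed
  also have "?K * \<dots> = zz * R (p - 1) q - c * zb * R (p - 2) q + c\<^sup>2 * cnj c * R (p - 3) q"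
    unfolding alt_add alt_diff alt_scale R_def k by (simp add: ring_distribs mult_ac)
  finally show ?thesis .
qed

text \<open>The exponent of the first variable is 0, so every summand depends on one variable only
  and the transpositions cancel in pairs.\<close>

lemma R_m1: "R (-1) q = 0"
  by (simp add: R_def alt_def)

lemma powi_neg_shift:
  fixes x :: complex
  assumes "x \<noteq> 0"
  shows "x powi (- q) = x powi (- (q + 1)) * x" "x powi (- (q - 1)) = x powi (- (q + 1)) * x\<^sup>2"
  using powi_shift(3)[OF assms, of "1 - q"] powi_shift(2)[OF assms, of "1 - q"]
  by (simp_all add: algebra_simps)

lemma inverses_perm:
  assumes "(x, y, s) \<in> {(u, v, w), (v, u, w), (w, v, u), (u, w, v), (v, w, u), (w, u, v)}"
  shows "inverse x = y * s" "inverse s = x * y" "x \<noteq> 0" "s \<noteq> 0"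
  using assms inverses nz by (auto simp: mult.commute)

text \<open>Since x y s = 1, a negative power of \<open>x\<close> is a positive power of y s. The
  role of \<open>x\<close> passes to \<open>y\<close>, and exchanging the two costs the sign.
  \<open>R_m3\<close> uses the same reflection with squares.\<close>

lemma R_m2: "c * R (-2) q = - R 0 (q - 1)"
proof -
  let ?F = "\<lambda>x. x powi (- (q + 1)) * (1 - e * x ^ 3)"
  have 1: "alt (\<lambda>x y s. x powi (-2 + 1) * ?F s) u v w = alt (\<lambda>x y s. y * (s * ?F s)) u v w"
    by (rule alt_cong) (use inverses_perm in \<open>simp add: power_int_minus mult.assoc\<close>)
  have 2: "alt (\<lambda>x y s. x powi (0 + 1) * (s powi (- (q - 1 + 1)) * (1 - e * s ^ 3))) u v w
      = alt (\<lambda>x y s. x * (s * ?F s)) u v w"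
    by (rule alt_cong) (simp add: powi_neg_shift(1)[OF inverses_perm(4)] mult_ac)
  have 3: "alt (\<lambda>x y s. y * (s * ?F s)) u v w = - alt (\<lambda>x y s. x * (s * ?F s)) u v w"
    by (simp add: alt_def)
  have k: "c * (\<kappa> powi (-2) * cnj \<kappa> powi q) = cnj \<kappa> powi (q - 1)"
  proof -
    have "cnj \<kappa> powi q = cnj \<kappa> powi (q - 1) * cnj \<kappa>"
      using power_int_add[of "cnj \<kappa>" "q - 1" 1] nz by simp
    then have "c * (\<kappa> powi (-2) * cnj \<kappa> powi q) = (c * cnj \<kappa>) * \<kappa> powi (-2) * cnj \<kappa> powi (q - 1)"
      by (simp add: mult_ac)
    then show ?thesis unfolding kappa2 using nz by (simp add: power_int_minus)
  qed
  have "c * R (-2) q = (c * (\<kappa> powi (-2) * cnj \<kappa> powi q)) * alt (\<lambda>x y s. x powi (-2 + 1) * ?F s) u v w"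
    by (simp only: R_def mult.assoc)
  also have "\<dots> = - (cnj \<kappa> powi (q - 1) * alt (\<lambda>x y s. x * (s * ?F s)) u v w)"
    unfolding k 1 3 by simp
  also have "\<dots> = - R 0 (q - 1)" unfolding R_def 2 by simp
  finally show ?thesis .
qed

lemma R_m3: "c\<^sup>2 * R (-3) q = - R 1 (q - 2)"
proof -
  let ?F = "\<lambda>x. x powi (- (q + 1)) * (1 - e * x ^ 3)"
  have 1: "alt (\<lambda>x y s. x powi (-3 + 1) * ?F s) u v w = alt (\<lambda>x y s. y\<^sup>2 * (s\<^sup>2 * ?F s)) u v w"
    by (rule alt_cong)
      (use inverses_perm in \<open>simp add: power_int_minus power_inverse[symmetric] power_mult_distrib mult.assoc\<close>)
  have 2: "alt (\<lambda>x y s. x powi (1 + 1) * (s powi (- (q - 2 + 1)) * (1 - e * s ^ 3))) u v w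
      = alt (\<lambda>x y s. x\<^sup>2 * (s\<^sup>2 * ?F s)) u v w"
  proof (rule alt_cong)
    fix x y s assume "(x, y, s) \<in> {(u, v, w), (v, u, w), (w, v, u), (u, w, v), (v, w, u), (w, u, v)}"
    then have "s powi (- (q - 1)) = s powi (- (q + 1)) * s\<^sup>2"
      by (intro powi_neg_shift inverses_perm)
    then show "x powi (1 + 1) * (s powi (- (q - 2 + 1)) * (1 - e * s ^ 3)) = x\<^sup>2 * (s\<^sup>2 * ?F s)"
      by (simp add: mult_ac)
  qed
  have 3: "alt (\<lambda>x y s. y\<^sup>2 * (s\<^sup>2 * ?F s)) u v w = - alt (\<lambda>x y s. x\<^sup>2 * (s\<^sup>2 * ?F s)) u v w"
    by (simp add: alt_def)
  have k: "c\<^sup>2 * (\<kappa> powi (-3) * cnj \<kappa> powi q) = \<kappa> * cnj \<kappa> powi (q - 2)"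
  proof -
    have "cnj \<kappa> powi q = cnj \<kappa> powi (q - 2) * (cnj \<kappa>)\<^sup>2"
      using power_int_add[of "cnj \<kappa>" "q - 2" 2] nz by simp
    then have "c\<^sup>2 * (\<kappa> powi (-3) * cnj \<kappa> powi q) = (c * cnj \<kappa>)\<^sup>2 * \<kappa> powi (-3) * cnj \<kappa> powi (q - 2)"
      by (simp add: mult_ac power_mult_distrib)
    also have "(c * cnj \<kappa>)\<^sup>2 * \<kappa> powi (-3) = \<kappa>"
      unfolding kappa2 using nz by (simp add: power_int_minus power2_eq_square power3_eq_cube field_simps)
    finally show ?thesis .
  qed
  have "c\<^sup>2 * R (-3) q = (c\<^sup>2 * (\<kappa> powi (-3) * cnj \<kappa> powi q)) * alt (\<lambda>x y s. x powi (-3 + 1) * ?F s) u v w"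
    by (simp only: R_def mult.assoc)
  also have "\<dots> = - (\<kappa> * cnj \<kappa> powi (q - 2) * alt (\<lambda>x y s. x\<^sup>2 * (s\<^sup>2 * ?F s)) u v w)"
    unfolding k 1 3 by simp
  also have "\<dots> = - R 1 (q - 2)" unfolding R_def 2 by simp
  finally show ?thesis .
qed

lemma vdm_eq: "vdm u v w = alt (\<lambda>x y s. x\<^sup>2 * y) u v w"
  by (rule alt_cong) (use inverses_perm(2) in \<open>auto simp: divide_inverse power2_eq_square mult.assoc\<close>)

lemma alt_z: "alt (\<lambda>x y s. x\<^sup>2 / s) u v w = (u + v + w) * vdm u v w"
proof -
  have "alt (\<lambda>x y s. x\<^sup>2 / s) u v w = alt (\<lambda>x y s. x ^ 3 * y) u v w"
    by (rule alt_cong)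
      (use inverses_perm(2) in \<open>auto simp: divide_inverse power2_eq_square power3_eq_cube mult.assoc\<close>)
  also have "\<dots> = (u + v + w) * alt (\<lambda>x y s. x\<^sup>2 * y) u v w"
    by (simp add: alt_def algebra_simps power2_eq_square power3_eq_cube)
  finally show ?thesis by (simp only: vdm_eq)
qed

lemma alt_zb: "alt (\<lambda>x y s. x / s\<^sup>2) u v w = (v * w + u * w + u * v) * vdm u v w"
proof -
  have "alt (\<lambda>x y s. x / s\<^sup>2) u v w = alt (\<lambda>x y s. x ^ 3 * y\<^sup>2) u v w"
    by (rule alt_cong)
      (use inverses_perm(2) in \<open>auto simp: divide_inverse power_inverse[symmetric] power2_eq_square power3_eq_cube mult_ac\<close>)
  also have "\<dots> = (v * w + u * w + u * v) * alt (\<lambda>x y s. x\<^sup>2 * y) u v w"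
    by (simp add: alt_def algebra_simps power2_eq_square power3_eq_cube)
  finally show ?thesis by (simp only: vdm_eq)
qed

text \<open>The part with \<open>e\<close> is the monomial x s^2, an even permutation of x^2 y, so
  the value is (1 - e) times the Vandermonde product. This is where 1 - e has to be a / c.\<close>

lemma R00: "c * R 0 0 = a * vdm u v w"
proof -
  have "alt (\<lambda>x y s. x powi (0 + 1) * (s powi (- (0 + 1)) * (1 - e * s ^ 3))) u v w
      = alt (\<lambda>x y s. x / s - e * (x * s\<^sup>2)) u v w"
  proof (rule alt_cong)
    fix x y s assume *: "(x, y, s) \<in> {(u, v, w), (v, u, w), (w, v, u), (u, w, v), (v, w, u), (w, u, v)}"
    show "x powi (0 + 1) * (s powi (- (0 + 1)) * (1 - e * s ^ 3)) = x / s - e * (x * s\<^sup>2)"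
      using inverses_perm(4)[OF *]
      by (simp add: power_int_minus field_simps power2_eq_square power3_eq_cube)
  qed
  also have "\<dots> = vdm u v w - e * alt (\<lambda>x y s. x * s\<^sup>2) u v w"
    by (simp only: alt_diff alt_scale)
  also have "alt (\<lambda>x y s. x * s\<^sup>2) u v w = vdm u v w"
    unfolding vdm_eq by (simp add: alt_def algebra_simps)
  finally have eq: "alt (\<lambda>x y s. x powi (0 + 1) * (s powi (- (0 + 1)) * (1 - e * s ^ 3))) u v w
      = vdm u v w - e * vdm u v w" .
  show ?thesis unfolding R_def eq by (simp add: a_eq algebra_simps)
qed

text \<open>The part with \<open>e\<close> is symmetric in two of the variables and drops out; the
  same happens in \<open>R01\<close>.\<close>

lemma R10: "R 1 0 = zz * vdm u v w"
proof -
  have "alt (\<lambda>x y s. x powi (1 + 1) * (s powi (- (0 + 1)) * (1 - e * s ^ 3))) u v w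
      = alt (\<lambda>x y s. x\<^sup>2 / s - e * (x\<^sup>2 * s\<^sup>2)) u v w"
  proof (rule alt_cong)
    fix x y s assume *: "(x, y, s) \<in> {(u, v, w), (v, u, w), (w, v, u), (u, w, v), (v, w, u), (w, u, v)}"
    show "x powi (1 + 1) * (s powi (- (0 + 1)) * (1 - e * s ^ 3)) = x\<^sup>2 / s - e * (x\<^sup>2 * s\<^sup>2)"
      using inverses_perm(4)[OF *]
      by (simp add: power_int_minus field_simps power2_eq_square power3_eq_cube)
  qed
  also have "\<dots> = (u + v + w) * vdm u v w - e * alt (\<lambda>x y s. x\<^sup>2 * s\<^sup>2) u v w"
    by (simp only: alt_diff alt_scale alt_z)
  also have "alt (\<lambda>x y s. x\<^sup>2 * s\<^sup>2) u v w = 0" by (simp add: alt_def algebra_simps)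
  finally have eq: "alt (\<lambda>x y s. x powi (1 + 1) * (s powi (- (0 + 1)) * (1 - e * s ^ 3))) u v w
      = (u + v + w) * vdm u v w - e * 0" .
  show ?thesis unfolding R_def eq by (simp add: mult.assoc)
qed

lemma R01: "R 0 1 = zb * vdm u v w"
proof -
  have "alt (\<lambda>x y s. x powi (0 + 1) * (s powi (- (1 + 1)) * (1 - e * s ^ 3))) u v w
      = alt (\<lambda>x y s. x / s\<^sup>2 - e * (x * s)) u v w"
  proof (rule alt_cong)
    fix x y s assume *: "(x, y, s) \<in> {(u, v, w), (v, u, w), (w, v, u), (u, w, v), (v, w, u), (w, u, v)}"
    show "x powi (0 + 1) * (s powi (- (1 + 1)) * (1 - e * s ^ 3)) = x / s\<^sup>2 - e * (x * s)"
      using inverses_perm(4)[OF *]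
      by (simp add: power_int_minus field_simps power2_eq_square power3_eq_cube)
  qed
  also have "\<dots> = (v * w + u * w + u * v) * vdm u v w - e * alt (\<lambda>x y s. x * s) u v w"
    by (simp only: alt_diff alt_scale alt_zb)
  also have "alt (\<lambda>x y s. x * s) u v w = 0" by (simp add: alt_def algebra_simps)
  finally have eq: "alt (\<lambda>x y s. x powi (0 + 1) * (s powi (- (1 + 1)) * (1 - e * s ^ 3))) u v w
      = (v * w + u * w + u * v) * vdm u v w - e * 0" .
  show ?thesis unfolding R_def eq by (simp add: mult.assoc)
qed

text \<open>The first row differs from the recurrence only by \<open>cnj a\<close> in place of
  \<open>cnj c\<close>. The difference is a multiple of \<open>R\<close> at \<open>p - 3\<close>,
  which turns into the factor \<open>1 - cnj e / u^3\<close>.\<close>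

lemma band_det_formula:
  assumes "p + q \<ge> 2"
  shows "vdm u v w * band_det a c zz zb (cnj c) (top_row zz zb (cnj a)) p q
    = \<kappa> ^ p * cnj \<kappa> ^ q * alt (Q_term e p q) u v w"
proof -
  have a': "c\<^sup>2 * cnj a = c\<^sup>2 * cnj c - \<kappa> ^ 3 * cnj e"
    unfolding kappa a_eq by (simp add: algebra_simps)
  have "vdm u v w * band_det a c zz zb (cnj c) (top_row zz zb (cnj a)) p q
      = zz * R (int p - 1) (int q) - c * zb * R (int p - 2) (int q) + c\<^sup>2 * cnj a * R (int p - 3) (int q)"
    using band_det_closed_form[OF R_rec R_m1 R_m2 R_m3 R00 R10 R01 assms, of "top_row zz zb (cnj a)"]
    by (simp add: top_row_def)
  also have "\<dots> = R (int p) (int q) - \<kappa> ^ 3 * cnj e * R (int p - 3) (int q)"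
    unfolding a' R_rec[of "int p"] by (simp add: algebra_simps)
  also have "\<kappa> ^ 3 * cnj e * R (int p - 3) (int q)
      = \<kappa> ^ p * cnj \<kappa> ^ q * alt (\<lambda>x y s. cnj e * (x powi (int p - 3 + 1) * (s powi (- (int q + 1)) * (1 - e * s ^ 3)))) u v w"
  proof -
    have "\<kappa> ^ p = \<kappa> ^ 3 * \<kappa> powi (int p - 3)"
      using power_int_add[of \<kappa> 3 "int p - 3"] nz by simp
    then show ?thesis unfolding R_def alt_scale by (simp add: mult_ac)
  qed
  also have "R (int p) (int q) - \<dots> = \<kappa> ^ p * cnj \<kappa> ^ q *
     alt (\<lambda>x y s. x powi (int p + 1) * (s powi (- (int q + 1)) * (1 - e * s ^ 3))
       - cnj e * (x powi (int p - 3 + 1) * (s powi (- (int q + 1)) * (1 - e * s ^ 3)))) u v w"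
    unfolding alt_diff R_def by (simp add: algebra_simps)
  finally have formula: "vdm u v w * band_det a c zz zb (cnj c) (top_row zz zb (cnj a)) p q = \<kappa> ^ p * cnj \<kappa> ^ q *
     alt (\<lambda>x y s. x powi (int p + 1) * (s powi (- (int q + 1)) * (1 - e * s ^ 3))
       - cnj e * (x powi (int p - 3 + 1) * (s powi (- (int q + 1)) * (1 - e * s ^ 3)))) u v w" .
  have collect: "A * (B * F) - E * (A / D * (B * F)) = A * B * (1 - E / D) * F" for A B D E F :: complex
    by (simp add: algebra_simps)
  have "alt (\<lambda>x y s. x powi (int p + 1) * (s powi (- (int q + 1)) * (1 - e * s ^ 3))
       - cnj e * (x powi (int p - 3 + 1) * (s powi (- (int q + 1)) * (1 - e * s ^ 3)))) u v w
     = alt (Q_term e p q) u v w"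
  proof (rule alt_cong)
    fix x y s assume *: "(x, y, s) \<in> {(u, v, w), (v, u, w), (w, v, u), (u, w, v), (v, w, u), (w, u, v)}"
    have x0: "x \<noteq> 0" "s \<noteq> 0" using inverses_perm[OF *] by auto
    have 1: "x powi (int p + 1) = x ^ Suc p" using power_int_add[of x "int p" 1] x0 by simp
    have 2: "x powi (int p - 3 + 1) = x ^ Suc p / x ^ 3"
      using power_int_diff[of x "int p + 1" 3] 1 x0 by simp
    have 3: "s powi (- (int q + 1)) = (1 / s) ^ Suc q"
      using power_int_add[of s "int q" 1] x0 unfolding power_int_minus
      by (simp add: power_divide divide_inverse power_inverse)
    show "x powi (int p + 1) * (s powi (- (int q + 1)) * (1 - e * s ^ 3))
       - cnj e * (x powi (int p - 3 + 1) * (s powi (- (int q + 1)) * (1 - e * s ^ 3))) = Q_term e p q x y s"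
      unfolding 1 2 3 Q_term_def by (rule collect)
  qed
  then show ?thesis unfolding formula by simp
qed

text \<open>The matrix with m = 1 contains no entry \<open>a\<close>, so the general formula does
  not cover it. The alternating sum still gives the right polynomial, up to the constant 1 -
  |e|^2.\<close>

lemma alt_Q_term_1_0: "alt (Q_term e 1 0) u v w = (1 - e * cnj e) * (u + v + w) * vdm u v w"
proof -
  have "alt (Q_term e 1 0) u v w
      = alt (\<lambda>x y s. x\<^sup>2 / s - e * (x\<^sup>2 * s\<^sup>2) - cnj e * (inverse x * inverse s) + e * cnj e * (s\<^sup>2 / x)) u v w"
  proof (rule alt_cong)
    fix x y s assume *: "(x, y, s) \<in> {(u, v, w), (v, u, w), (w, v, u), (u, w, v), (v, w, u), (w, u, v)}"
    show "Q_term e 1 0 x y s = x\<^sup>2 / s - e * (x\<^sup>2 * s\<^sup>2) - cnj e * (inverse x * inverse s) + e * cnj e * (s\<^sup>2 / x)"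
      using inverses_perm(3,4)[OF *]
      by (simp add: Q_term_def field_simps power2_eq_square power3_eq_cube)
  qed
  also have "\<dots> = alt (\<lambda>x y s. x\<^sup>2 / s) u v w - e * alt (\<lambda>x y s. x\<^sup>2 * s\<^sup>2) u v w
      - cnj e * alt (\<lambda>x y s. inverse x * inverse s) u v w + e * cnj e * alt (\<lambda>x y s. s\<^sup>2 / x) u v w"
    by (simp only: alt_diff alt_add alt_scale)
  also have "alt (\<lambda>x y s. x\<^sup>2 * s\<^sup>2) u v w = 0" by (simp add: alt_def algebra_simps)
  also have "alt (\<lambda>x y s. inverse x * inverse s) u v w = 0" by (simp add: alt_def algebra_simps)
  also have "alt (\<lambda>x y s. s\<^sup>2 / x) u v w = - alt (\<lambda>x y s. x\<^sup>2 / s) u v w" by (simp add: alt_def algebra_simps)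
  finally show ?thesis by (simp add: alt_z algebra_simps)
qed

lemma alt_Q_term_0_1: "alt (Q_term e 0 1) u v w = (1 - e * cnj e) * (v * w + u * w + u * v) * vdm u v w"
proof -
  have "alt (Q_term e 0 1) u v w
      = alt (\<lambda>x y s. x / s\<^sup>2 - e * (x * s) - cnj e * (inverse (x\<^sup>2) * inverse (s\<^sup>2)) + e * cnj e * (s / x\<^sup>2)) u v w"
  proof (rule alt_cong)
    fix x y s assume *: "(x, y, s) \<in> {(u, v, w), (v, u, w), (w, v, u), (u, w, v), (v, w, u), (w, u, v)}"
    show "Q_term e 0 1 x y s = x / s\<^sup>2 - e * (x * s) - cnj e * (inverse (x\<^sup>2) * inverse (s\<^sup>2)) + e * cnj e * (s / x\<^sup>2)"
      using inverses_perm(3,4)[OF *]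
      by (simp add: Q_term_def field_simps power2_eq_square power3_eq_cube)
  qed
  also have "\<dots> = alt (\<lambda>x y s. x / s\<^sup>2) u v w - e * alt (\<lambda>x y s. x * s) u v w
      - cnj e * alt (\<lambda>x y s. inverse (x\<^sup>2) * inverse (s\<^sup>2)) u v w + e * cnj e * alt (\<lambda>x y s. s / x\<^sup>2) u v w"
    by (simp only: alt_diff alt_add alt_scale)
  also have "alt (\<lambda>x y s. x * s) u v w = 0" by (simp add: alt_def algebra_simps)
  also have "alt (\<lambda>x y s. inverse (x\<^sup>2) * inverse (s\<^sup>2)) u v w = 0" by (simp add: alt_def algebra_simps)
  also have "alt (\<lambda>x y s. s / x\<^sup>2) u v w = - alt (\<lambda>x y s. x / s\<^sup>2) u v w" by (simp add: alt_def algebra_simps)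
  finally show ?thesis by (simp add: alt_zb algebra_simps)
qed

end

subsection \<open>Orthogonality on the torus\<close>

lemma torus_mean_add:
  assumes F: "continuous_on (circle \<times> circle) (\<lambda>(x, y). F x y)"
    and G: "continuous_on (circle \<times> circle) (\<lambda>(x, y). G x y)"
  shows "torus_mean (\<lambda>x y. F x y + G x y) = torus_mean F + torus_mean G"
proof -
  have FG: "continuous_on (circle \<times> circle) (\<lambda>(x, y). F x y + G x y)"
    using continuous_on_add[OF F G] by (simp add: split_def)
  show ?thesis
    unfolding torus_mean_eq_integral[OF F, symmetric] torus_mean_eq_integral[OF G, symmetric]
      torus_mean_eq_integral[OF FG, symmetric]
    using integral_add[OF integrable_continuous integrable_continuous,
        OF torus_continuous[OF F] torus_continuous[OF G]]
    by (simp add: split_def)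
qed

lemma torus_mean_scale: "torus_mean (\<lambda>x y. k * F x y) = k * torus_mean F"
  by (simp add: torus_mean_def circle_mean_def)

lemma circle_mean_cong: "(\<And>x. norm x = 1 \<Longrightarrow> f x = g x) \<Longrightarrow> circle_mean f = circle_mean g"
  unfolding circle_mean_def by (rule integral_cong) auto

lemma torus_mean_cong:
  "(\<And>x y. norm x = 1 \<Longrightarrow> norm y = 1 \<Longrightarrow> F x y = G x y) \<Longrightarrow> torus_mean F = torus_mean G"
  unfolding torus_mean_def by (intro circle_mean_cong) auto

definition cont3 :: "(complex \<Rightarrow> complex \<Rightarrow> complex \<Rightarrow> complex) \<Rightarrow> bool" where
  "cont3 \<Phi> \<longleftrightarrow> continuous_on (circle \<times> circle \<times> circle) (\<lambda>(u, v, w). \<Phi> u v w)"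

definition sym_mean :: "(complex \<Rightarrow> complex \<Rightarrow> complex \<Rightarrow> complex) \<Rightarrow> complex" where
  "sym_mean \<Phi> = torus_mean (\<lambda>x y. \<Phi> x y (1 / (x * y)))"

lemma cont3_compose:
  assumes "cont3 \<Phi>" "continuous_on A f" "continuous_on A g" "continuous_on A h"
    "\<And>x. x \<in> A \<Longrightarrow> norm (f x) = 1 \<and> norm (g x) = 1 \<and> norm (h x) = 1"
  shows "continuous_on A (\<lambda>x. \<Phi> (f x) (g x) (h x))"
proof -
  have "continuous_on A (\<lambda>x. (f x, g x, h x))"
    using assms(2-4) by (intro continuous_on_Pair)
  moreover have "(\<lambda>x. (f x, g x, h x)) ` A \<subseteq> circle \<times> circle \<times> circle"
    using assms(5) by (simp add: image_subset_iff)
  ultimately show ?thesis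
    using continuous_on_compose2[OF assms(1)[unfolded cont3_def], of A "\<lambda>x. (f x, g x, h x)"] by simp
qed

lemma cont3_torus:
  assumes "cont3 \<Phi>"
  shows "continuous_on (circle \<times> circle) (\<lambda>(x, y). \<Phi> x y (1 / (x * y)))"
  unfolding split_def
  by (rule cont3_compose[OF assms]) (auto intro!: continuous_intros simp: norm_mult norm_divide)

lemma cont3_perm:
  assumes "cont3 \<Phi>"
  shows "cont3 (\<lambda>u v w. \<Phi> v u w)" "cont3 (\<lambda>u v w. \<Phi> w v u)"
proof -
  show "cont3 (\<lambda>u v w. \<Phi> v u w)" unfolding cont3_def split_def
    by (rule cont3_compose[OF assms]) (auto intro!: continuous_intros)
  show "cont3 (\<lambda>u v w. \<Phi> w v u)" unfolding cont3_def split_def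
    by (rule cont3_compose[OF assms]) (auto intro!: continuous_intros)
qed

lemma sym_mean_swap12:
  assumes "cont3 \<Phi>"
  shows "sym_mean (\<lambda>u v w. \<Phi> v u w) = sym_mean \<Phi>"
  using torus_mean_swap[OF cont3_torus[OF assms]] by (simp add: sym_mean_def mult.commute)

text \<open>For fixed \<open>y\<close>, exchanging \<open>x\<close> with 1 / (x y) is a reflection
  of the circle.\<close>

lemma sym_mean_swap13:
  assumes "cont3 \<Phi>"
  shows "sym_mean (\<lambda>u v w. \<Phi> w v u) = sym_mean \<Phi>"
  unfolding sym_mean_def torus_mean_def
proof (rule circle_mean_cong)
  fix y :: complex assume y: "norm y = 1"
  have "continuous_on circle (\<lambda>x. \<Phi> x y (1 / (x * y)))"
    by (rule cont3_compose[OF assms])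
      (use y in \<open>auto intro!: continuous_intros simp: norm_mult norm_divide\<close>)
  from circle_mean_reflect[OF this, of "1 / y"] y
  have "circle_mean (\<lambda>x. \<Phi> (1 / y / x) y (1 / (1 / y / x * y))) = circle_mean (\<lambda>x. \<Phi> x y (1 / (x * y)))"
    by (simp add: norm_divide)
  moreover have "circle_mean (\<lambda>x. \<Phi> (1 / y / x) y (1 / (1 / y / x * y)))
      = circle_mean (\<lambda>x. \<Phi> (1 / (x * y)) y x)"
  proof (rule circle_mean_cong)
    fix x :: complex assume x: "norm x = 1"
    have "x \<noteq> 0" "y \<noteq> 0" using x y by auto
    then show "\<Phi> (1 / y / x) y (1 / (1 / y / x * y)) = \<Phi> (1 / (x * y)) y x"
      by (simp add: mult.commute)
  qed
  ultimately show "circle_mean (\<lambda>x. \<Phi> (1 / (x * y)) y x) = circle_mean (\<lambda>x. \<Phi> x y (1 / (x * y)))"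
    by simp
qed

lemma sym_mean_add:
  assumes "cont3 \<Phi>" "cont3 \<Psi>"
  shows "sym_mean (\<lambda>u v w. \<Phi> u v w + \<Psi> u v w) = sym_mean \<Phi> + sym_mean \<Psi>"
  unfolding sym_mean_def by (rule torus_mean_add[OF assms[THEN cont3_torus]])

lemma cont3_add: "cont3 \<Phi> \<Longrightarrow> cont3 \<Psi> \<Longrightarrow> cont3 (\<lambda>u v w. \<Phi> u v w + \<Psi> u v w)"
  unfolding cont3_def split_def by (intro continuous_intros)

lemma cont3_mult: "cont3 \<Phi> \<Longrightarrow> cont3 \<Psi> \<Longrightarrow> cont3 (\<lambda>u v w. \<Phi> u v w * \<Psi> u v w)"
  unfolding cont3_def split_def by (intro continuous_intros)

text \<open>The two transpositions generate all permutations and preserve the mean. Against an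
  antisymmetric function the six signed terms therefore contribute equally, so a single term decides
  whether the mean vanishes.\<close>

lemma sym_mean_alt:
  assumes t: "cont3 t" and \<Psi>: "cont3 \<Psi>"
    and anti: "\<And>u v w. \<Psi> v u w = - \<Psi> u v w" "\<And>u v w. \<Psi> w v u = - \<Psi> u v w"
  shows "sym_mean (\<lambda>u v w. alt t u v w * \<Psi> u v w) = 6 * sym_mean (\<lambda>u v w. t u v w * \<Psi> u v w)"
proof -
  define P where "P = (\<lambda>u v w. t u v w * \<Psi> u v w)"
  have P1: "cont3 P" unfolding P_def using t \<Psi> by (rule cont3_mult)
  note P2 = cont3_perm(1)[OF P1] and P3 = cont3_perm(2)[OF P1]
  note P4 = cont3_perm(1)[OF P3] and P5 = cont3_perm(2)[OF P2]
  note P6 = cont3_perm(1)[OF P5]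
  have anti': "\<Psi> u w v = - \<Psi> u v w" "\<Psi> v w u = \<Psi> u v w" "\<Psi> w u v = \<Psi> u v w" for u v w
    using anti by (metis minus_minus)+
  have expand: "alt t u v w * \<Psi> u v w = P u v w + P v u w + P w v u + P u w v + P v w u + P w u v" for u v w
  proof -
    have "\<Psi> v u w = - \<Psi> u v w" "\<Psi> w v u = - \<Psi> u v w" "\<Psi> u w v = - \<Psi> u v w"
      "\<Psi> v w u = \<Psi> u v w" "\<Psi> w u v = \<Psi> u v w" by (rule anti anti')+
    then show ?thesis unfolding alt_def P_def by (simp add: algebra_simps)
  qed
  have "sym_mean (\<lambda>u v w. alt t u v w * \<Psi> u v w)
      = sym_mean P + sym_mean (\<lambda>u v w. P v u w) + sym_mean (\<lambda>u v w. P w v u)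
        + sym_mean (\<lambda>u v w. P u w v) + sym_mean (\<lambda>u v w. P v w u) + sym_mean (\<lambda>u v w. P w u v)"
    unfolding expand by (simp add: sym_mean_add cont3_add P1 P2 P3 P4 P5 P6)
  also have "\<dots> = 6 * sym_mean P"
    using sym_mean_swap12[OF P1] sym_mean_swap13[OF P1] sym_mean_swap12[OF P3]
      sym_mean_swap13[OF P2] sym_mean_swap12[OF P5] by simp
  finally show ?thesis by (simp add: P_def)
qed

section \<open>The weight and the vanishing of a single term\<close>

lemma one_minus_cube_nz:
  fixes e x :: complex
  assumes "norm e < 1" "norm x \<le> 1"
  shows "1 - e * x ^ 3 \<noteq> 0"
proof
  assume "1 - e * x ^ 3 = 0"
  then have "norm (e * x ^ 3) = 1" by (metis eq_iff_diff_eq_0 norm_one)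
  moreover have "norm (e * x ^ 3) \<le> norm e * 1"
    unfolding norm_mult norm_power using assms by (intro mult_left_mono power_le_one) auto
  ultimately show False using assms by simp
qed

lemma one_minus_cube_nz':
  fixes e x :: complex
  assumes "norm e < 1" "norm x = 1"
  shows "1 - cnj e / x ^ 3 \<noteq> 0"
  using one_minus_cube_nz[of "cnj e" "1 / x"] assms by (simp add: norm_divide power_divide)

text \<open>For unimodular \<open>u\<close> the number \<open>1 - cnj e / u ^ 3\<close> is the
  conjugate of \<open>1 - e * u ^ 3\<close>. This is the reciprocal squared modulus from the
  density, written as a rational function so that it extends off the circle.\<close>

definition weight :: "complex \<Rightarrow> complex \<Rightarrow> complex \<Rightarrow> complex \<Rightarrow> complex" where
  "weight e u v w = 1 / ((1 - e * u ^ 3) * (1 - cnj e / u ^ 3) * ((1 - e * v ^ 3) * (1 - cnj e / v ^ 3))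
     * ((1 - e * w ^ 3) * (1 - cnj e / w ^ 3)))"

text \<open>The weight times the conjugates, on the torus, of the Vandermonde product and of the
  monomial z^i (cnj z)^j, all expressed by inverses instead of conjugation.\<close>

definition conj_test :: "complex \<Rightarrow> complex \<Rightarrow> nat \<Rightarrow> nat \<Rightarrow> complex \<Rightarrow> complex \<Rightarrow> complex \<Rightarrow> complex" where
  "conj_test \<kappa> e i j u v w = alt (\<lambda>u v w. w / u) u v w * (cnj \<kappa> * (1 / u + 1 / v + 1 / w)) ^ i
     * (\<kappa> * (u + v + w)) ^ j * weight e u v w"

lemma cont3_Q_term: "cont3 (Q_term e p q)"
  unfolding cont3_def split_def Q_term_def by (auto intro!: continuous_intros)

lemma cont3_conj_test:
  assumes "norm e < 1"
  shows "cont3 (conj_test \<kappa> e i j)"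
  unfolding cont3_def split_def conj_test_def alt_def weight_def
  by (intro continuous_intros)
    (auto simp: one_minus_cube_nz[OF assms] one_minus_cube_nz'[OF assms] simp del: right_minus_eq)

lemma alt_swap: "alt \<Phi> v u w = - alt \<Phi> u v w" "alt \<Phi> w v u = - alt \<Phi> u v w"
  by (simp_all add: alt_def)

lemma weight_swap: "weight e v u w = weight e u v w" "weight e w v u = weight e u v w"
  by (simp_all add: weight_def mult_ac)

lemma conj_test_anti:
  "conj_test \<kappa> e i j v u w = - conj_test \<kappa> e i j u v w"
  "conj_test \<kappa> e i j w v u = - conj_test \<kappa> e i j u v w"
  unfolding conj_test_def alt_swap(1)[of _ v u w] alt_swap(2)[of _ w v u] weight_swap(1)[of e v u w] weight_swap(2)[of e w v u]
  by (simp_all add: add_ac)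

text \<open>After w = 1 / (x y) the two factors of \<open>Q_term\<close> containing \<open>e\<close>
  cancel the part of the weight with poles in the disc, and the remaining denominators have no zero
  on the closed disc. The powers in \<open>Q_term\<close> give x^(p+q+2), while the test function
  contributes a pole of order at most i + j + 2 at 0. A positive power of \<open>x\<close> is left,
  so the mean is the value 0 at the centre.\<close>

lemma circle_mean_Q_term:
  assumes e: "norm e < 1" and y: "norm y = 1" and ij: "i + j < p + q"
  shows "circle_mean (\<lambda>x. Q_term e p q x y (1 / (x * y)) * conj_test \<kappa> e i j x y (1 / (x * y))) = 0"
proof -
  obtain n where n: "p + q = i + j + Suc n" using ij less_iff_Suc_add by auto
  have y0: "y \<noteq> 0" using y by auto
  \<comment> \<open>\<open>A\<close> is \<open>x\<close> times the conjugate of the point,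
    \<open>B\<close> is \<open>x\<close> times the point, and \<open>D\<close> is x^2 times the
    conjugate Vandermonde product; all three are polynomials in \<open>x\<close>.\<close>
  define A where "A = (\<lambda>x. cnj \<kappa> * (1 + x / y + x\<^sup>2 * y))"
  define B where "B = (\<lambda>x. \<kappa> * (x\<^sup>2 + x * y + 1 / y))"
  define D where "D = (\<lambda>x. 1 / y - x / y\<^sup>2 - x ^ 4 * y - x * y + x ^ 3 / y + x ^ 3 * y\<^sup>2)"
  define G where "G = (1 - e * y ^ 3) * (1 - cnj e / y ^ 3)"
  define H where "H = (\<lambda>x. x ^ Suc n * y ^ Suc q * A x ^ i * B x ^ j * D x
      / ((1 - e * x ^ 3) * (1 - cnj e * (x * y) ^ 3) * G))"
  have "circle_mean (\<lambda>x. Q_term e p q x y (1 / (x * y)) * conj_test \<kappa> e i j x y (1 / (x * y))) = circle_mean H"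
  proof (rule circle_mean_cong)
    fix x :: complex assume x: "norm x = 1"
    then have x0: "x \<noteq> 0" by auto
    let ?w = "1 / (x * y)"
    have w: "norm ?w = 1" using x y by (simp add: norm_divide norm_mult)
    have nz: "1 - e * x ^ 3 \<noteq> 0" "1 - cnj e / x ^ 3 \<noteq> 0" "1 - e * ?w ^ 3 \<noteq> 0" "1 - cnj e * (x * y) ^ 3 \<noteq> 0"
      using one_minus_cube_nz[OF e, of x] one_minus_cube_nz'[OF e x] one_minus_cube_nz[OF e, of ?w]
        one_minus_cube_nz[of "cnj e" "x * y"] e x y w by (auto simp: norm_mult)
    have a: "(cnj \<kappa> * (1 / x + 1 / y + 1 / ?w)) ^ i * x ^ i = A x ^ i"
      unfolding A_def power_mult_distrib[symmetric] using x0
      by (intro arg_cong[where f = "\<lambda>t. t ^ i"]) (simp add: field_simps power2_eq_square)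
    have b: "(\<kappa> * (x + y + ?w)) ^ j * x ^ j = B x ^ j"
      unfolding B_def power_mult_distrib[symmetric] using x0 y0
      by (intro arg_cong[where f = "\<lambda>t. t ^ j"]) (simp add: field_simps power2_eq_square)
    have d: "alt (\<lambda>u v w. w / u) x y ?w * x\<^sup>2 = D x"
    proof -
      have f: "?w / x * x\<^sup>2 = 1 / y" "?w / y * x\<^sup>2 = x / y\<^sup>2" "x / ?w * x\<^sup>2 = x ^ 4 * y"
        "y / x * x\<^sup>2 = x * y" "x / y * x\<^sup>2 = x ^ 3 / y" "y / ?w * x\<^sup>2 = x ^ 3 * y\<^sup>2"
        using x0 y0 by (simp_all add: divide_simps) (simp_all add: eval_nat_numeral)
      then show ?thesis unfolding D_def alt_def by (simp only: left_diff_distrib distrib_right f)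
    qed
    have g: "weight e x y ?w = 1 / ((1 - e * x ^ 3) * (1 - cnj e / x ^ 3) * G * ((1 - e * ?w ^ 3) * (1 - cnj e * (x * y) ^ 3)))"
      unfolding weight_def G_def by (simp add: power_divide)
    have "x ^ Suc p * (1 / ?w) ^ Suc q = x ^ (p + q) * x\<^sup>2 * y ^ Suc q"
      using x0 y0 by (simp add: power_mult_distrib power_add power2_eq_square)
    also have "\<dots> = x ^ Suc n * y ^ Suc q * (x ^ i * x ^ j * x\<^sup>2)"
      unfolding n by (simp add: power_add)
    finally have t: "x ^ Suc p * (1 / ?w) ^ Suc q = x ^ Suc n * y ^ Suc q * (x ^ i * x ^ j * x\<^sup>2)" .
    \<comment> \<open>\<open>P\<close> and \<open>S\<close> stand for the two factors that occur
      both in \<open>Q_term\<close> and in the denominator of the weight.\<close>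
    have cancel: "(T * (X1 * X2 * X3) * P * S) * (E * C * F * (1 / (N1 * P * G' * (S * N2))))
        = T * (C * X1) * (F * X2) * (E * X3) / (N1 * N2 * G')"
      if "P \<noteq> 0" "S \<noteq> 0" for T X1 X2 X3 P S E C F N1 G' N2 :: complex
    proof -
      have "1 / (N1 * P * G' * (S * N2)) = 1 / (N1 * N2 * G') * inverse P * inverse S"
        by (simp add: divide_inverse mult_ac)
      then have "(T * (X1 * X2 * X3) * P * S) * (E * C * F * (1 / (N1 * P * G' * (S * N2))))
          = T * (C * X1) * (F * X2) * (E * X3) * (1 / (N1 * N2 * G')) * (P * inverse P) * (S * inverse S)"
        by (simp only: mult_ac)
      then show ?thesis using that by simp
    qed
    show "Q_term e p q x y ?w * conj_test \<kappa> e i j x y ?w = H x"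
      unfolding Q_term_def conj_test_def g t H_def a[symmetric] b[symmetric] d[symmetric]
      by (rule cancel) (use nz in auto)
  qed
  also have "\<dots> = H 0"
  proof (rule circle_mean_holomorphic)
    have "1 - e * x ^ 3 \<noteq> 0" "1 - cnj e * (x * y) ^ 3 \<noteq> 0" if "x \<in> cball 0 1" for x
      using that one_minus_cube_nz[OF e, of x] one_minus_cube_nz[of "cnj e" "x * y"] e y
      by (auto simp: norm_mult)
    moreover have "G \<noteq> 0"
      unfolding G_def using one_minus_cube_nz[OF e, of y] one_minus_cube_nz'[OF e y] y by auto
    ultimately show "H holomorphic_on cball 0 1"
      unfolding H_def A_def B_def D_def by (intro holomorphic_intros) (auto simp: y0)
  qed
  also have "\<dots> = 0" by (simp add: H_def)
  finally show ?thesis .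
qed

lemma sym_mean_Q_term:
  assumes "norm e < 1" "i + j < p + q"
  shows "sym_mean (\<lambda>u v w. alt (Q_term e p q) u v w * conj_test \<kappa> e i j u v w) = 0"
proof -
  have "sym_mean (\<lambda>u v w. Q_term e p q u v w * conj_test \<kappa> e i j u v w) = circle_mean (\<lambda>y. 0)"
    unfolding sym_mean_def torus_mean_def
    by (rule circle_mean_cong) (rule circle_mean_Q_term[OF assms(1) _ assms(2)])
  then show ?thesis
    unfolding sym_mean_alt[OF cont3_Q_term cont3_conj_test[OF assms(1)] conj_test_anti]
    by (simp add: circle_mean_def)
qed

subsection \<open>The weighted functional on polynomials\<close>

lemma zpolys_continuous: "f \<in> zpolys_less m \<Longrightarrow> continuous_on A f"
  by (induction rule: zpolys_induct) (auto intro!: continuous_intros)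

lemma cnj_unit: "norm x = 1 \<Longrightarrow> cnj x = 1 / x"
  using complex_norm_square[of x] by (cases "x = 0") (auto simp: eq_divide_eq mult.commute)

locale deltoid =
  fixes a c \<kappa> e :: complex
  assumes c0: "c \<noteq> 0" and kappa: "\<kappa> ^ 3 = c\<^sup>2 * cnj c" "\<kappa> * cnj \<kappa> = c * cnj c"
    and a_eq: "a = c * (1 - e)" and e: "norm e < 1"
begin

definition point :: "complex \<Rightarrow> complex \<Rightarrow> complex" where
  "point x y = \<kappa> * (x + y + 1 / (x * y))"

definition density_fun :: "complex \<Rightarrow> complex \<Rightarrow> real" where
  "density_fun x y = (norm (vdm x y (1 / (x * y))))\<^sup>2
     / (norm ((1 - e * x ^ 3) * (1 - e * y ^ 3) * (1 - e * (1 / (x * y)) ^ 3)))\<^sup>2"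

lemma kappa_nz: "\<kappa> \<noteq> 0"
  using kappa(1) c0 by auto

lemma cnj_point:
  assumes "norm x = 1" "norm y = 1"
  shows "cnj (point x y) = cnj \<kappa> * (1 / x + 1 / y + x * y)"
  using assms by (simp add: point_def cnj_unit)

lemma continuous_on_point: "continuous_on (circle \<times> circle) (\<lambda>(x, y). point x y)"
  unfolding point_def split_def by (auto intro!: continuous_intros)

lemma continuous_on_density: "continuous_on (circle \<times> circle) (\<lambda>(x, y). density_fun x y)"
  unfolding density_fun_def split_def
proof (rule continuous_on_divide)
  show "continuous_on (circle \<times> circle) (\<lambda>z. (norm (vdm (fst z) (snd z) (1 / (fst z * snd z))))\<^sup>2)"
    unfolding alt_def by (auto intro!: continuous_intros)
  show "continuous_on (circle \<times> circle) (\<lambda>z. (norm ((1 - e * fst z ^ 3) * (1 - e * snd z ^ 3)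
      * (1 - e * (1 / (fst z * snd z)) ^ 3)))\<^sup>2)"
    by (auto intro!: continuous_intros)
  show "\<forall>z\<in>circle \<times> circle. (norm ((1 - e * fst z ^ 3) * (1 - e * snd z ^ 3)
      * (1 - e * (1 / (fst z * snd z)) ^ 3)))\<^sup>2 \<noteq> 0"
  proof
    fix z assume z: "z \<in> circle \<times> circle"
    have "1 - e * fst z ^ 3 \<noteq> 0" "1 - e * snd z ^ 3 \<noteq> 0" "1 - e * (1 / (fst z * snd z)) ^ 3 \<noteq> 0"
      by (rule one_minus_cube_nz[OF e]; use z in \<open>auto simp: norm_divide norm_mult\<close>)+
    then show "(norm ((1 - e * fst z ^ 3) * (1 - e * snd z ^ 3)
      * (1 - e * (1 / (fst z * snd z)) ^ 3)))\<^sup>2 \<noteq> 0" by simp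
  qed
qed

lemma cnj_vdm:
  assumes "norm u = 1" "norm v = 1" "norm w = 1"
  shows "cnj (vdm u v w) = alt (\<lambda>u v w. w / u) u v w"
  unfolding alt_def using assms by (simp add: cnj_unit)

lemma complex_density:
  assumes x: "norm x = 1" and y: "norm y = 1"
  shows "complex_of_real (density_fun x y) =
    vdm x y (1 / (x * y)) * alt (\<lambda>u v w. w / u) x y (1 / (x * y)) * weight e x y (1 / (x * y))"
proof -
  let ?w = "1 / (x * y)"
  have w: "norm ?w = 1" using x y by (simp add: norm_divide norm_mult)
  have cube: "cnj (1 - e * u ^ 3) = 1 - cnj e / u ^ 3" if "norm u = 1" for u
    using that by (simp add: cnj_unit power_divide)
  have sq: "complex_of_real ((norm z)\<^sup>2) = z * cnj z" for z
    using complex_norm_square[of z] by simp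
  show ?thesis
    unfolding density_fun_def of_real_divide sq complex_cnj_mult cube[OF x] cube[OF y] cube[OF w]
      cnj_vdm[OF x y w] weight_def
    by (simp add: mult_ac)
qed

lemma Q_poly_point:
  assumes x: "norm x = 1" and y: "norm y = 1" and pq: "p + q \<ge> 1"
  shows "(if p + q = 1 then 1 - e * cnj e else 1) * (vdm x y (1 / (x * y)) * Q_poly a c (p + q) q (point x y))
     = \<kappa> ^ p * cnj \<kappa> ^ q * alt (Q_term e p q) x y (1 / (x * y))"
proof -
  let ?w = "1 / (x * y)"
  interpret P: deltoid_point a c \<kappa> e x y ?w
    using c0 kappa a_eq x y by unfold_locales auto
  have z: "point x y = \<kappa> * (x + y + ?w)" by (simp add: point_def)
  have zb: "cnj (point x y) = cnj \<kappa> * (y * ?w + x * ?w + x * y)"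
    unfolding cnj_point[OF x y] using x y by auto
  have Q: "Q_poly a c (p + q) q (point x y)
      = band_det a c (point x y) (cnj (point x y)) (cnj c) (top_row (point x y) (cnj (point x y)) (cnj a)) p q"
    by (simp add: Q_poly_eq_band_det)
  show ?thesis
  proof (cases "p + q = 1")
    case True
    then consider "p = 1" "q = 0" | "p = 0" "q = 1" by linarith
    then show ?thesis
    proof cases
      case 1
      then have "Q_poly a c (p + q) q (point x y) = point x y"
        unfolding Q by (simp add: band_det_1_0 top_row_def)
      then show ?thesis using 1 P.alt_Q_term_1_0 unfolding z by simp
    next
      case 2
      then have "Q_poly a c (p + q) q (point x y) = cnj (point x y)"
        unfolding Q by (simp add: band_det_0_1 top_row_def)
      then show ?thesis using 2 P.alt_Q_term_0_1 unfolding zb by simp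
    qed
  next
    case False
    have "Q_poly a c (p + q) q (point x y)
        = band_det a c P.zz P.zb (cnj c) (top_row P.zz P.zb (cnj a)) p q"
      unfolding Q zb unfolding z ..
    then show ?thesis using P.band_det_formula[of p q] pq False by simp
  qed
qed

lemma torus_continuous_zpoly:
  assumes "f \<in> zpolys_less m"
  shows "continuous_on (circle \<times> circle) (\<lambda>(x, y). f (point x y))"
  using continuous_on_compose2[OF zpolys_continuous[OF assms, of UNIV] continuous_on_point]
  by (simp add: split_def)

lemma torus_continuous_density:
  assumes "continuous_on (circle \<times> circle) (\<lambda>(x, y). f x y)"
  shows "continuous_on (circle \<times> circle) (\<lambda>(x, y). of_real (density_fun x y) * (f x y :: complex))"
  using continuous_on_mult[OF continuous_on_of_real[OF continuous_on_density] assms]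
  by (simp add: split_def)

lemma torus_Q_orthogonal:
  assumes R: "R \<in> zpolys_less m" and k: "k \<le> m"
  shows "torus_mean (\<lambda>x y. of_real (density_fun x y) * (Q_poly a c m k (point x y) * cnj (R (point x y)))) = 0"
proof -
  let ?I = "\<lambda>R x y. of_real (density_fun x y) * (Q_poly a c m k (point x y) * cnj (R (point x y)))"
  have cont: "continuous_on (circle \<times> circle) (\<lambda>(x, y). ?I R x y)"
    if "continuous_on (circle \<times> circle) (\<lambda>(x, y). R (point x y))" for R :: "complex \<Rightarrow> complex"
    using continuous_on_mult[OF torus_continuous_zpoly[OF Q_poly_in_zpolys[OF k]] continuous_on_cnj[OF that]]
    by (intro torus_continuous_density) (simp add: split_def)
  \<comment> \<open>Continuity is carried through the induction because additivity of the mean asks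
    for it.\<close>
  have "continuous_on (circle \<times> circle) (\<lambda>(x, y). R (point x y)) \<and> torus_mean (?I R) = 0"
    using R
  proof (induction rule: zpolys_induct)
    case zero
    then show ?case by (simp add: torus_mean_def circle_mean_def split_def)
  next
    case (add f g)
    have "torus_mean (?I (\<lambda>z. f z + g z)) = torus_mean (\<lambda>x y. ?I f x y + ?I g x y)"
      by (simp add: algebra_simps)
    also have "\<dots> = 0" using add cont by (simp add: torus_mean_add)
    finally show ?case using add continuous_on_add by (fastforce simp: split_def)
  next
    case (scale f l)
    have "torus_mean (?I (\<lambda>z. l * f z)) = torus_mean (\<lambda>x y. cnj l * ?I f x y)"
      by (simp add: mult_ac)
    also have "\<dots> = 0" unfolding torus_mean_scale using scale by simp
    finally show ?case using scale by (auto simp: split_def intro!: continuous_intros)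
  next
    case (monomial i j)
    then have m: "m \<ge> 1" by simp
    \<comment> \<open>The exceptional constant of degree one; it is nonzero because |e| < 1.\<close>
    define \<nu> where "\<nu> = (if m = 1 then 1 - e * cnj e else 1)"
    have "e * cnj e \<noteq> 1"
    proof
      assume "e * cnj e = 1"
      then have "norm e * norm e = 1" by (metis complex_mod_cnj norm_mult norm_one)
      moreover have "norm e * norm e \<le> norm e * 1" using e by (intro mult_left_mono) auto
      ultimately show False using e by simp
    qed
    then have \<nu>0: "\<nu> \<noteq> 0" by (auto simp: \<nu>_def)
    have "torus_mean (?I (\<lambda>z. z ^ i * cnj z ^ j))
        = torus_mean (\<lambda>x y. (\<kappa> ^ (m - k) * cnj \<kappa> ^ k / \<nu>)
            * (alt (Q_term e (m - k) k) x y (1 / (x * y)) * conj_test \<kappa> e i j x y (1 / (x * y))))"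
    proof (rule torus_mean_cong)
      fix x y :: complex assume x: "norm x = 1" and y: "norm y = 1"
      have Q: "vdm x y (1 / (x * y)) * Q_poly a c m k (point x y)
          = \<kappa> ^ (m - k) * cnj \<kappa> ^ k / \<nu> * alt (Q_term e (m - k) k) x y (1 / (x * y))"
        using Q_poly_point[OF x y, of "m - k" k] k m \<nu>0 by (simp add: \<nu>_def field_simps)
      have "?I (\<lambda>z. z ^ i * cnj z ^ j) x y = (vdm x y (1 / (x * y)) * Q_poly a c m k (point x y))
          * (alt (\<lambda>u v w. w / u) x y (1 / (x * y)) * cnj (point x y) ^ i * point x y ^ j * weight e x y (1 / (x * y)))"
        unfolding complex_density[OF x y] by (simp add: mult_ac)
      \<comment> \<open>Conjugation swaps the two exponents of the monomial, which is why
        \<open>conj_test\<close> puts \<open>i\<close> on the conjugate of the point.\<close>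
      also have "alt (\<lambda>u v w. w / u) x y (1 / (x * y)) * cnj (point x y) ^ i * point x y ^ j * weight e x y (1 / (x * y))
          = conj_test \<kappa> e i j x y (1 / (x * y))"
        unfolding conj_test_def cnj_point[OF x y] unfolding point_def by simp
      finally show "?I (\<lambda>z. z ^ i * cnj z ^ j) x y = (\<kappa> ^ (m - k) * cnj \<kappa> ^ k / \<nu>)
            * (alt (Q_term e (m - k) k) x y (1 / (x * y)) * conj_test \<kappa> e i j x y (1 / (x * y)))"
        unfolding Q by (simp only: mult.assoc)
    qed
    also have "\<dots> = \<kappa> ^ (m - k) * cnj \<kappa> ^ k / \<nu>
        * sym_mean (\<lambda>u v w. alt (Q_term e (m - k) k) u v w * conj_test \<kappa> e i j u v w)"
      unfolding torus_mean_scale sym_mean_def ..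
    also have "\<dots> = 0"
      using sym_mean_Q_term[OF e, of i j "m - k" k] monomial k by simp
    finally show ?case
      using torus_continuous_zpoly[OF monomial_in_zpolys[OF monomial]] by simp
  qed
  then show ?thesis by blast
qed

text \<open>With \<open>\<sigma> = 1 / x\<close>, the leading coefficients of a polynomial appear at \<open>\<sigma> = 0\<close>, where they can be
  read off as a circle mean of its values on the torus.\<close>

lemma zpoly_holomorphic_extension:
  assumes f: "f \<in> zpolys_less m" and y: "norm y = 1"
  shows "\<exists>H. H holomorphic_on UNIV \<and> H 0 = 0 \<and> (\<forall>\<sigma>. norm \<sigma> = 1 \<longrightarrow> H \<sigma> = \<sigma> ^ m * f (point (1 / \<sigma>) y))"
  using f
proof (induction rule: zpolys_induct)
  case zero
  then show ?case by (intro exI[of _ "\<lambda>_. 0"]) auto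
next
  case (add f g)
  then obtain F G where "F holomorphic_on UNIV" "F 0 = 0" "\<forall>\<sigma>. norm \<sigma> = 1 \<longrightarrow> F \<sigma> = \<sigma> ^ m * f (point (1 / \<sigma>) y)"
    "G holomorphic_on UNIV" "G 0 = 0" "\<forall>\<sigma>. norm \<sigma> = 1 \<longrightarrow> G \<sigma> = \<sigma> ^ m * g (point (1 / \<sigma>) y)" by blast
  then show ?case
    by (intro exI[of _ "\<lambda>\<sigma>. F \<sigma> + G \<sigma>"]) (auto simp: algebra_simps intro!: holomorphic_intros)
next
  case (scale f k)
  then obtain F where "F holomorphic_on UNIV" "F 0 = 0" "\<forall>\<sigma>. norm \<sigma> = 1 \<longrightarrow> F \<sigma> = \<sigma> ^ m * f (point (1 / \<sigma>) y)" by blast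
  then show ?case
    by (intro exI[of _ "\<lambda>\<sigma>. k * F \<sigma>"]) (auto simp: algebra_simps intro!: holomorphic_intros)
next
  case (monomial i j)
  have y0: "y \<noteq> 0" using y by auto
  \<comment> \<open>\<sigma> times the point and \<sigma> times its conjugate, both polynomial in
    \<sigma>. Since i + j < m, a positive power of \<sigma> remains and the extension vanishes at
    0.\<close>
  let ?A = "\<lambda>\<sigma>. \<kappa> * (1 + \<sigma> * y + \<sigma>\<^sup>2 / y)" and ?B = "\<lambda>\<sigma>. cnj \<kappa> * (\<sigma>\<^sup>2 + \<sigma> / y + y)"
  have "\<sigma> ^ (m - i - j) * (?A \<sigma> ^ i * ?B \<sigma> ^ j)
      = \<sigma> ^ m * (point (1 / \<sigma>) y ^ i * cnj (point (1 / \<sigma>) y) ^ j)" if \<sigma>: "norm \<sigma> = 1" for \<sigma>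
  proof -
    have s0: "\<sigma> \<noteq> 0" using \<sigma> by auto
    have "?A \<sigma> = \<sigma> * point (1 / \<sigma>) y"
      using s0 y0 by (simp add: point_def field_simps power2_eq_square)
    moreover have "?B \<sigma> = \<sigma> * cnj (point (1 / \<sigma>) y)"
      using cnj_point[of "1 / \<sigma>" y] y \<sigma> s0 y0 by (simp add: norm_divide field_simps power2_eq_square)
    ultimately have "\<sigma> ^ (m - i - j) * (?A \<sigma> ^ i * ?B \<sigma> ^ j)
        = (\<sigma> ^ (m - i - j) * \<sigma> ^ i * \<sigma> ^ j) * (point (1 / \<sigma>) y ^ i * cnj (point (1 / \<sigma>) y) ^ j)"
      by (simp add: power_mult_distrib mult_ac)
    also have "\<sigma> ^ (m - i - j) * \<sigma> ^ i * \<sigma> ^ j = \<sigma> ^ m"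
      using monomial by (simp add: power_add[symmetric])
    finally show ?thesis .
  qed
  then show ?case
    using monomial by (intro exI[of _ "\<lambda>\<sigma>. \<sigma> ^ (m - i - j) * (?A \<sigma> ^ i * ?B \<sigma> ^ j)"])
      (auto intro!: holomorphic_intros simp: y0)
qed

end

lemma infinite_circle: "infinite (sphere 0 1 :: complex set)"
proof
  assume "finite (sphere 0 1 :: complex set)"
  moreover have "inj_on (\<lambda>n::nat. circ (1 / (real n + 2))) UNIV"
  proof (rule inj_onI)
    fix n k :: nat assume eq: "circ (1 / (real n + 2)) = circ (1 / (real k + 2))"
    have b: "\<bar>1 / (real n + 2) - 1 / (real k + 2)\<bar> < 1"
    proof -
      have "0 < 1 / (real n + 2)" "1 / (real n + 2) < 1" "0 < 1 / (real k + 2)" "1 / (real k + 2) < 1"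
        by (auto simp: field_simps)
      then show ?thesis by linarith
    qed
    from eq obtain i :: int where "2 * of_real pi * \<i> * of_real (1 / (real n + 2))
        = 2 * of_real pi * \<i> * of_real (1 / (real k + 2)) + of_int (2 * i) * of_real pi * \<i>"
      unfolding circ_def exp_eq by (auto simp: algebra_simps)
    then have "of_real pi * \<i> * of_real (2 * (1 / (real n + 2) - 1 / (real k + 2) - i)) = (0::complex)"
      by (simp add: algebra_simps)
    then have i: "1 / (real n + 2) - 1 / (real k + 2) = i" by (auto simp del: of_real_mult of_real_diff)
    then have "i = 0" using b by (metis of_int_abs of_int_less_1_iff abs_less_iff zabs_less_one_iff)
    then have "1 / (1 / (real n + 2)) = 1 / (1 / (real k + 2))" using i by simp
    then show "n = k" by simp
  qed
  moreover have "range (\<lambda>n::nat. circ (1 / (real n + 2))) \<subseteq> sphere 0 1" by auto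
  ultimately show False using finite_subset finite_imageD infinite_UNIV_nat by metis
qed

context deltoid
begin

text \<open>At \<sigma> = 0 the rescaled point and its conjugate become \<kappa> and
  \<open>cnj \<kappa> * y\<close>, and the rescaled Vandermonde product becomes \<open>y\<close>.
  The top part thus turns into a polynomial in \<open>y\<close> that vanishes on the whole circle,
  hence identically. The Vandermonde factor is kept in the hypothesis because later the vanishing is
  known only where the density is nonzero.\<close>

lemma leading_coeffs_zero:
  assumes f: "f \<in> zpolys_less m"
    and vanish: "\<And>x y. norm x = 1 \<Longrightarrow> norm y = 1 \<Longrightarrow>
      ((\<Sum>k\<le>m. b k * (point x y ^ (m - k) * cnj (point x y) ^ k)) + f (point x y)) * vdm x y (1 / (x * y)) = 0"
    and k: "k \<le> m"
  shows "b k = 0"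
proof -
  have zero: "(\<Sum>k\<le>m. b k * \<kappa> ^ (m - k) * cnj \<kappa> ^ k * y ^ k) = 0" if y: "norm y = 1" for y
  proof -
    have y0: "y \<noteq> 0" using y by auto
    obtain H where H: "H holomorphic_on UNIV" "H 0 = 0"
      "\<And>\<sigma>. norm \<sigma> = 1 \<Longrightarrow> H \<sigma> = \<sigma> ^ m * f (point (1 / \<sigma>) y)"
      using zpoly_holomorphic_extension[OF f y] by blast
    define A where "A = (\<lambda>\<sigma>. \<kappa> * (1 + \<sigma> * y + \<sigma>\<^sup>2 / y))"
    define B where "B = (\<lambda>\<sigma>. cnj \<kappa> * (\<sigma>\<^sup>2 + \<sigma> / y + y))"
    define D where "D = (\<lambda>\<sigma>. y - y\<^sup>2 * \<sigma> - \<sigma> ^ 4 / y - \<sigma> / y + y * \<sigma> ^ 3 + \<sigma> ^ 3 / y\<^sup>2)"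
    define P where "P = (\<lambda>\<sigma>. ((\<Sum>k\<le>m. b k * (A \<sigma> ^ (m - k) * B \<sigma> ^ k)) + H \<sigma>) * D \<sigma>)"
    have "P \<sigma> = 0" if \<sigma>: "norm \<sigma> = 1" for \<sigma>
    proof -
      have s0: "\<sigma> \<noteq> 0" using \<sigma> by auto
      let ?z = "point (1 / \<sigma>) y"
      have n: "norm (1 / \<sigma>) = 1" using \<sigma> by (simp add: norm_divide)
      have A: "A \<sigma> = \<sigma> * ?z"
        using s0 y0 by (simp add: A_def point_def field_simps power2_eq_square)
      have B: "B \<sigma> = \<sigma> * cnj ?z"
        using cnj_point[OF n y] s0 y0 by (simp add: B_def field_simps power2_eq_square)
      have "A \<sigma> ^ (m - k) * B \<sigma> ^ k = \<sigma> ^ m * (?z ^ (m - k) * cnj ?z ^ k)" if "k \<le> m" for k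
      proof -
        have "\<sigma> ^ m = \<sigma> ^ (m - k) * \<sigma> ^ k" using that by (simp add: power_add[symmetric])
        then show ?thesis unfolding A B power_mult_distrib by (simp only: mult_ac)
      qed
      then have "(\<Sum>k\<le>m. b k * (A \<sigma> ^ (m - k) * B \<sigma> ^ k)) = \<sigma> ^ m * (\<Sum>k\<le>m. b k * (?z ^ (m - k) * cnj ?z ^ k))"
        unfolding sum_distrib_left by (intro sum.cong) auto
      moreover have "D \<sigma> = \<sigma>\<^sup>2 * vdm (1 / \<sigma>) y (1 / (1 / \<sigma> * y))"
      proof -
        have t: "\<sigma>\<^sup>2 * ((1 / \<sigma>) / (\<sigma> / y)) = y" "\<sigma>\<^sup>2 * (y / (\<sigma> / y)) = y\<^sup>2 * \<sigma>"
          "\<sigma>\<^sup>2 * ((\<sigma> / y) / (1 / \<sigma>)) = \<sigma> ^ 4 / y" "\<sigma>\<^sup>2 * ((1 / \<sigma>) / y) = \<sigma> / y"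
          "\<sigma>\<^sup>2 * (y / (1 / \<sigma>)) = y * \<sigma> ^ 3" "\<sigma>\<^sup>2 * ((\<sigma> / y) / y) = \<sigma> ^ 3 / y\<^sup>2"
          using s0 y0 by (simp_all add: divide_simps) (simp_all add: eval_nat_numeral)
        have w: "1 / (1 / \<sigma> * y) = \<sigma> / y" by simp
        show ?thesis unfolding w D_def alt_def by (simp only: right_diff_distrib distrib_left t)
      qed
      ultimately have "P \<sigma> = \<sigma> ^ m * \<sigma>\<^sup>2 * (((\<Sum>k\<le>m. b k * (?z ^ (m - k) * cnj ?z ^ k)) + f ?z)
          * vdm (1 / \<sigma>) y (1 / (1 / \<sigma> * y)))"
        unfolding P_def H(3)[OF \<sigma>] by (simp add: algebra_simps)
      then show ?thesis using vanish[OF n y] by simp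
    qed
    then have "circle_mean P = circle_mean (\<lambda>_. 0)" by (intro circle_mean_cong)
    moreover have "H holomorphic_on cball 0 1"
      by (rule holomorphic_on_subset[OF H(1)]) simp
    then have "circle_mean P = P 0"
      unfolding P_def A_def B_def D_def
      by (intro circle_mean_holomorphic holomorphic_intros) (auto simp: y0)
    ultimately have "P 0 = 0" by (simp add: circle_mean_def)
    then show ?thesis using y0 by (simp add: P_def A_def B_def D_def H(2) power_mult_distrib mult.assoc)
  qed
  define q where "q = (\<Sum>k\<le>m. monom (b k * \<kappa> ^ (m - k) * cnj \<kappa> ^ k) k)"
  have "poly q y = 0" if "norm y = 1" for y
    using zero[OF that] by (simp add: q_def poly_sum poly_monom)
  then have "sphere 0 1 \<subseteq> {y. poly q y = 0}" by auto
  then have "q = 0" using infinite_circle poly_roots_finite finite_subset by metis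
  then have "coeff q k = 0" by simp
  moreover have "coeff q k = b k * \<kappa> ^ (m - k) * cnj \<kappa> ^ k"
    unfolding q_def coeff_sum using k by (simp add: coeff_monom if_distrib cong: if_cong)
  ultimately show ?thesis using kappa_nz by simp
qed

end

text \<open>The index set \<open>K\<close> serves two purposes: all of \<open>{..m}\<close> splits
  off the top degree, and initial segments allow independence to be proved one monomial at a
  time.\<close>

lemma span_leading_decomposition:
  assumes "f \<in> cfun.span (zpolys_less m \<union> (\<lambda>k z. z ^ (m - k) * cnj z ^ k) ` K)" "K \<subseteq> {..m}"
  shows "\<exists>b g. g \<in> zpolys_less m \<and> (\<forall>k. k \<notin> K \<longrightarrow> b k = 0)
    \<and> f = (\<lambda>z. (\<Sum>k\<le>m. b k * (z ^ (m - k) * cnj z ^ k)) + g z)"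
proof -
  define P where "P f \<longleftrightarrow> (\<exists>b g. g \<in> zpolys_less m \<and> (\<forall>k. k \<notin> K \<longrightarrow> b k = 0)
    \<and> f = (\<lambda>z. (\<Sum>k\<le>m. b k * (z ^ (m - k) * cnj z ^ k)) + g z))" for f :: "complex \<Rightarrow> complex"
  have P0: "P 0" unfolding P_def
    by (intro exI[of _ "\<lambda>_. 0"]) (auto simp: zpolys_zero zero_fun_def)
  have Padd: "P (f + g)" if fg: "P f" "P g" for f g
  proof -
    from fg obtain b f' b' g' where *: "f' \<in> zpolys_less m" "\<forall>k. k \<notin> K \<longrightarrow> b k = 0"
      "f = (\<lambda>z. (\<Sum>k\<le>m. b k * (z ^ (m - k) * cnj z ^ k)) + f' z)"
      "g' \<in> zpolys_less m" "\<forall>k. k \<notin> K \<longrightarrow> b' k = 0"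
      "g = (\<lambda>z. (\<Sum>k\<le>m. b' k * (z ^ (m - k) * cnj z ^ k)) + g' z)" unfolding P_def by blast
    have "f + g = (\<lambda>z. (\<Sum>k\<le>m. (b k + b' k) * (z ^ (m - k) * cnj z ^ k)) + (f' z + g' z))"
      unfolding *(3,6) by (simp add: fun_eq_iff distrib_right sum.distrib)
    then show ?thesis unfolding P_def using *(1,2,4,5) zpolys_add
      by (intro exI[of _ "\<lambda>k. b k + b' k"] exI[of _ "\<lambda>z. f' z + g' z"]) auto
  qed
  have Pscale: "P (fscale l f)" if f: "P f" for l f
  proof -
    from f obtain b f' where *: "f' \<in> zpolys_less m" "\<forall>k. k \<notin> K \<longrightarrow> b k = 0"
      "f = (\<lambda>z. (\<Sum>k\<le>m. b k * (z ^ (m - k) * cnj z ^ k)) + f' z)" unfolding P_def by blast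
    have "fscale l f = (\<lambda>z. (\<Sum>k\<le>m. l * b k * (z ^ (m - k) * cnj z ^ k)) + l * f' z)"
      unfolding *(3) fscale_def by (simp add: distrib_left sum_distrib_left mult.assoc)
    then show ?thesis unfolding P_def using *(1,2) zpolys_scale
      by (intro exI[of _ "\<lambda>k. l * b k"] exI[of _ "\<lambda>z. l * f' z"]) auto
  qed
  have "cfun.span (zpolys_less m \<union> (\<lambda>k z. z ^ (m - k) * cnj z ^ k) ` K) \<subseteq> Collect P"
  proof (rule cfun.span_minimal)
    show "cfun.subspace (Collect P)" using P0 Padd Pscale by (simp add: cfun.subspace_def)
    show "zpolys_less m \<union> (\<lambda>k z. z ^ (m - k) * cnj z ^ k) ` K \<subseteq> Collect P"
    proof
      fix h assume "h \<in> zpolys_less m \<union> (\<lambda>k z. z ^ (m - k) * cnj z ^ k) ` K"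
      then consider "h \<in> zpolys_less m" | j where "j \<in> K" "h = (\<lambda>z. z ^ (m - j) * cnj z ^ j)" by blast
      then have "P h"
      proof cases
        case 1
        then show ?thesis unfolding P_def
          by (intro exI[of _ "\<lambda>_. 0"] exI[of _ h]) auto
      next
        case 2
        show ?thesis unfolding P_def
        proof (intro exI conjI)
          show "(\<lambda>_. 0) \<in> zpolys_less m" by (rule zpolys_zero)
          show "\<forall>k. k \<notin> K \<longrightarrow> (if k = j then 1 else 0 :: complex) = 0" using 2 by auto
          have "(\<Sum>k\<le>m. (if k = j then 1 else 0) * (z ^ (m - k) * cnj z ^ k))
              = (\<Sum>k\<le>m. if k = j then z ^ (m - j) * cnj z ^ j else 0)" for z :: complex
            by (intro sum.cong) auto
          then show "h = (\<lambda>z. (\<Sum>k\<le>m. (if k = j then 1 else 0) * (z ^ (m - k) * cnj z ^ k)) + 0)"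
            using 2 assms(2) by auto
        qed
      qed
      then show "h \<in> Collect P" by simp
    qed
  qed
  then show ?thesis using assms(1) unfolding P_def by blast
qed

section \<open>Definiteness and linear independence of the monomials\<close>

lemma monomials_less_Suc:
  "monomials_less (Suc m) = monomials_less m \<union> (\<lambda>k z. z ^ (m - k) * cnj z ^ k) ` {..m}"
proof -
  have "{(i, j). i + j < Suc m} = {(i, j). i + j < m} \<union> (\<lambda>k. (m - k, k)) ` {..m}"
    by (auto simp: less_Suc_eq image_iff)
  then show ?thesis unfolding monomials_less_def by (simp add: image_Un image_image)
qed

lemma zpolys_Suc_eq:
  "zpolys_less (Suc m) = cfun.span (zpolys_less m \<union> (\<lambda>k z. z ^ (m - k) * cnj z ^ k) ` {..m})"
  unfolding zpolys_eq_span monomials_less_Suc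
  by (simp only: cfun.span_Un cfun.span_span)

context deltoid
begin

text \<open>Descent on the degree: the coefficients of the top part vanish, leaving a polynomial of
  smaller degree with the same property.\<close>

lemma zpoly_zero_if_vanishing:
  assumes "f \<in> zpolys_less m"
    and "\<And>x y. norm x = 1 \<Longrightarrow> norm y = 1 \<Longrightarrow> f (point x y) * vdm x y (1 / (x * y)) = 0"
  shows "f = 0"
  using assms
proof (induction m)
  case 0
  then show ?case by (auto simp: zpolys_less_def zero_fun_def)
next
  case (Suc m)
  obtain b g where g: "g \<in> zpolys_less m" and f: "f = (\<lambda>z. (\<Sum>k\<le>m. b k * (z ^ (m - k) * cnj z ^ k)) + g z)"
    using span_leading_decomposition[of f m "{..m}"] Suc.prems(1) unfolding zpolys_Suc_eq by blast
  have "b k = 0" if "k \<le> m" for k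
    by (rule leading_coeffs_zero[OF g _ that]) (use Suc.prems(2) f in simp)
  then have "f = g" using f by (simp add: fun_eq_iff)
  then show ?case using Suc g by blast
qed

text \<open>The top-degree monomials are adjoined one by one. A relation between monomials holds on
  the whole plane, in particular on the deltoid, so the criterion for leading coefficients excludes
  it.\<close>

lemma independent_monomials:
  "cfun.independent (monomials_less m) \<and> card (monomials_less m) = Suc m choose 2"
proof (induction m)
  case 0
  have "monomials_less 0 = {}" by (auto simp: monomials_less_def)
  then show ?case using cfun.independent_empty by simp
next
  case (Suc m)
  let ?t = "\<lambda>k z::complex. z ^ (m - k) * cnj z ^ k"
  have "cfun.independent (monomials_less m \<union> ?t ` {..<n})
      \<and> card (monomials_less m \<union> ?t ` {..<n}) = card (monomials_less m) + n" if "n \<le> Suc m" for n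
    using that
  proof (induction n)
    case 0
    then show ?case using Suc by simp
  next
    case (Suc n)
    let ?S = "monomials_less m \<union> ?t ` {..<n}"
    have IH: "cfun.independent ?S" "card ?S = card (monomials_less m) + n" using Suc by auto
    have notin: "?t n \<notin> cfun.span ?S"
    proof
      assume "?t n \<in> cfun.span ?S"
      moreover have "cfun.span ?S \<subseteq> cfun.span (zpolys_less m \<union> ?t ` {..<n})"
        unfolding zpolys_eq_span by (intro cfun.span_mono Un_mono cfun.span_superset subset_refl)
      ultimately have mem: "?t n \<in> cfun.span (zpolys_less m \<union> ?t ` {..<n})" by blast
      have "{..<n} \<subseteq> {..m}" using Suc.prems by auto
      from span_leading_decomposition[OF mem this] obtain b g where g: "g \<in> zpolys_less m" and b: "\<And>k. k \<notin> {..<n} \<Longrightarrow> b k = 0"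
        and eq: "?t n = (\<lambda>z. (\<Sum>k\<le>m. b k * ?t k z) + g z)"
        by blast
      \<comment> \<open>Moving the new monomial to the other side gives it the coefficient -1,
        because \<open>b\<close> vanishes outside \<open>{..<n}\<close>.\<close>
      define b' where "b' k = b k - (if k = n then 1 else 0)" for k
      have zero: "(\<Sum>k\<le>m. b' k * ?t k z) + g z = 0" for z
      proof -
        have "(\<Sum>k\<le>m. b' k * ?t k z) = (\<Sum>k\<le>m. b k * ?t k z) - (\<Sum>k\<le>m. (if k = n then ?t n z else 0))"
          unfolding sum_subtractf[symmetric] b'_def by (intro sum.cong) (auto simp: algebra_simps)
        also have "(\<Sum>k\<le>m. (if k = n then ?t n z else 0)) = ?t n z" using Suc.prems by simp
        finally show ?thesis using fun_cong[OF eq, of z] by simp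
      qed
      have "b' n = 0"
      proof (rule leading_coeffs_zero[OF g])
        show "((\<Sum>k\<le>m. b' k * ?t k (point x y)) + g (point x y)) * vdm x y (1 / (x * y)) = 0" for x y
          unfolding zero by simp
        show "n \<le> m" using Suc.prems by simp
      qed
      then show False using b[of n] by (simp add: b'_def)
    qed
    have ins: "monomials_less m \<union> ?t ` {..<Suc n} = insert (?t n) ?S" by (simp only: lessThan_Suc image_insert Un_insert_right)
    have "?t n \<notin> ?S" by (rule contra_subsetD[OF cfun.span_superset notin])
    moreover have "finite ?S" using finite_monomials_less by (intro finite_UnI) auto
    ultimately have "card (insert (?t n) ?S) = Suc (card ?S)" by (rule card_insert_disjoint[rotated])
    then show ?case unfolding ins
      using IH(2) cfun.independent_insertI[OF notin IH(1)] by (simp only: add_Suc_right simp_thms)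
  qed
  from this[of "Suc m"] have "cfun.independent (monomials_less (Suc m))
      \<and> card (monomials_less (Suc m)) = card (monomials_less m) + Suc m"
    unfolding monomials_less_Suc lessThan_Suc_atMost by blast
  then show ?case using Suc by (simp add: numeral_2_eq_2)
qed

end

subsection \<open>Push-forward measures\<close>

abbreviation unit_square :: "(real \<times> real) set" where
  "unit_square \<equiv> cbox (0, 0) (1, 1)"

definition push_measure ::
    "(real \<times> real \<Rightarrow> real) \<Rightarrow> (real \<times> real \<Rightarrow> real \<times> real) \<Rightarrow> (real \<times> real) measure" where
  "push_measure W Z = distr (density lborel (\<lambda>x. ennreal (indicator unit_square x * W x))) borel Z"

lemma closed_measure_support: "closed (measure_support M)"
  unfolding closed_def
proof (subst open_subopen, intro ballI)
  fix x assume "x \<in> - measure_support M"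
  then obtain U where "open U" "x \<in> U" "\<not> emeasure M U > 0" by (auto simp: measure_support_def)
  then show "\<exists>T. open T \<and> x \<in> T \<and> T \<subseteq> - measure_support M"
    by (intro exI[of _ U]) (auto simp: measure_support_def)
qed

context
  fixes W :: "real \<times> real \<Rightarrow> real" and Z :: "real \<times> real \<Rightarrow> real \<times> real"
  assumes W: "continuous_on UNIV W" "\<And>x. W x \<ge> 0" and Z: "continuous_on UNIV Z"
begin

lemma push_measurable [measurable]: "W \<in> borel_measurable borel" "Z \<in> borel_measurable borel"
  using W Z by (auto intro: borel_measurable_continuous_onI)

lemma sets_push_measure: "sets (push_measure W Z) = sets borel"
  by (simp add: push_measure_def)

lemma integral_push_measure:
  fixes F :: "real \<times> real \<Rightarrow> 'b :: euclidean_space"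
  assumes F: "continuous_on UNIV F"
  shows "(LINT p|push_measure W Z. F p) = integral unit_square (\<lambda>x. W x *\<^sub>R F (Z x))"
proof -
  have [measurable]: "F \<in> borel_measurable borel" using F by (rule borel_measurable_continuous_onI)
  have "continuous_on UNIV (\<lambda>x. F (Z x))"
    by (rule continuous_on_compose2[OF F Z]) auto
  then have "continuous_on unit_square (\<lambda>x. W x *\<^sub>R F (Z x))"
    using W(1) by (auto intro!: continuous_intros intro: continuous_on_subset)
  then have int: "set_integrable lborel unit_square (\<lambda>x. W x *\<^sub>R F (Z x))"
    unfolding set_integrable_def by (intro borel_integrable_compact) auto
  have "(LINT p|push_measure W Z. F p)
      = (LINT x|lborel. (indicator unit_square x * W x) *\<^sub>R F (Z x))"
    unfolding push_measure_def by (simp add: integral_distr integral_density W(2))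
  also have "\<dots> = (LINT x:unit_square|lborel. W x *\<^sub>R F (Z x))"
    unfolding set_lebesgue_integral_def by simp
  also have "\<dots> = integral unit_square (\<lambda>x. W x *\<^sub>R F (Z x))"
    by (rule set_borel_integral_eq_integral(2)[OF int])
  finally show ?thesis .
qed

lemma prob_space_push_measure:
  assumes "integral unit_square W = 1"
  shows "prob_space (push_measure W Z)"
proof
  have "continuous_on unit_square W" using W(1) by (rule continuous_on_subset) simp
  then have int: "set_integrable lborel unit_square W"
    unfolding set_integrable_def by (intro borel_integrable_compact) auto
  have "emeasure (push_measure W Z) (space (push_measure W Z))
      = (\<integral>\<^sup>+ x. ennreal (indicator unit_square x * W x) \<partial>lborel)"
    by (simp add: push_measure_def emeasure_distr emeasure_density)
  also have "\<dots> = ennreal (LINT x|lborel. indicator unit_square x * W x)"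
    using int W(2) by (intro nn_integral_eq_integral) (auto simp: set_integrable_def)
  also have "(LINT x|lborel. indicator unit_square x * W x) = integral unit_square W"
    using set_borel_integral_eq_integral(2)[OF int] by (simp add: set_lebesgue_integral_def)
  finally show "emeasure (push_measure W Z) (space (push_measure W Z)) = 1" using assms by simp
qed

text \<open>The image of the square is bounded, and the complement of a closed ball containing it is
  an open null set.\<close>

lemma compact_support_push_measure: "compact (measure_support (push_measure W Z))"
proof -
  have "bounded (Z ` unit_square)"
    using Z by (intro compact_imp_bounded compact_continuous_image) (auto intro: continuous_on_subset)
  then obtain r where r: "\<And>x. x \<in> unit_square \<Longrightarrow> norm (Z x) \<le> r" by (auto simp: bounded_iff)
  have "measure_support (push_measure W Z) \<subseteq> cball 0 r"
  proof
    fix x assume x: "x \<in> measure_support (push_measure W Z)"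
    show "x \<in> cball 0 r"
    proof (rule ccontr)
      assume "x \<notin> cball 0 r"
      then have "emeasure (push_measure W Z) (- cball 0 r) > 0"
        using x open_Compl[OF closed_cball[of 0 r]] unfolding measure_support_def by blast
      moreover have "emeasure (push_measure W Z) (- cball 0 r)
          = (\<integral>\<^sup>+ y. ennreal (indicator unit_square y * W y) * indicator (Z -` (- cball 0 r)) y \<partial>lborel)"
      proof -
        have "Z -` (- cball 0 r) \<in> sets borel"
          using measurable_sets[OF push_measurable(2), of "- cball 0 r"] by simp
        then show ?thesis
          unfolding push_measure_def by (subst emeasure_distr) (auto simp: emeasure_density)
      qed
      also have "\<dots> = (\<integral>\<^sup>+ y. 0 \<partial>(lborel :: (real \<times> real) measure))"
      proof (rule nn_integral_cong)
        fix y
        have "y \<notin> unit_square \<or> y \<notin> Z -` (- cball 0 r)" using r[of y] by (simp only: vimage_eq) simp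
        then show "ennreal (indicator unit_square y * W y) * indicator (Z -` (- cball 0 r)) y = 0"
          by (simp only: indicator_def) auto
      qed
      finally show False by simp
    qed
  qed
  then have "bounded (measure_support (push_measure W Z))" using bounded_cball bounded_subset by blast
  then show ?thesis using closed_measure_support compact_eq_bounded_closed by blast
qed

end

subsection \<open>Compressed multiplication operators\<close>

lemma zpolys_power:
  assumes "u \<in> zpolys_less 2"
  shows "(\<lambda>z. u z ^ i) \<in> zpolys_less (Suc i)"
proof (induction i)
  case 0
  show ?case using zpolys_const[of 1 1] by simp
next
  case (Suc i)
  show ?case using zpolys_mult[of u 1 "\<lambda>z. u z ^ i" "Suc i" "Suc (Suc i)"] assms Suc
    by (simp add: numeral_2_eq_2)
qed

lemma real_polys2_zpolys:
  assumes "f \<in> real_polys2 n"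
  shows "(\<lambda>z. complex_of_real (f (Re z, Im z))) \<in> zpolys_less (Suc n)"
proof -
  obtain b where f: "f = (\<lambda>(x, y). \<Sum>i\<le>n. \<Sum>j\<le>n - i. b i j * x ^ i * y ^ j)"
    using assms by (auto simp: real_polys2_def)
  have z: "(\<lambda>z. z) \<in> zpolys_less 2" "(\<lambda>z. cnj z) \<in> zpolys_less 2"
    using monomial_in_zpolys[of 1 0 2] monomial_in_zpolys[of 0 1 2] by auto
  have "(\<lambda>z. (1 / 2) * (z + cnj z)) \<in> zpolys_less 2"
    by (intro zpolys_scale zpolys_add z)
  moreover have "(1 / 2) * (z + cnj z) = of_real (Re z)" for z :: complex
    by (simp add: complex_add_cnj)
  ultimately have re: "(\<lambda>z. complex_of_real (Re z)) \<in> zpolys_less 2" by simp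
  have "(\<lambda>z. (1 / (2 * \<i>)) * (z - cnj z)) \<in> zpolys_less 2"
    by (intro zpolys_scale zpolys_diff z)
  moreover have "(1 / (2 * \<i>)) * (z - cnj z) = of_real (Im z)" for z :: complex
    by (simp add: complex_eq_iff Re_divide Im_divide)
  ultimately have im: "(\<lambda>z. complex_of_real (Im z)) \<in> zpolys_less 2" by simp
  have "(\<lambda>z. of_real (b i j) * (of_real (Re z) ^ i * of_real (Im z) ^ j)) \<in> zpolys_less (Suc n)"
    if "i \<le> n" "j \<le> n - i" for i j
    using that by (intro zpolys_scale zpolys_mult[OF zpolys_power[OF re] zpolys_power[OF im]]) auto
  then have "(\<lambda>z. \<Sum>i\<le>n. \<Sum>j\<le>n - i. of_real (b i j) * (of_real (Re z) ^ i * complex_of_real (Im z) ^ j))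
      \<in> zpolys_less (Suc n)"
    by (intro zpolys_sum) auto
  then show ?thesis by (simp add: f mult.assoc)
qed

text \<open>Row m - k - 1 of the cofactor relation. Its only entries depending on \<open>z\<close>
  are z and its conjugate in adjacent columns, and all others are constants. The point is that the
  right-hand side contains only Q's of the same degree \<open>m\<close>, which are orthogonal to
  everything of lower degree.\<close>

lemma Q_poly_relation:
  assumes "k < m"
  shows "\<exists>C. \<forall>z. cnj z * Q_poly a c m k z - z * Q_poly a c m (Suc k) z = (\<Sum>j\<le>m. C j * Q_poly a c m (m - j) z)"
proof -
  define i where "i = m - Suc k"
  have i: "i < m" "m - i = Suc k" "m - Suc i = k" "Suc i \<le> m" using assms by (auto simp: i_def)
  \<comment> \<open>The constant entries of the row can be read off at the argument 0, once the two
    variable columns are masked.\<close>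
  define B where "B j = (if j = i \<or> j = Suc i then 0 else A_mat a c m 0 $$ (i, j))" for j
  have A: "A_mat a c m z $$ (i, j) = (if j = i then z else 0) + (if j = Suc i then cnj z else 0) + B j"
    if "j \<le> m" for j z
    using that i(1) by (auto simp: A_mat_def B_def)
  have "cnj z * Q_poly a c m k z - z * Q_poly a c m (Suc k) z
      = (\<Sum>j\<le>m. (-1) ^ i * B j * (-1) ^ j * Q_poly a c m (m - j) z)" for z
  proof -
    let ?q = "\<lambda>j. (-1) ^ j * Q_poly a c m (m - j) z"
    have "0 = (\<Sum>j\<le>m. A_mat a c m z $$ (i, j) * ?q j)"
      using A_mat_cofactor_relation[OF i(1)] by simp
    also have "\<dots> = (\<Sum>j\<le>m. (if j = i then z * ?q i else 0) + (if j = Suc i then cnj z * ?q (Suc i) else 0) + B j * ?q j)"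
      by (intro sum.cong) (auto simp: A algebra_simps)
    also have "\<dots> = z * ?q i + cnj z * ?q (Suc i) + (\<Sum>j\<le>m. B j * ?q j)"
      using i by (simp add: sum.distrib)
    finally have "(-1) ^ i * (z * ?q i + cnj z * ?q (Suc i) + (\<Sum>j\<le>m. B j * ?q j)) = 0" by simp
    then have "(-1) ^ i * (-1) ^ i * (z * Q_poly a c m (Suc k) z - cnj z * Q_poly a c m k z)
        + (-1) ^ i * (\<Sum>j\<le>m. B j * ?q j) = 0"
      using i by (simp add: algebra_simps)
    moreover have "(-1) ^ i * (-1) ^ i = (1 :: complex)" by (simp add: power_add[symmetric])
    ultimately have "cnj z * Q_poly a c m k z - z * Q_poly a c m (Suc k) z = (-1) ^ i * (\<Sum>j\<le>m. B j * ?q j)"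
      by (simp add: algebra_simps)
    then show ?thesis by (simp add: sum_distrib_left mult.assoc)
  qed
  then show ?thesis by (intro exI[of _ "\<lambda>j. (-1) ^ i * B j * (-1) ^ j"]) blast
qed

text \<open>Abstracts the integral, so that no measure appears in the cubature argument. Additivity
  is asked only for continuous functions, where integrability is available.\<close>

locale Q_functional =
  fixes a c :: complex and J :: "(complex \<Rightarrow> complex) \<Rightarrow> complex"
  assumes J_add: "\<lbrakk>continuous_on UNIV f; continuous_on UNIV g\<rbrakk> \<Longrightarrow> J (\<lambda>z. f z + g z) = J f + J g"
    and J_scale: "J (\<lambda>z. l * f z) = l * J f"
    and J_cnj: "J (\<lambda>z. cnj (f z)) = cnj (J f)"
    and J_definite: "\<lbrakk>f \<in> zpolys_less m; J (\<lambda>z. f z * cnj (f z)) = 0\<rbrakk> \<Longrightarrow> f = 0"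
    and J_orthogonal: "\<lbrakk>k \<le> m; R \<in> zpolys_less m\<rbrakk> \<Longrightarrow> J (\<lambda>z. Q_poly a c m k z * cnj (R z)) = 0"
begin

lemma J_zero: "J (\<lambda>_. 0) = 0"
  using J_scale[of 0 "\<lambda>_. 0"] by simp

lemma J_diff:
  assumes "continuous_on UNIV f" "continuous_on UNIV g"
  shows "J (\<lambda>z. f z - g z) = J f - J g"
  using J_add[OF assms(1), of "\<lambda>z. -1 * g z"] J_scale[of "-1" g] assms(2)
  by (simp add: continuous_on_minus)

lemma J_sum:
  assumes "finite A" "\<And>i. i \<in> A \<Longrightarrow> continuous_on UNIV (f i)"
  shows "J (\<lambda>z. \<Sum>i\<in>A. f i z) = (\<Sum>i\<in>A. J (f i))"
  using assms
proof (induction A rule: finite_induct)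
  case (insert x A)
  then show ?case by (simp add: J_add continuous_on_sum)
qed (simp add: J_zero)

definition ip :: "(complex \<Rightarrow> complex) \<Rightarrow> (complex \<Rightarrow> complex) \<Rightarrow> complex" where
  "ip f g = J (\<lambda>z. f z * cnj (g z))"

lemma ip_cnj: "ip g f = cnj (ip f g)"
  unfolding ip_def J_cnj[symmetric] by (simp add: mult.commute)

lemma hermitian_zpolys: "hermitian_space fscale (zpolys_less m) ip"
proof
  show "cfun.subspace (zpolys_less m)" by (rule subspace_zpolys)
  show "\<exists>B. finite B \<and> zpolys_less m \<subseteq> cfun.span B"
    using finite_monomials_less zpolys_eq_span by blast
  show "ip (f + g) h = ip f h + ip g h"
    if "f \<in> zpolys_less m" "g \<in> zpolys_less m" "h \<in> zpolys_less m" for f g h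
  proof -
    have "continuous_on UNIV (\<lambda>z. f z * cnj (h z))" "continuous_on UNIV (\<lambda>z. g z * cnj (h z))"
      using that[THEN zpolys_continuous] by (auto intro!: continuous_intros)
    then show ?thesis by (simp add: ip_def distrib_right J_add)
  qed
  show "ip (fscale k f) h = k * ip f h" for k f h
    by (simp add: ip_def fscale_def mult.assoc J_scale)
  show "ip g f = cnj (ip f g)" for f g by (rule ip_cnj)
  show "f = 0" if "f \<in> zpolys_less m" "ip f f = 0" for f
    using J_definite that by (simp add: ip_def)
qed

text \<open>A top monomial times z is the leading monomial of some Q of the next degree, and times
  \<open>cnj z\<close> that of the Q with the next index. Both products therefore use the same
  coefficients \<open>b\<close>, and this is what makes the two compressions commute.\<close>

lemma Q_shift_decomposition:
  assumes "f \<in> zpolys_less (Suc n)"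
  shows "\<exists>b t s. t \<in> zpolys_less (Suc n) \<and> s \<in> zpolys_less (Suc n)
    \<and> (\<forall>z. z * f z = t z + (\<Sum>k\<le>n. b k * Q_poly a c (Suc n) k z))
    \<and> (\<forall>z. cnj z * f z = s z + (\<Sum>k\<le>n. b k * Q_poly a c (Suc n) (Suc k) z))"
proof -
  obtain b g where g: "g \<in> zpolys_less n" and f: "f = (\<lambda>z. (\<Sum>k\<le>n. b k * (z ^ (n - k) * cnj z ^ k)) + g z)"
    using span_leading_decomposition[of f n "{..n}"] assms unfolding zpolys_Suc_eq by blast
  let ?Q = "Q_poly a c (Suc n)"
  let ?t = "\<lambda>z. z ^ 1 * cnj z ^ 0 * g z - (\<Sum>k\<le>n. b k * (?Q k z - z ^ (Suc n - k) * cnj z ^ k))"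
  let ?s = "\<lambda>z. z ^ 0 * cnj z ^ 1 * g z - (\<Sum>k\<le>n. b k * (?Q (Suc k) z - z ^ (Suc n - Suc k) * cnj z ^ Suc k))"
  have "?t \<in> zpolys_less (Suc n)"
    by (rule zpolys_diff[OF zpolys_mult_monomial[OF g] zpolys_sum[OF zpolys_scale[OF Q_poly_leading_term]]]) auto
  moreover have "?s \<in> zpolys_less (Suc n)"
    by (rule zpolys_diff[OF zpolys_mult_monomial[OF g] zpolys_sum[OF zpolys_scale[OF Q_poly_leading_term]]]) auto
  moreover have "z * f z = ?t z + (\<Sum>k\<le>n. b k * ?Q k z)" for z
  proof -
    have "z * (\<Sum>k\<le>n. b k * (z ^ (n - k) * cnj z ^ k)) = (\<Sum>k\<le>n. b k * (z ^ (Suc n - k) * cnj z ^ k))"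
      unfolding sum_distrib_left by (intro sum.cong) (auto simp: Suc_diff_le)
    then show ?thesis by (simp add: f algebra_simps sum_subtractf)
  qed
  moreover have "cnj z * f z = ?s z + (\<Sum>k\<le>n. b k * ?Q (Suc k) z)" for z
  proof -
    have "cnj z * (\<Sum>k\<le>n. b k * (z ^ (n - k) * cnj z ^ k)) = (\<Sum>k\<le>n. b k * (z ^ (Suc n - Suc k) * cnj z ^ Suc k))"
      unfolding sum_distrib_left by (intro sum.cong) auto
    then show ?thesis by (simp add: f algebra_simps sum_subtractf)
  qed
  ultimately show ?thesis by blast
qed

lemma J_Q_combination:
  assumes "h \<in> zpolys_less m" "\<And>k. k \<in> A \<Longrightarrow> p k \<le> m" "finite A"
  shows "J (\<lambda>z. (\<Sum>k\<in>A. b k * Q_poly a c m (p k) z) * cnj (h z)) = 0"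
proof -
  have "continuous_on UNIV (\<lambda>z. b k * (Q_poly a c m (p k) z * cnj (h z)))" if "k \<in> A" for k
    using zpolys_continuous[OF Q_poly_in_zpolys[OF assms(2)[OF that]], of UNIV]
      zpolys_continuous[OF assms(1), of UNIV]
    by (auto intro!: continuous_intros)
  then have "J (\<lambda>z. \<Sum>k\<in>A. b k * (Q_poly a c m (p k) z * cnj (h z)))
      = (\<Sum>k\<in>A. J (\<lambda>z. b k * (Q_poly a c m (p k) z * cnj (h z))))"
    by (intro J_sum assms(3))
  also have "\<dots> = 0" unfolding J_scale using J_orthogonal[OF assms(2,1)] by simp
  finally show ?thesis by (simp add: sum_distrib_right mult.assoc)
qed

text \<open>The compressions of multiplication by \<open>z\<close> and by its conjugate to the polynomials of degree at most
  \<open>n\<close> commute: the top parts removed by the projection are combinations of the \<open>Q\<close>'s, and the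
  cofactor relation turns their shifts into further combinations of the \<open>Q\<close>'s.\<close>

lemma compression_exists:
  "\<exists>T S. normal_operator fscale (zpolys_less (Suc n)) ip T S
    \<and> (\<forall>f\<in>zpolys_less (Suc n). \<forall>h\<in>zpolys_less (Suc n).
         ip (T f) h = J (\<lambda>z. z * f z * cnj (h z)) \<and> ip (S f) h = J (\<lambda>z. cnj z * f z * cnj (h z)))"
proof -
  let ?V = "zpolys_less (Suc n)" and ?Q = "Q_poly a c (Suc n)"
  interpret H: hermitian_space fscale ?V ip by (rule hermitian_zpolys)
  have cont: "continuous_on UNIV (\<lambda>z. f z)" if "f \<in> zpolys_less m" for f m
    using zpolys_continuous[OF that] .
  have Qcont: "continuous_on UNIV (Q_poly a c (Suc n) k)" if "k \<le> Suc n" for k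
    by (rule cont[OF Q_poly_in_zpolys[OF that]])
  define decomposed where "decomposed f x \<longleftrightarrow> (case x of (b, t, s) \<Rightarrow> t \<in> ?V \<and> s \<in> ?V
    \<and> (\<forall>z. z * f z = t z + (\<Sum>k\<le>n. b k * ?Q k z))
    \<and> (\<forall>z. cnj z * f z = s z + (\<Sum>k\<le>n. b k * ?Q (Suc k) z)))" for f x
  \<comment> \<open>The decompositions are chosen separately for each \<open>f\<close>, so
    \<open>T\<close> is not linear by construction. Linearity follows afterwards because
    \<open>ip (T f) h\<close> for all \<open>h\<close> determines \<open>T f\<close>.\<close>
  have "\<exists>x. decomposed f x" if "f \<in> ?V" for f
    using Q_shift_decomposition[OF that] unfolding decomposed_def by auto
  then obtain D where D: "\<And>f. f \<in> ?V \<Longrightarrow> decomposed f (D f)" by metis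
  define b where "b f = fst (D f)" for f
  define T where "T f = fst (snd (D f))" for f
  define S where "S f = snd (snd (D f))" for f
  have TS: "T f \<in> ?V" "S f \<in> ?V" "z * f z = T f z + (\<Sum>k\<le>n. b f k * ?Q k z)"
    "cnj z * f z = S f z + (\<Sum>k\<le>n. b f k * ?Q (Suc k) z)" if "f \<in> ?V" for f z
    using D[OF that] unfolding decomposed_def split_def b_def T_def S_def by blast+
  have T: "ip (T f) h = J (\<lambda>z. z * f z * cnj (h z))" if "f \<in> ?V" "h \<in> ?V" for f h
  proof -
    have "J (\<lambda>z. z * f z * cnj (h z)) = J (\<lambda>z. T f z * cnj (h z) + (\<Sum>k\<le>n. b f k * ?Q k z) * cnj (h z))"
      using TS(3)[OF that(1)] by (simp add: distrib_right)
    also have "\<dots> = ip (T f) h + J (\<lambda>z. (\<Sum>k\<le>n. b f k * ?Q k z) * cnj (h z))"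
      unfolding ip_def using cont[OF TS(1)[OF that(1)]] cont[OF that(2)]
      by (intro J_add continuous_intros) (auto intro: Qcont)
    finally show ?thesis using J_Q_combination[OF that(2), of "{..n}" "\<lambda>k. k"] by simp
  qed
  have S: "ip (S f) h = J (\<lambda>z. cnj z * f z * cnj (h z))" if "f \<in> ?V" "h \<in> ?V" for f h
  proof -
    have "J (\<lambda>z. cnj z * f z * cnj (h z)) = J (\<lambda>z. S f z * cnj (h z) + (\<Sum>k\<le>n. b f k * ?Q (Suc k) z) * cnj (h z))"
      using TS(4)[OF that(1)] by (simp add: distrib_right)
    also have "\<dots> = ip (S f) h + J (\<lambda>z. (\<Sum>k\<le>n. b f k * ?Q (Suc k) z) * cnj (h z))"
      unfolding ip_def using cont[OF TS(2)[OF that(1)]] cont[OF that(2)]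
      by (intro J_add continuous_intros) (auto intro: Qcont)
    finally show ?thesis using J_Q_combination[OF that(2), of "{..n}" Suc] by simp
  qed
  have unique: "f = g" if "f \<in> ?V" "g \<in> ?V" "\<And>h. h \<in> ?V \<Longrightarrow> ip f h = ip g h" for f g
  proof -
    have "f - g \<in> ?V" using that H.V_closed by blast
    then have "ip (f - g) (f - g) = 0" using that by (simp add: H.ip_diff)
    then show ?thesis using H.ip_definite \<open>f - g \<in> ?V\<close> by fastforce
  qed
  have mult_cont: "continuous_on UNIV (\<lambda>z. z * f z * cnj (h z))" "continuous_on UNIV (\<lambda>z. cnj z * f z * cnj (h z))"
    if "f \<in> ?V" "h \<in> ?V" for f h
    using that[THEN cont] by (auto intro!: continuous_intros)
  have comm: "T (S f) = S (T f)" if f: "f \<in> ?V" for f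
  proof (rule unique)
    fix h assume h: "h \<in> ?V"
    let ?q = "\<lambda>z. \<Sum>k\<le>n. b f k * ?Q k z" and ?q' = "\<lambda>z. \<Sum>k\<le>n. b f k * ?Q (Suc k) z"
    have qc: "continuous_on UNIV (\<lambda>z. z * ?q' z * cnj (h z))" "continuous_on UNIV (\<lambda>z. cnj z * ?q z * cnj (h z))"
      "continuous_on UNIV (\<lambda>z. z * (cnj z * f z) * cnj (h z))" "continuous_on UNIV (\<lambda>z. cnj z * (z * f z) * cnj (h z))"
      using cont[OF f] cont[OF h] by (auto intro!: continuous_intros intro: Qcont)
    \<comment> \<open>Tested against \<open>h\<close>, the two compositions differ from
      multiplication by z and its conjugate only through the shifted top parts. The cofactor
      relation makes the difference of these a combination of Q's of degree n + 1, which
      \<open>J\<close> does not see.\<close>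
    have "J (\<lambda>z. cnj z * ?q z * cnj (h z)) - J (\<lambda>z. z * ?q' z * cnj (h z)) = 0"
    proof -
      have "\<forall>k. \<exists>C. k \<le> n \<longrightarrow> (\<forall>z. cnj z * ?Q k z - z * ?Q (Suc k) z = (\<Sum>j\<le>Suc n. C j * ?Q (Suc n - j) z))"
        using Q_poly_relation[of _ "Suc n"] by (metis less_Suc_eq_le)
      then obtain C where C: "\<And>k z. k \<le> n \<Longrightarrow> cnj z * ?Q k z - z * ?Q (Suc k) z = (\<Sum>j\<le>Suc n. C k j * ?Q (Suc n - j) z)"
        by metis
      have "cnj z * ?q z - z * ?q' z = (\<Sum>j\<le>Suc n. (\<Sum>k\<le>n. b f k * C k j) * ?Q (Suc n - j) z)" for z
      proof -
        have "cnj z * ?q z - z * ?q' z = (\<Sum>k\<le>n. b f k * (cnj z * ?Q k z - z * ?Q (Suc k) z))"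
          by (simp add: sum_distrib_left sum_subtractf[symmetric] algebra_simps)
        also have "\<dots> = (\<Sum>k\<le>n. \<Sum>j\<le>Suc n. b f k * C k j * ?Q (Suc n - j) z)"
          by (intro sum.cong refl) (simp only: C atMost_iff sum_distrib_left mult.assoc)
        also have "\<dots> = (\<Sum>j\<le>Suc n. \<Sum>k\<le>n. b f k * C k j * ?Q (Suc n - j) z)" by (rule sum.swap)
        finally show ?thesis by (simp only: sum_distrib_right)
      qed
      then have "(\<lambda>z. cnj z * ?q z * cnj (h z) - z * ?q' z * cnj (h z))
          = (\<lambda>z. (\<Sum>j\<le>Suc n. (\<Sum>k\<le>n. b f k * C k j) * ?Q (Suc n - j) z) * cnj (h z))"
        by (simp only: left_diff_distrib[symmetric])
      then have "J (\<lambda>z. cnj z * ?q z * cnj (h z) - z * ?q' z * cnj (h z)) = 0"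
        using J_Q_combination[OF h, of "{..Suc n}" "\<lambda>j. Suc n - j"] by simp
      then show ?thesis using J_diff[OF qc(2,1)] by simp
    qed
    moreover have "ip (T (S f)) h = J (\<lambda>z. z * (cnj z * f z) * cnj (h z)) - J (\<lambda>z. z * ?q' z * cnj (h z))"
    proof -
      have "z * S f z * cnj (h z) = z * (cnj z * f z) * cnj (h z) - z * ?q' z * cnj (h z)" for z
        unfolding TS(4)[OF f] by (simp add: algebra_simps)
      then show ?thesis unfolding T[OF TS(2)[OF f] h]
        by (simp only:) (rule J_diff[OF qc(3,1)])
    qed
    moreover have "ip (S (T f)) h = J (\<lambda>z. cnj z * (z * f z) * cnj (h z)) - J (\<lambda>z. cnj z * ?q z * cnj (h z))"
    proof -
      have "cnj z * T f z * cnj (h z) = cnj z * (z * f z) * cnj (h z) - cnj z * ?q z * cnj (h z)" for z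
        unfolding TS(3)[OF f] by (simp add: algebra_simps)
      then show ?thesis unfolding S[OF TS(1)[OF f] h]
        by (simp only:) (rule J_diff[OF qc(4,2)])
    qed
    ultimately show "ip (T (S f)) h = ip (S (T f)) h" by (simp add: mult_ac)
  qed (use TS(1,2) f in auto)
  have "normal_operator fscale ?V ip T S"
  proof
    show "T f \<in> ?V" "S f \<in> ?V" if "f \<in> ?V" for f using TS that by auto
    show "T (f + g) = T f + T g" if fg: "f \<in> ?V" "g \<in> ?V" for f g
    proof (rule unique)
      fix h assume h: "h \<in> ?V"
      have "ip (T (f + g)) h = J (\<lambda>z. z * f z * cnj (h z) + z * g z * cnj (h z))"
        using T[of "f + g" h] fg h H.V_closed by (simp add: algebra_simps)
      also have "\<dots> = ip (T f + T g) h"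
        using fg h TS(1) by (simp add: J_add mult_cont T H.ip_add)
      finally show "ip (T (f + g)) h = ip (T f + T g) h" .
    qed (use fg TS(1) H.V_closed in auto)
    show "T (fscale k f) = fscale k (T f)" if f: "f \<in> ?V" for k f
    proof (rule unique)
      fix h assume h: "h \<in> ?V"
      have "ip (T (fscale k f)) h = J (\<lambda>z. k * (z * f z * cnj (h z)))"
        using T[of "fscale k f" h] f h H.V_closed by (simp add: fscale_def mult_ac)
      then show "ip (T (fscale k f)) h = ip (fscale k (T f)) h"
        using f h TS(1) by (simp add: J_scale T H.ip_scale)
    qed (use f TS(1) H.V_closed in auto)
    show "ip (T f) g = ip f (S g)" if fg: "f \<in> ?V" "g \<in> ?V" for f g
    proof -
      have "ip f (S g) = cnj (ip (S g) f)" by (rule ip_cnj)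
      also have "\<dots> = J (\<lambda>z. cnj (cnj z * g z * cnj (f z)))" using S fg by (simp only: J_cnj)
      also have "\<dots> = J (\<lambda>z. z * f z * cnj (g z))" by (simp add: mult_ac)
      finally show ?thesis using T fg by simp
    qed
    show "T (S f) = S (T f)" if "f \<in> ?V" for f by (rule comm[OF that])
  qed
  then show ?thesis using T S by blast
qed

end

subsection \<open>Gaussian cubature\<close>

context Q_functional
begin

text \<open>Pairing with an eigenvector \<open>e\<close> is a multiple of evaluation at its
  eigenvalue, because factors z and \<open>cnj z\<close> can be moved onto \<open>e\<close>.
  Expanding the second argument of a product in the eigenbasis then turns \<open>J\<close> into a
  sum over the eigenvalues. The number of nodes is the dimension of the space.\<close>

lemma cubature_exists:
  "\<exists>(E :: (complex \<Rightarrow> complex) set) \<tau> wt.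
     card E = Suc (Suc n) choose 2 \<and> finite E \<and> inj_on \<tau> E \<and> (\<forall>x\<in>E. wt x \<noteq> (0 :: real)) \<and>
     (\<forall>h \<in> zpolys_less (2 * Suc n). J h = (\<Sum>x\<in>E. of_real (wt x) * h (\<tau> x)))"
  if indep: "cfun.independent (monomials_less (Suc n))" "card (monomials_less (Suc n)) = Suc (Suc n) choose 2"
proof -
  let ?V = "zpolys_less (Suc n)"
  obtain T S where TS: "normal_operator fscale ?V ip T S"
    and T: "\<And>f h. f \<in> ?V \<Longrightarrow> h \<in> ?V \<Longrightarrow> ip (T f) h = J (\<lambda>z. z * f z * cnj (h z))"
    and S: "\<And>f h. f \<in> ?V \<Longrightarrow> h \<in> ?V \<Longrightarrow> ip (S f) h = J (\<lambda>z. cnj z * f z * cnj (h z))"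
    using compression_exists[of n] by blast
  interpret N: normal_operator fscale ?V ip T S by (rule TS)
  obtain E where E: "finite E" "N.orthogonal_set E" "?V \<subseteq> cfun.span E"
    and eig: "\<forall>e\<in>E. \<exists>t. T e = fscale t e \<and> S e = fscale (cnj t) e"
    using N.orthogonal_eigenbasis by blast
  have EV: "\<And>e. e \<in> E \<Longrightarrow> e \<in> ?V" "0 \<notin> E" and orth: "\<And>e e'. e \<in> E \<Longrightarrow> e' \<in> E \<Longrightarrow> e \<noteq> e' \<Longrightarrow> ip e e' = 0"
    using E(2) by (auto simp: N.orthogonal_set_def)
  have card: "card E = Suc (Suc n) choose 2"
  proof -
    have "card E = cfun.dim ?V"
      using EV E(3) N.independent_orthogonal_set[OF E(2)] by (intro cfun.basis_card_eq_dim) auto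
    also have "\<dots> = card (monomials_less (Suc n))"
      unfolding zpolys_eq_span by (rule cfun.dim_span_eq_card_independent[OF indep(1)])
    finally show ?thesis using indep(2) by simp
  qed
  from eig obtain \<tau> where \<tau>: "\<And>e. e \<in> E \<Longrightarrow> T e = fscale (\<tau> e) e" "\<And>e. e \<in> E \<Longrightarrow> S e = fscale (cnj (\<tau> e)) e"
    by metis
  have cont: "continuous_on UNIV (\<lambda>z. f z)" if "f \<in> zpolys_less m" for f m
    using zpolys_continuous[OF that] .
  \<comment> \<open>The factor between pairing with \<open>e\<close> and evaluation at its node,
    read off from the constant polynomial 1.\<close>
  define \<beta> where "\<beta> e = J (\<lambda>z. cnj (e z))" for e
  have ip_nz: "ip e e \<noteq> 0" if "e \<in> E" for e
    using N.ip_definite[of e] EV that by metis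
  have eval_step: "J (\<lambda>z. z * g z * cnj (e z)) = \<tau> e * ip g e" "J (\<lambda>z. cnj z * g z * cnj (e z)) = cnj (\<tau> e) * ip g e"
    if "g \<in> ?V" "e \<in> E" for g e
  proof -
    have "J (\<lambda>z. z * g z * cnj (e z)) = ip g (S e)" using T[of g e] N.adjoint[of g e] that EV by simp
    also have "\<dots> = \<tau> e * ip g e" using that EV by (simp add: \<tau>(2) N.ip_scale_right)
    finally show "J (\<lambda>z. z * g z * cnj (e z)) = \<tau> e * ip g e" .
    have "J (\<lambda>z. cnj z * g z * cnj (e z)) = cnj (ip e (S g))" using S[of g e] ip_cnj[of "S g" e] that EV by simp
    also have "\<dots> = cnj (ip (T e) g)" using N.adjoint[of e g] that EV by simp
    also have "\<dots> = cnj (\<tau> e) * cnj (ip e g)" using that EV by (simp add: \<tau>(1) N.ip_scale)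
    also have "cnj (ip e g) = ip g e" by (rule ip_cnj[symmetric])
    finally show "J (\<lambda>z. cnj z * g z * cnj (e z)) = cnj (\<tau> e) * ip g e" .
  qed
  \<comment> \<open>The bound goes one degree beyond the space itself: the last factor moved
    multiplies a polynomial of degree at most \<open>n\<close>. This extra degree is what makes the
    rule exact up to 2 n + 1.\<close>
  have eval_monomial: "J (\<lambda>z. z ^ i * cnj z ^ j * cnj (e z)) = \<tau> e ^ i * cnj (\<tau> e) ^ j * \<beta> e"
    if "i + j \<le> Suc n" "e \<in> E" for i j e
    using that(1)
  proof (induction "i + j" arbitrary: i j)
    case 0
    then show ?case by (simp add: \<beta>_def)
  next
    case (Suc l)
    show ?case
    proof (cases i)
      case (Suc i')
      have g: "(\<lambda>z. z ^ i' * cnj z ^ j) \<in> ?V" using Suc Suc.prems by (intro monomial_in_zpolys) simp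
      have "J (\<lambda>z. z ^ i * cnj z ^ j * cnj (e z)) = \<tau> e * J (\<lambda>z. z ^ i' * cnj z ^ j * cnj (e z))"
        using eval_step(1)[OF g \<open>e \<in> E\<close>] Suc by (simp add: ip_def mult_ac)
      then show ?thesis using Suc.hyps(1)[of i' j] Suc.hyps(2) Suc.prems Suc by (simp add: mult_ac)
    next
      case 0
      then obtain j' where j': "j = Suc j'" using Suc.hyps(2) by auto
      have g: "(\<lambda>z. z ^ i * cnj z ^ j') \<in> ?V" using 0 j' Suc.prems by (intro monomial_in_zpolys) simp
      have "J (\<lambda>z. z ^ i * cnj z ^ j * cnj (e z)) = cnj (\<tau> e) * J (\<lambda>z. z ^ i * cnj z ^ j' * cnj (e z))"
        using eval_step(2)[OF g \<open>e \<in> E\<close>] j' by (simp add: ip_def mult_ac)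
      then show ?thesis using Suc.hyps(1)[of i j'] Suc.hyps(2) Suc.prems j' by (simp add: mult_ac)
    qed
  qed
  have eval: "J (\<lambda>z. f z * cnj (e z)) = f (\<tau> e) * \<beta> e" if f: "f \<in> zpolys_less (Suc (Suc n))" and e: "e \<in> E" for f e
  proof -
    have "continuous_on UNIV f \<and> J (\<lambda>z. f z * cnj (e z)) = f (\<tau> e) * \<beta> e"
      using f
    proof (induction rule: zpolys_induct)
      case zero
      then show ?case by (simp add: J_zero)
    next
      case (add f g)
      then have "J (\<lambda>z. f z * cnj (e z) + g z * cnj (e z)) = J (\<lambda>z. f z * cnj (e z)) + J (\<lambda>z. g z * cnj (e z))"
        using cont[OF EV(1)[OF e]] by (intro J_add continuous_intros) auto
      then show ?case using add by (auto simp: distrib_right intro!: continuous_intros)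
    next
      case (scale f k)
      then show ?case by (auto simp: mult.assoc J_scale intro!: continuous_intros)
    next
      case (monomial i j)
      then show ?case using eval_monomial[of i j e] e by (auto intro!: continuous_intros)
    qed
    then show ?thesis by blast
  qed
  have evalV: "ip f e = f (\<tau> e) * \<beta> e" if "f \<in> ?V" "e \<in> E" for f e
    using eval[of f e] that zpolys_mono[of "Suc n" "Suc (Suc n)"] by (auto simp: ip_def)
  \<comment> \<open>Neither factor of \<open>ip e e = e (\<tau> e) * \<beta> e\<close> can vanish.
    Hence two eigenvectors cannot share a node, since orthogonality would make one of them vanish
    there.\<close>
  have \<beta>_nz: "\<beta> e \<noteq> 0" if "e \<in> E" for e
    using evalV[of e e] ip_nz[OF that] EV that by auto
  have inj: "inj_on \<tau> E"
  proof (rule inj_onI, rule ccontr)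
    fix e e' assume *: "e \<in> E" "e' \<in> E" "\<tau> e = \<tau> e'" "e \<noteq> e'"
    then have "e' (\<tau> e) * \<beta> e = 0" using evalV[of e' e] orth[of e' e] EV by simp
    then have "e' (\<tau> e') = 0" using \<beta>_nz * by simp
    then show False using evalV[of e' e'] ip_nz[of e'] EV * by simp
  qed
  \<comment> \<open>The Christoffel number: evaluating \<open>f\<close> gives one factor \<beta>,
    and expressing the coefficient of \<open>g\<close> by its value at the node gives the conjugate
    factor and the division by \<open>ip e e\<close>.\<close>
  define wt where "wt e = Re (\<beta> e * cnj (\<beta> e) / ip e e)" for e
  have wt: "of_real (wt e) = \<beta> e * cnj (\<beta> e) / ip e e" if "e \<in> E" for e
  proof -
    have "cnj (\<beta> e * cnj (\<beta> e) / ip e e) = \<beta> e * cnj (\<beta> e) / ip e e"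
      using ip_cnj[of e e] by (simp add: mult.commute)
    then show ?thesis unfolding wt_def by (metis Reals_cnj_iff of_real_Re)
  qed
  have wt_nz: "wt e \<noteq> 0" if "e \<in> E" for e
    using wt[OF that] \<beta>_nz[OF that] ip_nz[OF that] by auto
  have pairing: "J (\<lambda>z. f z * cnj (g z)) = (\<Sum>e\<in>E. of_real (wt e) * (f (\<tau> e) * cnj (g (\<tau> e))))"
    if f: "f \<in> zpolys_less (Suc (Suc n))" and g: "g \<in> ?V" for f g
  proof -
    obtain u where u: "g = (\<Sum>e\<in>E. fscale (u e) e)"
      using g E(3) cfun.span_finite[OF E(1)] by auto
    have gu: "g (\<tau> e) * \<beta> e = u e * ip e e" if "e \<in> E" for e
      using N.ip_orthogonal_sum[OF E(2,1) subset_refl that, of u] evalV[OF g that] u by simp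
    have "(\<lambda>z. f z * cnj (g z)) = (\<lambda>z. \<Sum>e\<in>E. cnj (u e) * (f z * cnj (e z)))"
      unfolding u by (auto simp: fun_eq_iff sum_fun_apply fscale_def sum_distrib_left mult_ac)
    then have "J (\<lambda>z. f z * cnj (g z)) = (\<Sum>e\<in>E. J (\<lambda>z. cnj (u e) * (f z * cnj (e z))))"
      using cont[OF f] cont[OF EV(1)] by (simp only:) (intro J_sum E(1) continuous_intros; simp)
    also have "\<dots> = (\<Sum>e\<in>E. of_real (wt e) * (f (\<tau> e) * cnj (g (\<tau> e))))"
    proof (rule sum.cong[OF refl])
      fix e assume e: "e \<in> E"
      have ipr: "cnj (ip e e) = ip e e" by (rule ip_cnj[symmetric])
      have "cnj (u e) * ip e e = cnj (g (\<tau> e)) * cnj (\<beta> e)"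
        using arg_cong[OF gu[OF e], of cnj] ipr by simp
      then have "cnj (u e) = cnj (g (\<tau> e)) * cnj (\<beta> e) / ip e e"
        using ip_nz[OF e] by (simp add: eq_divide_eq)
      then show "J (\<lambda>z. cnj (u e) * (f z * cnj (e z))) = of_real (wt e) * (f (\<tau> e) * cnj (g (\<tau> e)))"
        unfolding J_scale eval[OF f e] wt[OF e] by simp
    qed
    finally show ?thesis .
  qed
  have "J h = (\<Sum>e\<in>E. of_real (wt e) * h (\<tau> e))" if h: "h \<in> zpolys_less (2 * Suc n)" for h
  proof -
    have "continuous_on UNIV h \<and> J h = (\<Sum>e\<in>E. of_real (wt e) * h (\<tau> e))"
      using h
    proof (induction rule: zpolys_induct)
      case zero
      then show ?case by (simp add: J_zero)
    next
      case (add f g)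
      then show ?case by (auto simp: J_add distrib_left sum.distrib intro!: continuous_intros)
    next
      case (scale f k)
      then show ?case by (auto simp: J_scale sum_distrib_left mult_ac intro!: continuous_intros)
    next
      case (monomial i j)
      \<comment> \<open>A monomial of degree at most 2 n + 1 is written as one of degree at most n +
        1 times the conjugate of one of degree at most n, taking as many factors z as possible into
        the first. Conjugation exchanges the exponents left over.\<close>
      define i1 j1 where "i1 = min i (Suc n)" and "j1 = min j (Suc n - i1)"
      have ij: "i1 \<le> i" "j1 \<le> j" "i1 + j1 < Suc (Suc n)" "(j - j1) + (i - i1) < Suc n"
        using monomial by (auto simp: i1_def j1_def min_def)
      have split: "z ^ i * cnj z ^ j = (z ^ i1 * cnj z ^ j1) * cnj (z ^ (j - j1) * cnj z ^ (i - i1))" for z :: complex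
      proof -
        have "z ^ i = z ^ i1 * z ^ (i - i1)" "cnj z ^ j = cnj z ^ j1 * cnj z ^ (j - j1)"
          using ij by (simp_all add: power_add[symmetric])
        then show ?thesis by (simp add: mult_ac)
      qed
      show ?case
        using pairing[OF monomial_in_zpolys[OF ij(3)] monomial_in_zpolys[OF ij(4)]]
        unfolding split[symmetric] by (auto intro!: continuous_intros)
    qed
    then show ?thesis by blast
  qed
  then show ?thesis using card E(1) inj wt_nz by blast
qed

end

subsection \<open>The measure on the deltoid\<close>

context deltoid
begin

definition mass :: real where
  "mass = integral unit_square (\<lambda>(s, t). density_fun (circ s) (circ t))"

definition deltoid_measure :: "(real \<times> real) measure" where
  "deltoid_measure = push_measure (\<lambda>(s, t). density_fun (circ s) (circ t) / mass)
     (\<lambda>(s, t). (Re (point (circ s) (circ t)), Im (point (circ s) (circ t))))"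

lemma density_nonneg: "density_fun x y \<ge> 0"
  by (simp add: density_fun_def)

lemma density_eq_0_iff:
  assumes "norm x = 1" "norm y = 1"
  shows "density_fun x y = 0 \<longleftrightarrow> vdm x y (1 / (x * y)) = 0"
proof -
  have "1 - e * x ^ 3 \<noteq> 0" "1 - e * y ^ 3 \<noteq> 0" "1 - e * (1 / (x * y)) ^ 3 \<noteq> 0"
    by (rule one_minus_cube_nz[OF e]; use assms in \<open>auto simp: norm_divide norm_mult\<close>)+
  then show ?thesis by (simp add: density_fun_def)
qed

text \<open>A continuous nonnegative integrand with integral zero vanishes on the closed square,
  which covers the whole torus. The density vanishes exactly with the Vandermonde product, so the
  criterion containing that factor applies.\<close>

lemma vanishing_if_integral_zero:
  assumes f: "f \<in> zpolys_less m"
    and int: "integral unit_square (\<lambda>(s, t). density_fun (circ s) (circ t) * (norm (f (point (circ s) (circ t))))\<^sup>2) = 0"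
  shows "f = 0"
proof (rule zpoly_zero_if_vanishing[OF f])
  fix x y :: complex assume x: "norm x = 1" and y: "norm y = 1"
  obtain s t where st: "s \<in> {0..1}" "t \<in> {0..1}" "x = circ s" "y = circ t"
    using circle_eq_circ[OF x] circle_eq_circ[OF y] by blast
  let ?g = "\<lambda>(s, t). density_fun (circ s) (circ t) * (norm (f (point (circ s) (circ t))))\<^sup>2"
  have "continuous_on (circle \<times> circle) (\<lambda>(x, y). density_fun x y * (norm (f (point x y)))\<^sup>2)"
    using continuous_on_density torus_continuous_zpoly[OF f]
    unfolding split_def by (intro continuous_intros)
  then have "continuous_on unit_square ?g" by (rule torus_continuous)
  moreover have "box (0, 0) (1, 1) \<noteq> ({} :: (real \<times> real) set)"
    by (simp add: box_ne_empty Basis_prod_def inner_prod_def)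
  moreover have "?g p \<ge> 0" for p by (simp add: density_nonneg split_def)
  ultimately have vals: "\<forall>p\<in>unit_square. ?g p = 0"
    using integral_cbox_eq_0_iff[of "(0, 0)" "(1, 1)" ?g] int by blast
  have "(s, t) \<in> unit_square" using st by simp
  from bspec[OF vals this] have "density_fun x y = 0 \<or> f (point x y) = 0" by (simp add: st)
  then show "f (point x y) * vdm x y (1 / (x * y)) = 0"
    using density_eq_0_iff[OF x y] by auto
qed

text \<open>If the total mass were zero, the preceding definiteness argument would annihilate the
  constant polynomial 1.\<close>

lemma mass_pos: "mass > 0"
proof -
  have "mass \<ge> 0" unfolding mass_def
    by (intro integral_nonneg integrable_continuous torus_continuous continuous_on_density)
      (auto simp: density_nonneg)
  moreover have "mass \<noteq> 0"
  proof
    assume "mass = 0"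
    then have "(\<lambda>_. 1 :: complex) = (0 :: complex \<Rightarrow> complex)"
      by (intro vanishing_if_integral_zero[OF zpolys_const[of 1 1]]) (simp_all add: mass_def)
    then show False by (simp add: fun_eq_iff)
  qed
  ultimately show ?thesis by simp
qed

lemma deltoid_measure_continuous:
  "continuous_on UNIV (\<lambda>(s, t). density_fun (circ s) (circ t) / mass)"
  "continuous_on UNIV (\<lambda>(s, t). (Re (point (circ s) (circ t)), Im (point (circ s) (circ t))))"
  using torus_continuous[OF continuous_on_density, of UNIV] torus_continuous[OF continuous_on_point, of UNIV]
    mass_pos
  unfolding split_def by (auto intro!: continuous_intros)

lemma deltoid_density_nonneg: "(\<lambda>(s, t). density_fun (circ s) (circ t) / mass) x \<ge> 0"
  using mass_pos by (simp add: density_nonneg split_def)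

lemmas push_facts = deltoid_measure_continuous(1) deltoid_density_nonneg deltoid_measure_continuous(2)

lemma sets_deltoid_measure: "sets deltoid_measure = sets borel"
  unfolding deltoid_measure_def by (rule sets_push_measure[OF push_facts])

lemma prob_space_deltoid_measure: "prob_space deltoid_measure"
  unfolding deltoid_measure_def
proof (rule prob_space_push_measure[OF push_facts])
  have "integral unit_square (\<lambda>(s, t). density_fun (circ s) (circ t) / mass) = mass / mass"
    unfolding split_def integral_divide by (simp add: mass_def split_def)
  then show "integral unit_square (\<lambda>(s, t). density_fun (circ s) (circ t) / mass) = 1"
    using mass_pos by simp
qed

lemma compact_support_deltoid_measure: "compact (measure_support deltoid_measure)"
  unfolding deltoid_measure_def by (rule compact_support_push_measure[OF push_facts])

lemma continuous_on_cplx: "continuous_on A cplx"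
  unfolding cplx_def Complex_eq by (intro continuous_intros)

definition J :: "(complex \<Rightarrow> complex) \<Rightarrow> complex" where
  "J f = (LINT p|deltoid_measure. f (cplx p))"

lemma J_eq_torus_mean:
  assumes f: "continuous_on UNIV f"
  shows "J f = torus_mean (\<lambda>x y. of_real (density_fun x y) * f (point x y)) / of_real mass"
proof -
  have "continuous_on UNIV (\<lambda>p. f (cplx p))"
    by (rule continuous_on_compose2[OF f continuous_on_cplx]) auto
  then have "J f = integral unit_square (\<lambda>x. (case x of (s, t) \<Rightarrow> density_fun (circ s) (circ t) / mass)
      *\<^sub>R f (cplx (case x of (s, t) \<Rightarrow> (Re (point (circ s) (circ t)), Im (point (circ s) (circ t))))))"
    unfolding J_def deltoid_measure_def by (rule integral_push_measure[OF push_facts])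
  also have "\<dots> = integral unit_square (\<lambda>x. (case x of (s, t) \<Rightarrow>
      of_real (density_fun (circ s) (circ t)) * f (point (circ s) (circ t))) / of_real mass)"
    by (intro integral_cong) (auto simp: cplx_def scaleR_conv_of_real)
  also have "\<dots> = integral unit_square (\<lambda>(s, t).
      of_real (density_fun (circ s) (circ t)) * f (point (circ s) (circ t))) / of_real mass"
    by (rule integral_divide)
  also have "integral unit_square (\<lambda>(s, t).
      of_real (density_fun (circ s) (circ t)) * f (point (circ s) (circ t)))
      = torus_mean (\<lambda>x y. of_real (density_fun x y) * f (point x y))"
    by (rule torus_mean_eq_integral, rule torus_continuous_density)
      (use continuous_on_compose2[OF f continuous_on_point] in \<open>simp add: split_def\<close>)
  finally show ?thesis .
qed

lemma Q_functional_J: "Q_functional a c J"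
proof
  show "J (\<lambda>z. f z + g z) = J f + J g"
    if f: "continuous_on UNIV f" and g: "continuous_on UNIV g" for f g
  proof -
    have c: "continuous_on (circle \<times> circle) (\<lambda>(x, y). of_real (density_fun x y) * f (point x y))"
      if "continuous_on UNIV f" for f :: "complex \<Rightarrow> complex"
      by (rule torus_continuous_density)
        (use continuous_on_compose2[OF that continuous_on_point] in \<open>simp add: split_def\<close>)
    have "continuous_on UNIV (\<lambda>z. f z + g z)" using f g by (intro continuous_intros)
    then show ?thesis using torus_mean_add[OF c[OF f] c[OF g]]
      by (simp add: J_eq_torus_mean f g distrib_left add_divide_distrib)
  qed
  show "J (\<lambda>z. l * f z) = l * J f" for l f
    by (simp add: J_def)
  show "J (\<lambda>z. cnj (f z)) = cnj (J f)" for f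
    by (simp add: J_def)
  show "f = 0" if f: "f \<in> zpolys_less m" and J0: "J (\<lambda>z. f z * cnj (f z)) = 0" for f m
  proof (rule vanishing_if_integral_zero[OF f])
    let ?h = "\<lambda>x y. density_fun x y * (norm (f (point x y)))\<^sup>2"
    have hc: "continuous_on (circle \<times> circle) (\<lambda>(x, y). ?h x y)"
      using continuous_on_density torus_continuous_zpoly[OF f]
      unfolding split_def by (intro continuous_intros)
    have hcc: "continuous_on (circle \<times> circle) (\<lambda>(x, y). complex_of_real (?h x y))"
      using continuous_on_of_real[OF hc] by (simp only: split_def)
    have "continuous_on UNIV (\<lambda>z. f z * cnj (f z))"
      using zpolys_continuous[OF f] by (intro continuous_intros)
    then have "0 = torus_mean (\<lambda>x y. of_real (density_fun x y) * (f (point x y) * cnj (f (point x y))))"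
      using J0 mass_pos by (simp add: J_eq_torus_mean)
    also have "\<dots> = torus_mean (\<lambda>x y. complex_of_real (?h x y))"
      by (simp only: of_real_mult complex_norm_square)
    also have "\<dots> = integral unit_square (\<lambda>(s, t). complex_of_real (?h (circ s) (circ t)))"
      by (rule torus_mean_eq_integral[OF hcc, symmetric])
    also have "\<dots> = of_real (integral unit_square (\<lambda>(s, t). ?h (circ s) (circ t)))"
      using integral_linear[OF integrable_continuous[OF torus_continuous[OF hc]] bounded_linear_of_real, of "(0, 0)" "(1, 1)"]
      by (simp add: o_def split_def)
    finally show "integral unit_square (\<lambda>(s, t). ?h (circ s) (circ t)) = 0" by simp
  qed
  show "J (\<lambda>z. Q_poly a c m k z * cnj (R z)) = 0" if k: "k \<le> m" and R: "R \<in> zpolys_less m" for k m R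
  proof -
    have "continuous_on UNIV (\<lambda>z. Q_poly a c m k z * cnj (R z))"
      using zpolys_continuous[OF Q_poly_in_zpolys[OF k], of UNIV] zpolys_continuous[OF R, of UNIV]
      by (intro continuous_intros)
    then show ?thesis by (simp add: J_eq_torus_mean torus_Q_orthogonal[OF R k])
  qed
qed

lemma gaussian_cubature_deltoid_measure:
  assumes "m \<ge> 1"
  shows "gaussian_cubature_exists deltoid_measure m"
proof -
  obtain n where m: "m = Suc n" using assms by (cases m) auto
  interpret Q: Q_functional a c J by (rule Q_functional_J)
  obtain E :: "(complex \<Rightarrow> complex) set" and \<tau> wt where E: "card E = (m + 1) choose 2" "finite E" "inj_on \<tau> E"
    "\<forall>x\<in>E. wt x \<noteq> (0 :: real)" "\<And>h. h \<in> zpolys_less (2 * m) \<Longrightarrow> J h = (\<Sum>x\<in>E. of_real (wt x) * h (\<tau> x))"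
    using Q.cubature_exists[OF conjunct1[OF independent_monomials] conjunct2[OF independent_monomials], of n]
    unfolding m Suc_eq_plus1[symmetric] by blast
  obtain enum where enum: "bij_betw enum {1..card E} E"
    using ex_bij_betw_nat_finite_1[OF E(2)] by blast
  define node where "node k = (Re (\<tau> (enum k)), Im (\<tau> (enum k)))" for k
  have "inj_on node {1..card E}"
  proof (rule inj_onI)
    fix k l assume *: "k \<in> {1..card E}" "l \<in> {1..card E}" "node k = node l"
    then have "\<tau> (enum k) = \<tau> (enum l)" by (simp add: node_def complex_eq_iff)
    then have "enum k = enum l"
      by (rule inj_onD[OF E(3)]) (rule bij_betw_apply[OF enum *(1)], rule bij_betw_apply[OF enum *(2)])
    then show "k = l" by (rule inj_onD[OF bij_betw_imp_inj_on[OF enum]]) (rule *)+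
  qed
  moreover have "\<forall>k\<in>{1..card E}. wt (enum k) \<noteq> 0" using E(4) bij_betw_apply[OF enum] by blast
  moreover have "(LINT p|deltoid_measure. f p) = (\<Sum>k = 1..card E. wt (enum k) * f (node k))"
    if f: "f \<in> real_polys2 (2 * m - 1)" for f
  proof -
    have "(\<lambda>z. complex_of_real (f (Re z, Im z))) \<in> zpolys_less (2 * m)"
      using real_polys2_zpolys[OF f] assms by simp
    then have "J (\<lambda>z. complex_of_real (f (Re z, Im z))) = (\<Sum>x\<in>E. of_real (wt x) * of_real (f (Re (\<tau> x), Im (\<tau> x))))"
      by (rule E(5))
    also have "\<dots> = (\<Sum>k = 1..card E. of_real (wt (enum k)) * of_real (f (node k)))"
      unfolding node_def by (rule sum.reindex_bij_betw[OF enum, symmetric])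
    also have "\<dots> = of_real (\<Sum>k = 1..card E. wt (enum k) * f (node k))" by simp
    finally have "J (\<lambda>z. complex_of_real (f (Re z, Im z))) = \<dots>" .
    moreover have "J (\<lambda>z. complex_of_real (f (Re z, Im z))) = of_real (LINT p|deltoid_measure. f p)"
      by (simp add: J_def cplx_def)
    ultimately show ?thesis using of_real_eq_iff by metis
  qed
  ultimately show ?thesis
    unfolding gaussian_cubature_exists_def
    by (intro exI[of _ "card E"] exI[of _ node] exI[of _ "\<lambda>k. wt (enum k)"] conjI E(1)) blast+
qed

lemma Q_orthogonal_deltoid_measure: "Q_orthogonal a c deltoid_measure"
  using Q_functional.J_orthogonal[OF Q_functional_J] by (auto simp: Q_orthogonal_def J_def)

end

section \<open>Choice of the parameters\<close>

theorem corollary4p4: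
  fixes a c :: complex
  assumes "a \<noteq> 0" and "c \<noteq> 0"
    and "c * (c - a) \<in> \<real>"
    and "cmod c \<ge> 2 * cmod (c - a)"
  shows "\<exists>M :: (real \<times> real) measure.
    sets M = sets borel \<and> prob_space M \<and> compact (measure_support M) \<and>
    Q_orthogonal a c M \<and>
    (\<forall>m \<ge> 1. gaussian_cubature_exists M m)"
proof -
  define \<kappa> where "\<kappa> = exp (Ln (c\<^sup>2 * cnj c) / 3)"
  define e where "e = (c - a) / c"
  have k3: "\<kappa> ^ 3 = c\<^sup>2 * cnj c"
    using assms(2) by (simp add: \<kappa>_def exp_of_nat_mult[symmetric])
  \<comment> \<open>Comparing moduli gives |\<kappa>| = |c|, which is the second condition on
    \<kappa> in the locale \<open>deltoid\<close>.\<close>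
  then have "norm (\<kappa> ^ 3) = norm (c\<^sup>2 * cnj c)" by (rule arg_cong)
  then have "norm \<kappa> ^ 3 = norm c ^ 3"
    unfolding norm_mult norm_power complex_mod_cnj by (simp add: power2_eq_square power3_eq_cube)
  then have "norm \<kappa> = norm c" by (rule power_eq_imp_eq_base) auto
  then have kk: "\<kappa> * cnj \<kappa> = c * cnj c" unfolding complex_norm_square[symmetric] by (rule arg_cong)
  \<comment> \<open>The assumption on |c - a| enters here; it keeps the zeros of 1 - e x^3 outside
    the closed disc.\<close>
  have "norm e * norm c \<le> norm c / 2"
    using assms(2,4) by (simp add: e_def norm_divide)
  then have "norm e * norm c < 1 * norm c" using assms(2) by simp
  then have e1: "norm e < 1" by (rule mult_right_less_imp_less) simp
  have ae: "a = c * (1 - e)" using assms(2) by (simp add: e_def field_simps)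
  interpret deltoid a c \<kappa> e
    by unfold_locales (fact assms(2) k3 kk ae e1)+
  show ?thesis
    using sets_deltoid_measure prob_space_deltoid_measure compact_support_deltoid_measure
      Q_orthogonal_deltoid_measure gaussian_cubature_deltoid_measure by blast
qed

end
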